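(* For the log LG model $(X^\dagger,\phi,f)$ mirror to a projective toric manifold $Y$, the spectral sequence associated to the $u$-adic filtration of the complex $(\Theta^\bullet_{X^\dagger/0^\dagger}[[u]],\{f,-\}+u\partial)$ degenerates at the $E_1$ page; in particular there is an isomorphism (of $\mathbb C[[u]]$-modules) $$H^*(\Theta^\bullet_{X^\dagger/0^\dagger}[[u]],\{f,-\}+u\partial)\cong H^*(\Theta^\bullet_{X^\dagger/0^\dagger},\{f,-\})[[u]].$$
   Context: $N\cong\mathbb Z^n$, $M=\mathrm{Hom}(N,\mathbb Z)$; $\Sigma\subset N\otimes\mathbb R$ is a smooth complete fan whose toric variety $Y$ is projective. $\rho_1,\dots,\rho_d\in N$ are the primitive ray generators, numbered so that $\rho_1,\dots,\rho_n$ is a basis of $N$ and spans a maximal cone; $e^1,\dots,e^n\in M$ is the dual basis. $X\subset\mathbb C^d$ is the analytic space defined by the Stanley-Reisner ideal of $\Sigma$ (generated by the products $z_{i_1}\cdots z_{i_p}$ such that $\rho_{i_1},\dots,\rho_{i_p}$ do not lie in a common cone), equipped with its natural log structure $\phi:X^\dagger\to0^\dagger$ as central fibre of the toric degeneration $\mathrm{Spec}\,\mathbb C[\{(m,r)\in N\oplus\mathbb Z:r\ge\psi(m)\}]\to\mathrm{Spec}\,\mathbb C[\mathbb N]$, $\psi$ a strictly convex integral $\Sigma$-piecewise linear function. The relative log derivations $\Theta^1_{X^\dagger/0^\dagger}$ form a free $\mathcal O_X$-module with frame $\tilde\theta_k=\sum_{i=1}^d\langle\rho_i,e^k\rangle z_i\partial/\partial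 z_i$, $k=1,\dots,n$; $\Theta^i=\wedge^i\Theta^1$. $f=z_1+\dots+z_d$. With $\partial/\partial\tilde\theta_k$ the $\mathcal O_X$-linear odd derivations of $\Theta^\bullet$ dual to the frame, $\{f,-\}=\sum_k\tilde\theta_k(f)\,\partial/\partial\tilde\theta_k$ and $\partial=\sum_k\tilde\theta_k\circ\partial/\partial\tilde\theta_k$, where $\tilde\theta_k$ acts as a vector field on coefficients in the frame; both map $\Theta^i\to\Theta^{i-1}$. $u$ is a formal variable. Cohomology is hypercohomology on $X$ (equivalently, as $X$ is Stein, cohomology of global sections). *)

theory Defs
  imports "HOL-Analysis.Analysis" "HOL-Algebra.Module" "HOL-Algebra.AbelCoset"
    "HOL-Computational_Algebra.Formal_Power_Series"
begin

section \<open>Fans\<close>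

text \<open>
  The lattice \<open>N\<close> is \<open>int ^ 'n\<close>, and \<open>N \<otimes> \<real>\<close> is \<open>real ^ 'n\<close>; elements of
  \<open>M = Hom(N, \<int>)\<close> are additive functions \<open>int ^ 'n \<Rightarrow> int\<close>.
\<close>

definition lat :: "int ^ 'n \<Rightarrow> real ^ 'n" where
  "lat v = (\<chi> j. of_int (v $ j))"

definition cone_gen :: "(int ^ 'n) set \<Rightarrow> (real ^ 'n) set" where
  "cone_gen S = convex_cone hull (lat ` S)"

definition lattice_basis :: "('n \<Rightarrow> int ^ 'n) \<Rightarrow> bool" where
  "lattice_basis B \<longleftrightarrow> (\<forall>v. \<exists>!c :: 'n \<Rightarrow> int. v = (\<Sum>k\<in>UNIV. c k *s B k))"

text \<open>The library counts the empty set among the faces of a convex set; it is not a cone.\<close>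

definition is_fan :: "(real ^ 'n) set set \<Rightarrow> bool" where
  "is_fan \<Sigma> \<longleftrightarrow> finite \<Sigma> \<and> \<Sigma> \<noteq> {} \<and>
     (\<forall>\<sigma>\<in>\<Sigma>. (\<exists>S. finite S \<and> \<sigma> = cone_gen S) \<and> \<sigma> \<inter> uminus ` \<sigma> = {0}) \<and>
     (\<forall>\<sigma>\<in>\<Sigma>. \<forall>\<tau>. \<tau> face_of \<sigma> \<and> \<tau> \<noteq> {} \<longrightarrow> \<tau> \<in> \<Sigma>) \<and>
     (\<forall>\<sigma>\<in>\<Sigma>. \<forall>\<tau>\<in>\<Sigma>. (\<sigma> \<inter> \<tau>) face_of \<sigma> \<and> (\<sigma> \<inter> \<tau>) face_of \<tau>)"

definition complete_fan :: "(real ^ 'n) set set \<Rightarrow> bool" where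
  "complete_fan \<Sigma> \<longleftrightarrow> is_fan \<Sigma> \<and> \<Union>\<Sigma> = UNIV"

definition smooth_fan :: "(real ^ 'n) set set \<Rightarrow> bool" where
  "smooth_fan \<Sigma> \<longleftrightarrow> is_fan \<Sigma> \<and>
     (\<forall>\<sigma>\<in>\<Sigma>. \<exists>B J. lattice_basis B \<and> \<sigma> = cone_gen (B ` J))"

definition maximal_cone :: "(real ^ 'n) set set \<Rightarrow> (real ^ 'n) set \<Rightarrow> bool" where
  "maximal_cone \<Sigma> \<sigma> \<longleftrightarrow> \<sigma> \<in> \<Sigma> \<and> (\<forall>\<tau>\<in>\<Sigma>. \<sigma> \<subseteq> \<tau> \<longrightarrow> \<tau> = \<sigma>)"

definition primitive_vec :: "int ^ 'n \<Rightarrow> bool" where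
  "primitive_vec v \<longleftrightarrow> (\<forall>c w. v = c *s w \<longrightarrow> \<bar>c\<bar> = 1)"

definition ray_generators :: "(real ^ 'n) set set \<Rightarrow> ('d::finite \<Rightarrow> int ^ 'n) \<Rightarrow> bool" where
  "ray_generators \<Sigma> \<rho> \<longleftrightarrow> inj \<rho> \<and> (\<forall>i. primitive_vec (\<rho> i)) \<and>
     range (\<lambda>i. cone_gen {\<rho> i}) = {\<sigma> \<in> \<Sigma>. dim \<sigma> = 1}"

definition dual_basis :: "('n \<Rightarrow> int ^ 'n) \<Rightarrow> ('n \<Rightarrow> int ^ 'n \<Rightarrow> int) \<Rightarrow> bool" where
  "dual_basis B e \<longleftrightarrow> (\<forall>k v w. e k (v + w) = e k v + e k w) \<and>
     (\<forall>k l. e k (B l) = (if k = l then 1 else 0))"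

text \<open>
  For a complete fan, the existence of such a function \<open>\<psi>\<close> is the standard criterion for (and, in
  this development, the meaning of) projectivity of the toric variety. Convexity is understood in
  the sense making \<open>{(m, r). \<psi> m \<le> r}\<close> convex.
\<close>

definition integral_PL :: "(real ^ 'n) set set \<Rightarrow> (real ^ 'n \<Rightarrow> real) \<Rightarrow> bool" where
  "integral_PL \<Sigma> \<psi> \<longleftrightarrow>
     (\<forall>\<sigma>\<in>\<Sigma>. \<exists>l. linear l \<and> (\<forall>v. l (lat v) \<in> \<int>) \<and> (\<forall>x\<in>\<sigma>. \<psi> x = l x))"

definition strictly_convex_PL :: "(real ^ 'n) set set \<Rightarrow> (real ^ 'n \<Rightarrow> real) \<Rightarrow> bool" where
  "strictly_convex_PL \<Sigma> \<psi> \<longleftrightarrow> integral_PL \<Sigma> \<psi> \<and> convex_on UNIV \<psi> \<and>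
     (\<forall>\<sigma> \<tau> l. maximal_cone \<Sigma> \<sigma> \<and> maximal_cone \<Sigma> \<tau> \<and> linear l \<and> (\<forall>x\<in>\<sigma> \<union> \<tau>. \<psi> x = l x)
        \<longrightarrow> \<sigma> = \<tau>)"


section \<open>The analytic space of the Stanley-Reisner ideal\<close>

definition holo_on :: "(complex ^ 'd \<Rightarrow> complex) \<Rightarrow> (complex ^ 'd) set \<Rightarrow> bool" where
  "holo_on g U \<longleftrightarrow> (\<forall>z\<in>U. \<exists>D. (g has_derivative D) (at z) \<and> (\<forall>c v. D (c *s v) = c * D v))"

definition nonfaces :: "(real ^ 'n) set set \<Rightarrow> ('d::finite \<Rightarrow> int ^ 'n) \<Rightarrow> 'd set set" where
  "nonfaces \<Sigma> \<rho> = {S. \<not> (\<exists>\<sigma>\<in>\<Sigma>. \<forall>i\<in>S. lat (\<rho> i) \<in> \<sigma>)}"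

text \<open>
  \<open>SR_cong \<Sigma> \<rho> x g h\<close>: the germs at \<open>x\<close> of \<open>g\<close> and \<open>h\<close> are holomorphic and congruent modulo the
  ideal of \<open>\<O>\<^bsub>\<complex>\<^sup>d,x\<^esub>\<close> generated by the Stanley-Reisner monomials. An element of the stalk of
  \<open>\<O> / I\<close> at \<open>x\<close> is represented by the set of all functions on \<open>\<complex>\<^sup>d\<close> whose germ at \<open>x\<close> lies in it.
\<close>

definition SR_cong ::
  "(real ^ 'n) set set \<Rightarrow> ('d::finite \<Rightarrow> int ^ 'n) \<Rightarrow> complex ^ 'd \<Rightarrow>
   (complex ^ 'd \<Rightarrow> complex) \<Rightarrow> (complex ^ 'd \<Rightarrow> complex) \<Rightarrow> bool" where
  "SR_cong \<Sigma> \<rho> x g h \<longleftrightarrow>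
     (\<exists>U a. open U \<and> x \<in> U \<and> holo_on g U \<and> holo_on h U \<and>
        (\<forall>S\<in>nonfaces \<Sigma> \<rho>. holo_on (a S) U) \<and>
        (\<forall>z\<in>U. g z - h z = (\<Sum>S\<in>nonfaces \<Sigma> \<rho>. a S z * (\<Prod>i\<in>S. z $ i))))"

type_synonym 'd sec = "complex ^ 'd \<Rightarrow> (complex ^ 'd \<Rightarrow> complex) set"

definition restr ::
  "(real ^ 'n) set set \<Rightarrow> ('d::finite \<Rightarrow> int ^ 'n) \<Rightarrow> (complex ^ 'd \<Rightarrow> complex) \<Rightarrow> 'd sec" where
  "restr \<Sigma> \<rho> g = (\<lambda>x. {h. SR_cong \<Sigma> \<rho> x h g})"

text \<open>
  The ring \<open>\<Gamma>(X, \<O>\<^sub>X)\<close>: families of elements of the stalks of the quotient sheaf \<open>\<O> / I\<close> on \<open>\<complex>\<^sup>d\<close>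
  that are locally induced by holomorphic functions. The stalks vanish off the support \<open>X\<close> of
  \<open>\<O> / I\<close>, so sections over \<open>\<complex>\<^sup>d\<close> and over \<open>X\<close> are the same.
\<close>

definition OX :: "(real ^ 'n) set set \<Rightarrow> ('d::finite \<Rightarrow> int ^ 'n) \<Rightarrow> 'd sec ring" where
  "OX \<Sigma> \<rho> =
     \<lparr>carrier = {s. \<forall>x. \<exists>U g. open U \<and> x \<in> U \<and> holo_on g U \<and> (\<forall>y\<in>U. s y = restr \<Sigma> \<rho> g y)},
      mult = (\<lambda>s t x. {h. \<exists>a\<in>s x. \<exists>b\<in>t x. SR_cong \<Sigma> \<rho> x h (\<lambda>z. a z * b z)}),
      one = restr \<Sigma> \<rho> (\<lambda>_. 1),
      zero = restr \<Sigma> \<rho> (\<lambda>_. 0),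
      add = (\<lambda>s t x. {h. \<exists>a\<in>s x. \<exists>b\<in>t x. SR_cong \<Sigma> \<rho> x h (\<lambda>z. a z + b z)})\<rparr>"

text \<open>The vector field \<open>\<Sum>\<^sub>i \<langle>\<rho>\<^sub>i, m\<rangle> z\<^sub>i \<partial>/\<partial>z\<^sub>i\<close> on \<open>\<complex>\<^sup>d\<close> preserves \<open>I\<close>; \<open>vf\<close> is the induced derivation
  of \<open>\<Gamma>(X, \<O>\<^sub>X)\<close>. For \<open>m = e\<^sup>k\<close> this is \<open>\<theta>\<^sub>k\<close>.\<close>

definition vf_amb ::
  "('d::finite \<Rightarrow> int ^ 'n) \<Rightarrow> (int ^ 'n \<Rightarrow> int) \<Rightarrow> (complex ^ 'd \<Rightarrow> complex) \<Rightarrow> complex ^ 'd \<Rightarrow> complex" where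
  "vf_amb \<rho> m g = (\<lambda>z. \<Sum>i\<in>UNIV. of_int (m (\<rho> i)) * z $ i * frechet_derivative g (at z) (axis i 1))"

definition vf ::
  "(real ^ 'n) set set \<Rightarrow> ('d::finite \<Rightarrow> int ^ 'n) \<Rightarrow> (int ^ 'n \<Rightarrow> int) \<Rightarrow> 'd sec \<Rightarrow> 'd sec" where
  "vf \<Sigma> \<rho> m s = (\<lambda>x. {h. \<exists>g\<in>s x. SR_cong \<Sigma> \<rho> x h (vf_amb \<rho> m g)})"

definition superpotential :: "(real ^ 'n) set set \<Rightarrow> ('d::finite \<Rightarrow> int ^ 'n) \<Rightarrow> 'd sec" where
  "superpotential \<Sigma> \<rho> = restr \<Sigma> \<rho> (\<lambda>z. \<Sum>i\<in>UNIV. z $ i)"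


section \<open>Log polyvector fields\<close>

text \<open>
  Global sections of \<open>\<Theta>\<^sup>i\<close>, the \<open>i\<close>-th exterior power of the free module \<open>\<Theta>\<^sup>1\<close> of relative log
  derivations with frame \<open>\<theta>\<^sub>k\<close>: a family \<open>g\<close> stands for
  \<open>\<Sum> g I \<theta>\<^bsub>k\<^sub>1\<^esub> \<and> \<dots> \<and> \<theta>\<^bsub>k\<^sub>i\<^esub>\<close>, the sum over \<open>I = {k\<^sub>1 < \<dots> < k\<^sub>i}\<close>. The degree is an integer and
  \<open>\<Theta>\<^sup>i = 0\<close> for \<open>i < 0\<close>. In module records the fields \<open>mult\<close> and \<open>one\<close> are irrelevant.
\<close>

type_synonym ('n, 'd) pvec = "'n set \<Rightarrow> 'd sec"

definition Theta ::
  "(real ^ 'n) set set \<Rightarrow> ('d::finite \<Rightarrow> int ^ 'n) \<Rightarrow> int \<Rightarrow> (complex, ('n, 'd) pvec) module" where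
  "Theta \<Sigma> \<rho> i =
     \<lparr>carrier = {g. (\<forall>I. g I \<in> carrier (OX \<Sigma> \<rho>)) \<and> (\<forall>I. int (card I) \<noteq> i \<longrightarrow> g I = \<zero>\<^bsub>OX \<Sigma> \<rho>\<^esub>)},
      mult = undefined,
      one = undefined,
      zero = (\<lambda>I. \<zero>\<^bsub>OX \<Sigma> \<rho>\<^esub>),
      add = (\<lambda>g h I. g I \<oplus>\<^bsub>OX \<Sigma> \<rho>\<^esub> h I),
      smult = (\<lambda>c g I. restr \<Sigma> \<rho> (\<lambda>_. c) \<otimes>\<^bsub>OX \<Sigma> \<rho>\<^esub> g I)\<rparr>"

definition ddtheta ::
  "(real, 'n::{finite,linorder}) vec set set \<Rightarrow> ('d::finite \<Rightarrow> (int, 'n) vec) \<Rightarrow> 'n \<Rightarrow>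
   ('n, 'd) pvec \<Rightarrow> ('n, 'd) pvec" where
  "ddtheta \<Sigma> \<rho> k g = (\<lambda>I. if k \<in> I then \<zero>\<^bsub>OX \<Sigma> \<rho>\<^esub>
     else if even (card {l\<in>I. l < k}) then g (insert k I) else \<ominus>\<^bsub>OX \<Sigma> \<rho>\<^esub> g (insert k I))"

definition bracket_f ::
  "(real, 'n::{finite,linorder}) vec set set \<Rightarrow> ('d::finite \<Rightarrow> (int, 'n) vec) \<Rightarrow> ('n \<Rightarrow> (int, 'n) vec \<Rightarrow> int) \<Rightarrow>
   ('n, 'd) pvec \<Rightarrow> ('n, 'd) pvec" where
  "bracket_f \<Sigma> \<rho> e g = (\<lambda>I. \<Oplus>\<^bsub>OX \<Sigma> \<rho>\<^esub>k\<in>UNIV.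
     vf \<Sigma> \<rho> (e k) (superpotential \<Sigma> \<rho>) \<otimes>\<^bsub>OX \<Sigma> \<rho>\<^esub> ddtheta \<Sigma> \<rho> k g I)"

definition bv ::
  "(real, 'n::{finite,linorder}) vec set set \<Rightarrow> ('d::finite \<Rightarrow> (int, 'n) vec) \<Rightarrow> ('n \<Rightarrow> (int, 'n) vec \<Rightarrow> int) \<Rightarrow>
   ('n, 'd) pvec \<Rightarrow> ('n, 'd) pvec" where
  "bv \<Sigma> \<rho> e g = (\<lambda>I. \<Oplus>\<^bsub>OX \<Sigma> \<rho>\<^esub>k\<in>UNIV. vf \<Sigma> \<rho> (e k) (ddtheta \<Sigma> \<rho> k g I))"


section \<open>Homological algebra\<close>

definition quot_module :: "('r, 'm) module \<Rightarrow> 'm set \<Rightarrow> ('r, 'm set) module" where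
  "quot_module M B =
     \<lparr>carrier = a_rcosets\<^bsub>M\<^esub> B,
      mult = undefined,
      one = undefined,
      zero = B,
      add = (\<lambda>K L. K <+>\<^bsub>M\<^esub> L),
      smult = (\<lambda>a K. \<Union>x\<in>K. B +>\<^bsub>M\<^esub> (a \<odot>\<^bsub>M\<^esub> x))\<rparr>"

text \<open>
  Complexes have differential of degree \<open>-1\<close>: a family \<open>C\<close> of modules with a map \<open>d\<close> taking
  \<open>C i\<close> to \<open>C (i - 1)\<close>.
\<close>

definition homology ::
  "(int \<Rightarrow> ('r, 'm) module) \<Rightarrow> ('m \<Rightarrow> 'm) \<Rightarrow> int \<Rightarrow> ('r, 'm set) module" where
  "homology C d i = quot_module
     ((C i)\<lparr>carrier := {x \<in> carrier (C i). d x = \<zero>\<^bsub>C (i - 1)\<^esub>}\<rparr>) (d ` carrier (C (i + 1)))"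

definition pser_module :: "('c::comm_ring_1, 'm) module \<Rightarrow> ('c fps, nat \<Rightarrow> 'm) module" where
  "pser_module M =
     \<lparr>carrier = {x. \<forall>j. x j \<in> carrier M},
      mult = undefined,
      one = undefined,
      zero = (\<lambda>j. \<zero>\<^bsub>M\<^esub>),
      add = (\<lambda>x y j. x j \<oplus>\<^bsub>M\<^esub> y j),
      smult = (\<lambda>a x j. \<Oplus>\<^bsub>M\<^esub>i\<in>{..j}. fps_nth a i \<odot>\<^bsub>M\<^esub> x (j - i))\<rparr>"

definition module_iso :: "('r, 'm) module \<Rightarrow> ('r, 'k) module \<Rightarrow> bool" where
  "module_iso M M' \<longleftrightarrow> (\<exists>\<phi>. bij_betw \<phi> (carrier M) (carrier M') \<and>
     (\<forall>x\<in>carrier M. \<forall>y\<in>carrier M. \<phi> (x \<oplus>\<^bsub>M\<^esub> y) = \<phi> x \<oplus>\<^bsub>M'\<^esub> \<phi> y) \<and>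
     (\<forall>a. \<forall>x\<in>carrier M. \<phi> (a \<odot>\<^bsub>M\<^esub> x) = a \<odot>\<^bsub>M'\<^esub> \<phi> x))"

text \<open>
  The spectral sequence of a complex with decreasing filtration \<open>F p i \<subseteq> C i\<close>:
  \<open>E\<^sub>r\<^sup>p = Z\<^sub>r\<^sup>p / (Z\<^bsub>r-1\<^esub>\<^bsup>p+1\<^esup> + d Z\<^bsub>r-1\<^esub>\<^bsup>p-r+1\<^esup>)\<close> for \<open>r \<ge> 1\<close>, where
  \<open>Z\<^sub>r\<^sup>p = {x \<in> F\<^sup>p. d x \<in> F\<^bsup>p+r\<^esup>}\<close>, with \<open>d\<^sub>r : E\<^sub>r\<^sup>p \<rightarrow> E\<^sub>r\<^bsup>p+r\<^esup>\<close> induced by \<open>d\<close>; in particular \<open>E\<^sub>1\<close> is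
  the homology of the associated graded complex.
\<close>

definition ss_Z :: "('m \<Rightarrow> 'm) \<Rightarrow> (int \<Rightarrow> int \<Rightarrow> 'm set) \<Rightarrow> int \<Rightarrow> int \<Rightarrow> int \<Rightarrow> 'm set" where
  "ss_Z d F r p i = {x \<in> F p i. d x \<in> F (p + r) (i - 1)}"

definition ss_B ::
  "(int \<Rightarrow> ('r, 'm) module) \<Rightarrow> ('m \<Rightarrow> 'm) \<Rightarrow> (int \<Rightarrow> int \<Rightarrow> 'm set) \<Rightarrow> int \<Rightarrow> int \<Rightarrow> int \<Rightarrow> 'm set" where
  "ss_B C d F r p i =
     ss_Z d F (r - 1) (p + 1) i <+>\<^bsub>C i\<^esub> d ` ss_Z d F (r - 1) (p - r + 1) (i + 1)"

definition ss_page ::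
  "(int \<Rightarrow> ('r, 'm) module) \<Rightarrow> ('m \<Rightarrow> 'm) \<Rightarrow> (int \<Rightarrow> int \<Rightarrow> 'm set) \<Rightarrow> int \<Rightarrow> int \<Rightarrow> int \<Rightarrow>
   ('r, 'm set) module" where
  "ss_page C d F r p i = quot_module ((C i)\<lparr>carrier := ss_Z d F r p i\<rparr>) (ss_B C d F r p i)"

definition ss_diff ::
  "(int \<Rightarrow> ('r, 'm) module) \<Rightarrow> ('m \<Rightarrow> 'm) \<Rightarrow> (int \<Rightarrow> int \<Rightarrow> 'm set) \<Rightarrow> int \<Rightarrow> int \<Rightarrow> int \<Rightarrow>
   'm set \<Rightarrow> 'm set" where
  "ss_diff C d F r p i K = (\<Union>x\<in>K. ss_B C d F r (p + r) (i - 1) +>\<^bsub>C (i - 1)\<^esub> d x)"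

definition degenerates_at_E1 ::
  "(int \<Rightarrow> ('r, 'm) module) \<Rightarrow> ('m \<Rightarrow> 'm) \<Rightarrow> (int \<Rightarrow> int \<Rightarrow> 'm set) \<Rightarrow> bool" where
  "degenerates_at_E1 C d F \<longleftrightarrow> (\<forall>r\<ge>1. \<forall>p i. \<forall>K\<in>carrier (ss_page C d F r p i).
     ss_diff C d F r p i K = \<zero>\<^bsub>ss_page C d F r (p + r) (i - 1)\<^esub>)"

definition u_adic ::
  "(int \<Rightarrow> ('c::comm_ring_1 fps, 'm) module) \<Rightarrow> int \<Rightarrow> int \<Rightarrow> 'm set" where
  "u_adic C p i = (\<lambda>x. fps_X ^ nat p \<odot>\<^bsub>C i\<^esub> x) ` carrier (C i)"


section \<open>The twisted complex\<close>

definition Theta_u ::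
  "(real ^ 'n) set set \<Rightarrow> ('d::finite \<Rightarrow> int ^ 'n) \<Rightarrow> int \<Rightarrow> (complex fps, nat \<Rightarrow> ('n, 'd) pvec) module" where
  "Theta_u \<Sigma> \<rho> i = pser_module (Theta \<Sigma> \<rho> i)"

text \<open>The operator \<open>{f,-} + u \<partial>\<close>, extended \<open>u\<close>-linearly; a sequence \<open>x\<close> stands for \<open>\<Sum>\<^sub>j x\<^sub>j u\<^sup>j\<close>.\<close>

definition twisted_d ::
  "(real, 'n::{finite,linorder}) vec set set \<Rightarrow> ('d::finite \<Rightarrow> (int, 'n) vec) \<Rightarrow> ('n \<Rightarrow> (int, 'n) vec \<Rightarrow> int) \<Rightarrow>
   (nat \<Rightarrow> ('n, 'd) pvec) \<Rightarrow> nat \<Rightarrow> ('n, 'd) pvec" where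
  "twisted_d \<Sigma> \<rho> e x = (\<lambda>j I. case j of
       0 \<Rightarrow> bracket_f \<Sigma> \<rho> e (x 0) I
     | Suc j' \<Rightarrow> bracket_f \<Sigma> \<rho> e (x j) I \<oplus>\<^bsub>OX \<Sigma> \<rho>\<^esub> bv \<Sigma> \<rho> e (x j') I)"

end

theory Submission
  imports Defs "HOL-Complex_Analysis.Complex_Analysis"
begin

text \<open>
  The elements \<open>\<theta>\<^sub>k(f)\<close> form a regular sequence on \<open>\<Gamma>(X, \<O>\<^sub>X)\<close>, so the Koszul complex
  \<open>(\<Theta>\<^sup>\<bullet>, {f, -})\<close> is exact in positive degrees. Then \<open>E\<^sub>1\<close> is concentrated in degree 0, all
  differentials of the spectral sequence vanish, and a \<open>\<complex>\<close>-linear complement of the image of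
  \<open>{f, -}\<close> in \<open>\<Theta>\<^sup>0\<close> gives the isomorphism.

  For exactness, \<open>\<Gamma>(X, \<O>\<^sub>X)\<close> is identified with the entire functions on \<open>\<complex>\<^sup>d\<close> modulo those
  vanishing on \<open>X\<close>, the union of the coordinate subspaces of the maximal cones. Strict
  convexity of \<open>\<psi>\<close> yields a shelling of the fan. Adding the subspaces in the order of the
  shelling, each step contributes a Koszul complex on a single subspace, where the
  \<open>\<theta>\<^sub>k(f)\<close> are linear coordinates because \<open>\<Sigma>\<close> is smooth.
\<close>

unbundle no fps_syntax

section \<open>Holomorphic functions of several variables\<close>

text \<open>Regularity of the \<open>\<theta>\<^sub>k(f)\<close> is the Cohen-Macaulay property of
  the Stanley-Reisner ring, with holomorphic functions in place of polynomials. The shelling cuts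
  the ring into pieces that live on one coordinate subspace each and are generated there by a single
  squarefree monomial. The analytic obstacle is division: quotients by linear forms and by monomials
  must stay holomorphic on the zero sets of the divisors. All of them come from one integral
  formula, \<open>divq\<close>, whose holomorphy rests on Cauchy's formula and differentiation under
  the integral. The passage from germs to entire functions uses the coordinate projections
  \<open>pr A\<close>; they map \<open>X\<close> into itself and give explicit formulas where one
  would otherwise invoke vanishing theorems on Stein spaces. Power series in \<open>u\<close> are
  arbitrary sequences of coefficients, so equations for the twisted differential are solved one
  power of \<open>u\<close> at a time and raise no question of convergence.\<close>

abbreviation dd :: "(complex ^ 'd \<Rightarrow> complex) \<Rightarrow> complex ^ 'd \<Rightarrow> complex ^ 'd \<Rightarrow> complex" where
  "dd g v z \<equiv> frechet_derivative g (at z) v"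

lemma holo_on_has_derivative:
  assumes "holo_on g U" "z \<in> U"
  shows "(g has_derivative frechet_derivative g (at z)) (at z)"
  using assms unfolding holo_on_def by (meson differentiable_def frechet_derivative_works)

lemma holo_on_dd_smult:
  assumes "holo_on g U" "z \<in> U"
  shows "dd g (c *s v) z = c * dd g v z"
  using assms unfolding holo_on_def by (metis frechet_derivative_at)

lemma holo_onI:
  assumes "\<And>z. z \<in> U \<Longrightarrow> (g has_derivative D z) (at z)"
    and "\<And>z c v. z \<in> U \<Longrightarrow> D z (c *s v) = c * D z v"
  shows "holo_on g U"
  using assms unfolding holo_on_def by blast

lemma holo_on_subset: "holo_on g U \<Longrightarrow> V \<subseteq> U \<Longrightarrow> holo_on g V"
  unfolding holo_on_def by blast

lemma holo_on_continuous_on: "holo_on g U \<Longrightarrow> continuous_on U g"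
  by (meson continuous_at_imp_continuous_on has_derivative_continuous holo_on_has_derivative)

lemma holo_on_local:
  assumes "\<And>z. z \<in> U \<Longrightarrow> \<exists>V. z \<in> V \<and> holo_on g V"
  shows "holo_on g U"
  using assms unfolding holo_on_def by blast

lemma holo_on_cong:
  assumes "holo_on g U" "open U" "\<And>z. z \<in> U \<Longrightarrow> g z = h z"
  shows "holo_on h U"
proof (rule holo_onI)
  fix z assume z: "z \<in> U"
  show "(h has_derivative frechet_derivative g (at z)) (at z)"
    by (rule has_derivative_transform_within_open[OF holo_on_has_derivative[OF assms(1) z] assms(2) z assms(3)])
qed (use assms holo_on_dd_smult in blast)

lemma dd_cong:
  assumes "open U" "z \<in> U" "\<And>z. z \<in> U \<Longrightarrow> g z = h z" "holo_on g U"
  shows "dd g v z = dd h v z"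
proof -
  have "(h has_derivative frechet_derivative g (at z)) (at z)"
    by (rule has_derivative_transform_within_open[OF holo_on_has_derivative[OF assms(4,2)] assms(1,2,3)])
  from fun_cong[OF frechet_derivative_at[OF this, symmetric]] show ?thesis by simp
qed

lemma holo_on_const: "holo_on (\<lambda>_. c) U"
  by (rule holo_onI[where D = "\<lambda>_ _. 0"]) auto

lemma holo_on_nth: "holo_on (\<lambda>z. z $ i) U"
  by (rule holo_onI[where D = "\<lambda>_ v. v $ i"])
     (auto intro: bounded_linear_imp_has_derivative bounded_linear_vec_nth)

lemma holo_on_add:
  assumes "holo_on g U" "holo_on h U"
  shows "holo_on (\<lambda>z. g z + h z) U"
  by (rule holo_onI[where D = "\<lambda>z v. dd g v z + dd h v z"])
     (auto intro!: has_derivative_add holo_on_has_derivative[OF assms(1)]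
       holo_on_has_derivative[OF assms(2)]
       simp: holo_on_dd_smult[OF assms(1)] holo_on_dd_smult[OF assms(2)] algebra_simps)

lemma holo_on_mult:
  assumes "holo_on g U" "holo_on h U"
  shows "holo_on (\<lambda>z. g z * h z) U"
proof (rule holo_onI[where D = "\<lambda>z v. g z * dd h v z + dd g v z * h z"])
  fix z assume "z \<in> U"
  thus "((\<lambda>z. g z * h z) has_derivative (\<lambda>v. g z * dd h v z + dd g v z * h z)) (at z)"
    by (intro has_derivative_mult holo_on_has_derivative[OF assms(1)] holo_on_has_derivative[OF assms(2)])
qed (simp add: holo_on_dd_smult[OF assms(1)] holo_on_dd_smult[OF assms(2)] algebra_simps)

lemma dd_add:
  assumes "holo_on g U" "holo_on h U" "z \<in> U"
  shows "dd (\<lambda>z. g z + h z) v z = dd g v z + dd h v z"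
  by (rule fun_cong[OF frechet_derivative_at[OF has_derivative_add[OF
        holo_on_has_derivative[OF assms(1,3)] holo_on_has_derivative[OF assms(2,3)]], symmetric]])

lemma dd_mult:
  assumes "holo_on g U" "holo_on h U" "z \<in> U"
  shows "dd (\<lambda>z. g z * h z) v z = g z * dd h v z + dd g v z * h z"
  by (rule fun_cong[OF frechet_derivative_at[OF has_derivative_mult[OF
        holo_on_has_derivative[OF assms(1,3)] holo_on_has_derivative[OF assms(2,3)]], symmetric]])

lemma dd_const: "dd (\<lambda>_. c) v z = 0"
  by (metis frechet_derivative_const)

lemma dd_nth: "dd (\<lambda>z. z $ i) v z = v $ i"
proof -
  have "((\<lambda>z. z $ i) has_derivative (\<lambda>v. v $ i)) (at z)"
    by (rule bounded_linear_imp_has_derivative[OF bounded_linear_vec_nth])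
  from fun_cong[OF frechet_derivative_at[OF this, symmetric]] show ?thesis .
qed

lemma holo_on_uminus: "holo_on g U \<Longrightarrow> holo_on (\<lambda>z. - g z) U"
  using holo_on_mult[OF holo_on_const[of "-1"]] by fastforce

lemma holo_on_diff: "holo_on g U \<Longrightarrow> holo_on h U \<Longrightarrow> holo_on (\<lambda>z. g z - h z) U"
  using holo_on_add[OF _ holo_on_uminus] by fastforce

lemma holo_on_sum: "(\<And>i. i \<in> I \<Longrightarrow> holo_on (g i) U) \<Longrightarrow> holo_on (\<lambda>z. \<Sum>i\<in>I. g i z) U"
  by (induction I rule: infinite_finite_induct) (auto intro: holo_on_const holo_on_add)

lemma holo_on_prod: "(\<And>i. i \<in> I \<Longrightarrow> holo_on (g i) U) \<Longrightarrow> holo_on (\<lambda>z. \<Prod>i\<in>I. g i z) U"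
  by (induction I rule: infinite_finite_induct) (auto intro: holo_on_const holo_on_mult)

lemma dd_sum:
  assumes "\<And>i. i \<in> I \<Longrightarrow> holo_on (g i) U" "z \<in> U"
  shows "dd (\<lambda>z. \<Sum>i\<in>I. g i z) v z = (\<Sum>i\<in>I. dd (g i) v z)"
  using assms(1)
proof (induction I rule: infinite_finite_induct)
  case (insert i I)
  thus ?case
    using dd_add[OF insert.prems[of i] holo_on_sum[of I g U] assms(2), of v] by simp
qed (auto simp: dd_const)

lemma holo_on_inverse:
  assumes "holo_on g U" "\<And>z. z \<in> U \<Longrightarrow> g z \<noteq> 0"
  shows "holo_on (\<lambda>z. inverse (g z)) U"
proof (rule holo_onI[where D = "\<lambda>z v. - (inverse (g z) * dd g v z * inverse (g z))"])
  fix z assume "z \<in> U"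
  thus "((\<lambda>z. inverse (g z)) has_derivative (\<lambda>v. - (inverse (g z) * dd g v z * inverse (g z)))) (at z)"
    by (intro Deriv.has_derivative_inverse holo_on_has_derivative[OF assms(1)] assms(2))
qed (simp add: holo_on_dd_smult[OF assms(1)])

lemma holo_on_compose:
  assumes "holo_on g V" "\<And>z. z \<in> U \<Longrightarrow> A z \<in> V"
    and "\<And>z. z \<in> U \<Longrightarrow> (A has_derivative L) (at z)" "\<And>c v. L (c *s v) = c *s L v"
  shows "holo_on (\<lambda>z. g (A z)) U"
  by (rule holo_onI[where D = "\<lambda>z v. dd g (L v) (A z)"])
     (auto intro!: has_derivative_compose[OF assms(3) holo_on_has_derivative[OF assms(1)]]
       simp: assms(2,4) holo_on_dd_smult[OF assms(1)])

section \<open>Cauchy's formula along complex lines, and differentiation under the integral\<close>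

lemma bounded_linear_vector_smult_left: "bounded_linear (\<lambda>w::complex. w *s (v :: complex ^ 'd))"
proof -
  have "linear (\<lambda>w::complex. w *s v)"
    by (rule linearI) (auto simp: vec_eq_iff algebra_simps)
  thus ?thesis by (simp add: linear_conv_bounded_linear)
qed

lemmas continuous_on_smult_left [continuous_intros] =
  bounded_linear.continuous_on[OF bounded_linear_vector_smult_left]

text \<open>Cauchy's formula for the derivative at 0 of the function \<open>g (z + w *s v)\<close>
  of \<open>w\<close>, on a circle of radius \<open>r\<close>. Only values of \<open>g\<close> stand
  on the right, so regularity in \<open>z\<close> can be read off from parameter integrals.\<close>

lemma dd_Cauchy:
  assumes "holo_on g V" "open V" "r > 0" "\<And>w. norm w \<le> r \<Longrightarrow> z + w *s v \<in> V"
  shows "dd g v z = integral {0..1} (\<lambda>t. exp (- (2 * pi * \<i> * of_real t)) / r * g (z + (r * exp (2 * pi * \<i> * of_real t)) *s v))"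
proof -
  let ?f = "\<lambda>w. g (z + w *s v)"
  \<comment> \<open>The chain rule gives a real derivative; complex linearity of the derivative of
    \<open>g\<close> makes it multiplication by a complex number.\<close>
  have der: "(?f has_field_derivative dd g v (z + w *s v)) (at w)" if "z + w *s v \<in> V" for w
  proof -
    have A: "((\<lambda>w. z + w *s v) has_derivative (\<lambda>w. 0 + w *s v)) (at w)"
      by (intro has_derivative_add has_derivative_const
          bounded_linear_imp_has_derivative bounded_linear_vector_smult_left)
    from has_derivative_compose[OF A holo_on_has_derivative[OF assms(1) that]]
    have "(?f has_derivative (\<lambda>w'. w' * dd g v (z + w *s v))) (at w)"
      using holo_on_dd_smult[OF assms(1) that] by simp
    moreover have "(\<lambda>w'. w' * dd g v (z + w *s v)) = (*) (dd g v (z + w *s v))"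
      by (simp add: fun_eq_iff)
    ultimately show ?thesis
      by (simp add: has_field_derivative_def)
  qed
  have cont: "continuous_on (cball 0 r) ?f"
    by (intro continuous_at_imp_continuous_on ballI DERIV_isCont[OF der] assms(4)) auto
  have hol: "?f holomorphic_on ball 0 r"
    unfolding holomorphic_on_def field_differentiable_def
    using der assms(4) by (meson DERIV_subset has_field_derivative_at_within less_imp_le mem_ball_0)
  have d0: "deriv ?f 0 = dd g v z"
    using der[of 0] assms(3) assms(4)[of 0] by (simp add: DERIV_imp_deriv)
  have "2 * pi * \<i> * dd g v z = contour_integral (circlepath 0 r) (\<lambda>u. ?f u / (u - 0)^2)"
    using Cauchy_contour_integral_circlepath_2[OF cont hol, of 0] assms(3) d0 by simp
  \<comment> \<open>For the circle \<open>gamma t = r * exp (2 * pi * \<i> * t)\<close> one has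
    \<open>gamma' / gamma^2 = 2 * pi * \<i> * exp (- 2 * pi * \<i> * t) / r\<close>.\<close>
  also have "\<dots> = integral {0..1} (\<lambda>t. 2 * pi * \<i> * (exp (- (2 * pi * \<i> * of_real t)) / r * g (z + (r * exp (2 * pi * \<i> * of_real t)) *s v)))"
    unfolding contour_integral_integral
    by (rule integral_cong)
       (unfold vector_derivative_circlepath, use assms(3) in \<open>auto simp: circlepath power2_eq_square exp_minus field_simps\<close>)
  also have "\<dots> = 2 * pi * \<i> * integral {0..1} (\<lambda>t. exp (- (2 * pi * \<i> * of_real t)) / r * g (z + (r * exp (2 * pi * \<i> * of_real t)) *s v))"
    by (rule integral_mult_right)
  finally show ?thesis by (simp only: mult_cancel_left) simp
qed

text \<open>Cauchy's formula is to be applied with one radius for all centres near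
  \<open>z0\<close>: half of the available distance \<open>d\<close> is left to the centre, a
  quarter to the circle.\<close>

lemma Cauchy_nbhd:
  fixes z0 v :: "complex ^ 'd"
  assumes "open V" "z0 \<in> V"
  obtains r N where "r > 0" "open N" "convex N" "z0 \<in> N"
    "\<And>z w. z \<in> N \<Longrightarrow> norm w \<le> r \<Longrightarrow> z + w *s v \<in> V"
proof -
  obtain d where d: "d > 0" "ball z0 d \<subseteq> V" using assms by (meson openE)
  obtain K where K: "K > 0" "\<And>w::complex. norm (w *s v) \<le> norm w * K"
    using bounded_linear.pos_bounded[OF bounded_linear_vector_smult_left[of v]] by blast
  show ?thesis
  proof (rule that[of "d / 4 / K" "ball z0 (d/2)"])
    fix z w assume *: "z \<in> ball z0 (d/2)" "norm (w::complex) \<le> d / 4 / K"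
    have "norm (w *s v) \<le> d / 4" using K(1) K(2)[of w] *(2) by (simp add: field_simps)
    hence "dist z0 (z + w *s v) < d"
      using *(1) d(1) dist_triangle_add_half dist_triangle[of z0 "z + w *s v" z]
      by (auto simp: dist_norm norm_minus_commute)
    thus "z + w *s v \<in> V" using d(2) by auto
  qed (use d K in auto)
qed

text \<open>\<open>holo_on\<close> asks for a derivative at each point only; its continuity comes
  from Cauchy's formula with a locally constant radius.\<close>

lemma continuous_on_dd:
  assumes "holo_on g V" "open V"
  shows "continuous_on V (dd g v)"
proof (rule continuous_at_imp_continuous_on, rule ballI)
  fix z0 assume "z0 \<in> V"
  then obtain r N where N: "r > 0" "open N" "convex N" "z0 \<in> N"
    "\<And>z w. z \<in> N \<Longrightarrow> norm w \<le> r \<Longrightarrow> z + w *s v \<in> V"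
    using Cauchy_nbhd[OF assms(2)] by metis
  have 1: "continuous_on (N \<times> {0..1}) (\<lambda>(z,t). exp (- (2 * pi * \<i> * of_real t)) / r * g (z + (r * exp (2 * pi * \<i> * of_real t)) *s v))"
    unfolding split_beta
    by (intro continuous_intros continuous_on_compose2[OF holo_on_continuous_on[OF assms(1)]])
       (use N in \<open>auto simp: norm_mult\<close>)
  have "continuous_on N (\<lambda>z. integral {0..1} (\<lambda>t. exp (- (2 * pi * \<i> * of_real t)) / r * g (z + (r * exp (2 * pi * \<i> * of_real t)) *s v)))"
    using integral_continuous_on_param[of N 0 "1::real", unfolded cbox_interval, OF 1] .
  moreover have "dd g v z = integral {0..1} (\<lambda>t. exp (- (2 * pi * \<i> * of_real t)) / r * g (z + (r * exp (2 * pi * \<i> * of_real t)) *s v))"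
    if "z \<in> N" for z
    by (rule dd_Cauchy[OF assms N(1) N(5)[OF that]])
  ultimately have "continuous_on N (dd g v)"
    by (metis (no_types, lifting) continuous_on_eq)
  thus "isCont (dd g v) z0" using N(2,4) by (simp add: continuous_on_eq_continuous_at)
qed

text \<open>The Leibniz rule needs the derivative as a continuous map into operators; in finite
  dimension continuity on each vector suffices.\<close>

lemma continuous_on_Blinfun_derivative:
  fixes V :: "(complex ^ 'd) set"
  assumes "holo_on g V" "open V"
  shows "continuous_on V (\<lambda>z. Blinfun (frechet_derivative g (at z)))"
proof (rule continuous_on_blinfun_componentwise)
  fix v :: "complex ^ 'd"
  show "continuous_on V (\<lambda>z. blinfun_apply (Blinfun (frechet_derivative g (at z))) v)"
    by (rule continuous_on_eq[OF continuous_on_dd[OF assms, of v]])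
       (simp add: bounded_linear_Blinfun_apply[OF has_derivative_bounded_linear[OF holo_on_has_derivative[OF assms(1)]]])
qed

text \<open>The affine substitution \<open>L t z + c t\<close> covers both later uses: circles
  around \<open>z\<close> in Cauchy's formula (\<open>L t\<close> the identity) and the segments in
  \<open>divq\<close> (\<open>c\<close> zero).\<close>

lemma
  fixes L :: "real \<Rightarrow> (complex ^ 'd) \<Rightarrow>\<^sub>L (complex ^ 'd)" and c :: "real \<Rightarrow> complex ^ 'd"
  assumes g: "holo_on g V" "open V" and U: "open U" "convex U"
    and cont: "continuous_on {0..1} k" "continuous_on {0..1} c" "continuous_on {0..1} L"
    and L: "\<And>t a v. t \<in> {0..1} \<Longrightarrow> L t (a *s v) = a *s L t v"
    and V: "\<And>z t. z \<in> U \<Longrightarrow> t \<in> {0..1} \<Longrightarrow> L t z + c t \<in> V"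
  shows holo_on_integral: "holo_on (\<lambda>z. integral {0..1} (\<lambda>t. k t * g (L t z + c t))) U"
    and dd_integral: "z \<in> U \<Longrightarrow> dd (\<lambda>z. integral {0..1} (\<lambda>t. k t * g (L t z + c t))) v z =
      integral {0..1} (\<lambda>t. k t * dd g (L t v) (L t z + c t))"
proof -
  let ?F = "\<lambda>z. integral {0..1} (\<lambda>t. k t * g (L t z + c t))"
  let ?D = "\<lambda>z t. blinfun_mult_right (k t) o\<^sub>L Blinfun (frechet_derivative g (at (L t z + c t))) o\<^sub>L L t"
  have D: "?D z t v = k t * dd g (L t v) (L t z + c t)" if "z \<in> U" "t \<in> {0..1}" for z t v
    by (simp add: bounded_linear_Blinfun_apply[OF has_derivative_bounded_linear[OF holo_on_has_derivative[OF g(1) V[OF that]]]])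
  have contA: "continuous_on (U \<times> {0..1}) (\<lambda>x. L (snd x) (fst x) + c (snd x))"
    by (intro continuous_intros continuous_on_compose2[OF cont(2)] continuous_on_compose2[OF cont(3)]
        bounded_bilinear.continuous_on[OF bounded_bilinear_blinfun_apply]) auto
  have contD: "continuous_on (U \<times> {0..1}) (\<lambda>(z,t). ?D z t)"
    unfolding split_beta
    by (intro bounded_bilinear.continuous_on[OF bounded_bilinear_blinfun_compose]
        bounded_linear.continuous_on[OF bounded_linear_blinfun_mult_right]
        continuous_on_compose2[OF cont(1)] continuous_on_compose2[OF cont(3)]
        continuous_on_compose2[OF continuous_on_Blinfun_derivative[OF g] contA] continuous_on_snd continuous_on_id)
       (use V in auto)
  have der: "((\<lambda>z. k t * g (L t z + c t)) has_derivative ?D z t) (at z within U)"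
    if "z \<in> U" "t \<in> {0..1}" for z t
  proof -
    have "((\<lambda>z. L t z + c t) has_derivative L t) (at z)"
      by (auto intro!: derivative_eq_intros)
    from has_derivative_mult_right[OF has_derivative_compose[OF this holo_on_has_derivative[OF g(1) V[OF that]]], of "k t"]
    have "((\<lambda>z. k t * g (L t z + c t)) has_derivative (\<lambda>v. k t * dd g (L t v) (L t z + c t))) (at z)" .
    moreover have "(\<lambda>v. k t * dd g (L t v) (L t z + c t)) = blinfun_apply (?D z t)"
      by (rule ext) (rule D[OF that, symmetric])
    ultimately show ?thesis by (simp add: has_derivative_at_withinI)
  qed
  have int: "(\<lambda>t. k t * g (L t z + c t)) integrable_on {0..1}" if "z \<in> U" for z
    by (intro integrable_continuous_real continuous_intros cont
        continuous_on_compose2[OF holo_on_continuous_on[OF g(1)]]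
        bounded_bilinear.continuous_on[OF bounded_bilinear_blinfun_apply]) (use V that in auto)
  have intD: "?D z integrable_on {0..1}" if "z \<in> U" for z
  proof -
    have "continuous_on {0..1} (\<lambda>t. case (z, t) of (z, t) \<Rightarrow> ?D z t)"
      by (rule continuous_on_compose2[OF contD])
         (use that in \<open>auto intro: continuous_on_Pair continuous_on_const continuous_on_id\<close>)
    thus ?thesis by (intro integrable_continuous_real) simp
  qed
  have main: "(?F has_derivative integral {0..1} (?D z)) (at z)" if "z \<in> U" for z
  proof -
    define E where "E = ?D"
    define F where "F = (\<lambda>z t. k t * g (L t z + c t))"
    have "((\<lambda>z. integral {0..1} (F z)) has_derivative integral {0..1} (E z)) (at z within U)"
    proof (rule leibniz_rule[of U 0 1 F E, unfolded cbox_interval])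
      show "((\<lambda>z. F z t) has_derivative blinfun_apply (E z t)) (at z within U)" if "z \<in> U" "t \<in> {0..1}" for z t
        using der[OF that] by (simp only: E_def F_def)
      show "F z integrable_on {0..1}" if "z \<in> U" for z using int[OF that] by (simp only: F_def)
      show "continuous_on (U \<times> {0..1}) (\<lambda>(z, t). E z t)" using contD by (simp only: E_def)
    qed fact+
    hence "(?F has_derivative integral {0..1} (?D z)) (at z within U)"
      by (simp only: E_def F_def)
    thus ?thesis unfolding at_within_open[OF that U(1)] .
  qed
  have val: "blinfun_apply (integral {0..1} (?D z)) v = integral {0..1} (\<lambda>t. k t * dd g (L t v) (L t z + c t))"
    if "z \<in> U" for z v
    unfolding blinfun_apply_integral[OF intD[OF that]]
    by (rule integral_cong) (use D[OF that] in auto)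
  show "holo_on ?F U"
  proof (rule holo_onI[OF main])
    fix z a v assume z: "z \<in> U"
    have "integral {0..1} (\<lambda>t. k t * dd g (L t (a *s v)) (L t z + c t)) =
      integral {0..1} (\<lambda>t. a * (k t * dd g (L t v) (L t z + c t)))"
      by (rule integral_cong) (simp add: L holo_on_dd_smult[OF g(1) V[OF z]])
    thus "blinfun_apply (integral {0..1} (?D z)) (a *s v) = a * blinfun_apply (integral {0..1} (?D z)) v"
      by (simp add: val[OF z])
  qed
  show "z \<in> U \<Longrightarrow> dd ?F v z = integral {0..1} (\<lambda>t. k t * dd g (L t v) (L t z + c t))"
    unfolding frechet_derivative_at[OF main, symmetric] by (rule val)
qed

text \<open>Cauchy's formula presents \<open>dd g v\<close> as an integral of \<open>g\<close>,
  hence as a holomorphic function. Differentiating it along \<open>w\<close> under the integral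
  gives Cauchy's formula for \<open>dd g w\<close>, hence the symmetry.\<close>

lemma holo_on_dd_and_commute:
  assumes "holo_on g V" "open V"
  shows "holo_on (dd g v) V \<and> (\<forall>z\<in>V. dd (dd g v) w z = dd (dd g w) v z)"
proof -
  have local: "\<exists>N. open N \<and> N \<subseteq> V \<and> z0 \<in> N \<and> holo_on (dd g v) N \<and>
     (\<forall>z\<in>N. dd (dd g v) w z = integral {0..1} (\<lambda>t. exp (- (2 * pi * \<i> * of_real t)) / r * dd g w (z + (r * exp (2 * pi * \<i> * of_real t)) *s v)))
     \<and> r > 0 \<and> (\<forall>z\<in>N. \<forall>w. norm w \<le> r \<longrightarrow> z + w *s v \<in> V)"
    if r: "r > 0" "open N" "convex N" "z0 \<in> N"
    "\<And>z w. z \<in> N \<Longrightarrow> norm w \<le> r \<Longrightarrow> z + w *s v \<in> V" for z0 r N v w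
  proof -
    \<comment> \<open>\<open>id_blinfun\<close> brings the integrand into the shape that
      \<open>dd_integral\<close> expects.\<close>
    let ?F = "\<lambda>z. integral {0..1} (\<lambda>t. exp (- (2 * pi * \<i> * of_real t)) / r * g (blinfun_apply id_blinfun z + (r * exp (2 * pi * \<i> * of_real t)) *s v))"
    have eq: "?F z = dd g v z" if "z \<in> N" for z
      unfolding id_blinfun.rep_eq id_apply by (rule dd_Cauchy[symmetric, OF assms r(1) r(5)[OF that]])
    have H: "holo_on ?F N"
      by (rule holo_on_integral[OF assms r(2,3)])
         (insert r(1,5), auto intro!: continuous_intros simp: norm_mult)
    have NV: "N \<subseteq> V" using r(1) r(5)[of _ 0] by auto
    have holo: "holo_on (dd g v) N" by (rule holo_on_cong[OF H r(2) eq])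
    have "dd (dd g v) w z = integral {0..1} (\<lambda>t. exp (- (2 * pi * \<i> * of_real t)) / r * dd g w (z + (r * exp (2 * pi * \<i> * of_real t)) *s v))" if "z \<in> N" for z
    proof -
      have "dd (dd g v) w z = dd ?F w z" by (rule dd_cong[OF r(2) that eq[symmetric] holo])
      also have "\<dots> = integral {0..1} (\<lambda>t. exp (- (2 * pi * \<i> * of_real t)) / r * dd g (blinfun_apply id_blinfun w) (blinfun_apply id_blinfun z + (r * exp (2 * pi * \<i> * of_real t)) *s v))"
        by (rule dd_integral[OF assms r(2,3)])
         (insert r(1,5) that, auto intro!: continuous_intros simp: norm_mult)
      finally show ?thesis by simp
    qed
    with holo NV r(1,2,4,5) show ?thesis by (intro exI[of _ N]) simp
  qed
  have holo: "holo_on (dd g v) V" for v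
  proof (rule holo_on_local)
    fix z0 assume "z0 \<in> V"
    then obtain r N where N: "r > 0" "open N" "convex N" "z0 \<in> N"
      "\<And>z w. z \<in> N \<Longrightarrow> norm w \<le> r \<Longrightarrow> z + w *s v \<in> V"
      using Cauchy_nbhd[OF assms(2)] by metis
    from local[OF this] show "\<exists>N. z0 \<in> N \<and> holo_on (dd g v) N" by blast
  qed
  have "dd (dd g v) w z = dd (dd g w) v z" if zV: "z \<in> V" for z
  proof -
    obtain r N where N: "r > 0" "open N" "convex N" "z \<in> N"
      "\<And>z w. z \<in> N \<Longrightarrow> norm w \<le> r \<Longrightarrow> z + w *s v \<in> V"
      using Cauchy_nbhd[OF assms(2) zV] by metis
    from local[OF this, of w] N(4) have "dd (dd g v) w z = integral {0..1} (\<lambda>t. exp (- (2 * pi * \<i> * of_real t)) / r * dd g w (z + (r * exp (2 * pi * \<i> * of_real t)) *s v))"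
      by blast
    also have "\<dots> = dd (dd g w) v z"
      by (rule dd_Cauchy[symmetric, OF holo assms(2) N(1)]) (use N in auto)
    finally show ?thesis .
  qed
  with holo show ?thesis by blast
qed

lemmas holo_on_dd = holo_on_dd_and_commute[THEN conjunct1]
lemmas dd_commute = holo_on_dd_and_commute[THEN conjunct2, rule_format]

text \<open>\<open>divq lam b g\<close> is \<open>(g z - g (z - lam z b)) / lam z\<close>, written so that it makes sense on \<open>lam = 0\<close>.\<close>

definition divq :: "(complex ^ 'd \<Rightarrow> complex) \<Rightarrow> complex ^ 'd \<Rightarrow> (complex ^ 'd \<Rightarrow> complex) \<Rightarrow> complex ^ 'd \<Rightarrow> complex" where
  "divq lam b g z = integral {0..1} (\<lambda>t. dd g b (z - (of_real t * lam z) *s b))"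

definition clinear_form :: "(complex ^ 'd \<Rightarrow> complex) \<Rightarrow> bool" where
  "clinear_form lam \<longleftrightarrow> (\<exists>a. \<forall>z. lam z = (\<Sum>i\<in>UNIV. a i * z $ i))"

lemma clinear_form_props:
  assumes "clinear_form lam"
  shows "lam (x + y) = lam x + lam y" "lam (x - y) = lam x - lam y" "lam (c *s x) = c * lam x" "bounded_linear lam"
proof -
  obtain a where a: "\<And>z. lam z = (\<Sum>i\<in>UNIV. a i * z $ i)" using assms clinear_form_def by metis
  show A: "lam (x + y) = lam x + lam y" and "lam (x - y) = lam x - lam y"
    and C: "lam (c *s x) = c * lam x" for x y c
    by (auto simp: a sum.distrib sum_subtractf algebra_simps sum_distrib_left)
  have "lam = (\<lambda>z. \<Sum>i\<in>UNIV. a i * z $ i)" using a by auto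
  thus "bounded_linear lam"
    by (auto intro!: bounded_linear_sum bounded_linear_mult_const bounded_linear_const_mult bounded_linear_vec_nth)
qed

text \<open>The shear \<open>z - (of_real t * lam z) *s b\<close> is linear in \<open>z\<close> and
  depends continuously on \<open>t\<close>, so the parameter integral applies to
  \<open>dd g b\<close>.\<close>

lemma holo_on_divq:
  fixes U :: "(complex ^ 'd) set"
  assumes g: "holo_on g V" "open V" and U: "open U" "convex U" and lam: "clinear_form lam"
    and UV: "\<And>z t. z \<in> U \<Longrightarrow> t \<in> {0..1} \<Longrightarrow> z - (of_real t * lam z) *s b \<in> V"
  shows "holo_on (divq lam b g) U"
proof -
  note l = clinear_form_props[OF lam]
  define M where "M = Blinfun (\<lambda>z. lam z *s b)"
  have "bounded_linear (\<lambda>z. lam z *s b)"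
    by (rule bounded_linear_compose[OF bounded_linear_vector_smult_left l(4)])
  hence M: "blinfun_apply M z = lam z *s b" for z
    by (simp add: M_def bounded_linear_Blinfun_apply)
  define L where "L = (\<lambda>t::real. id_blinfun - t *\<^sub>R M)"
  have L: "blinfun_apply (L t) z = z - (of_real t * lam z) *s b" for t z
    by (simp add: L_def M blinfun.diff_left blinfun.scaleR_left vec_eq_iff scaleR_conv_of_real[where 'a=complex])
  have "holo_on (\<lambda>z. integral {0..1} (\<lambda>t. 1 * dd g b (blinfun_apply (L t) z + 0))) U"
  proof (rule holo_on_integral[OF holo_on_dd[OF g] g(2) U])
    show "continuous_on {0..1} L" unfolding L_def by (intro continuous_intros)
    show "blinfun_apply (L t) (a *s v) = a *s blinfun_apply (L t) v" for t a v
      by (simp add: L l vec_eq_iff algebra_simps)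
    show "z \<in> U \<Longrightarrow> t \<in> {0..1} \<Longrightarrow> blinfun_apply (L t) z + 0 \<in> V" for z t
      by (simp add: L UV)
  qed auto
  thus ?thesis by (simp add: L divq_def[abs_def])
qed

text \<open>Hadamard's lemma: the fundamental theorem of calculus along the segment from
  \<open>z\<close> to \<open>z - lam z *s b\<close>. As \<open>lam b = 1\<close>, the end point lies
  on the hyperplane \<open>lam = 0\<close>.\<close>

lemma divq_mult:
  assumes g: "holo_on g V" and lam: "clinear_form lam" "lam b = 1"
    and V: "\<And>t. t \<in> {0..1} \<Longrightarrow> z - (of_real t * lam z) *s b \<in> V"
  shows "lam z * divq lam b g z = g z - g (z - lam z *s b)"
proof -
  have "((\<lambda>t. - (lam z * dd g b (z - (of_real t * lam z) *s b))) has_integral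
      g (z - (of_real 1 * lam z) *s b) - g (z - (of_real 0 * lam z) *s b)) {0..1}"
  proof (rule fundamental_theorem_of_calculus)
    fix t :: real assume t: "t \<in> {0..1}"
    have "((\<lambda>t::real. (of_real t * lam z) *s b) has_derivative (\<lambda>t. (of_real t * lam z) *s b)) (at t)"
      by (rule bounded_linear_imp_has_derivative, rule bounded_linear_compose[OF bounded_linear_vector_smult_left])
         (intro bounded_linear_mult_const bounded_linear_of_real)
    hence "((\<lambda>t::real. z - (of_real t * lam z) *s b) has_derivative (\<lambda>t. 0 - (of_real t * lam z) *s b)) (at t)"
      by (intro has_derivative_diff has_derivative_const)
    from has_derivative_compose[OF this holo_on_has_derivative[OF g V[OF t]]]
    have *: "((\<lambda>t. g (z - (of_real t * lam z) *s b)) has_derivative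
       (\<lambda>s. dd g (0 - (of_real s * lam z) *s b) (z - (of_real t * lam z) *s b))) (at t)" .
    have "dd g (0 - (of_real s * lam z) *s b) (z - (of_real t * lam z) *s b) =
        s *\<^sub>R - (lam z * dd g b (z - (of_real t * lam z) *s b))" for s
    proof -
      have "0 - (of_real s * lam z) *s b = (- of_real s * lam z) *s b" by (simp add: vec_eq_iff)
      thus ?thesis using holo_on_dd_smult[OF g V[OF t], of "- of_real s * lam z" b]
        by (simp add: scaleR_conv_of_real)
    qed
    with * show "((\<lambda>t. g (z - (of_real t * lam z) *s b)) has_vector_derivative
         - (lam z * dd g b (z - (of_real t * lam z) *s b))) (at t within {0..1})"
      by (simp add: has_vector_derivative_def has_derivative_at_withinI)
  qed simp
  from integral_unique[OF this] show ?thesis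
    by (simp add: divq_def) (metis minus_diff_eq minus_minus)
qed


section \<open>Shellings of projective fans\<close>

lemma sum_eq_single:
  assumes "finite A" "k \<in> A" "\<And>l. l \<in> A \<Longrightarrow> l \<noteq> k \<Longrightarrow> f l = 0"
  shows "sum f A = f k"
proof -
  have "sum f (A - {k}) = 0" using assms(3) by (intro sum.neutral) auto
  thus ?thesis by (simp add: sum.remove[OF assms(1,2)])
qed

lemma lat_add: "lat (v + w) = lat v + lat w"
  by (simp add: lat_def vec_eq_iff)

lemma lat_smult: "lat (c *s v) = of_int c *\<^sub>R lat v"
  by (simp add: lat_def vec_eq_iff)

lemma lat_zero: "lat 0 = 0"
  by (simp add: lat_def vec_eq_iff)

lemma lat_sum: "lat (\<Sum>i\<in>I. f i) = (\<Sum>i\<in>I. lat (f i))"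
  by (induction I rule: infinite_finite_induct) (auto simp: lat_zero lat_add)

lemma lat_inject: "lat v = lat w \<longleftrightarrow> v = w"
  by (simp add: lat_def vec_eq_iff)

lemma lat_axis_expansion: "(x :: real ^ 'n) = (\<Sum>j\<in>UNIV. (x $ j) *\<^sub>R lat (axis j 1))"
proof -
  have "lat (axis j 1) = axis j 1" for j :: 'n
    by (simp add: lat_def vec_eq_iff axis_def)
  thus ?thesis using basis_expansion[of x] by (simp add: scalar_mult_eq_scaleR)
qed

lemma linear_functional_inner:
  fixes l :: "real ^ 'n \<Rightarrow> real"
  assumes "linear l"
  obtains a where "\<And>x. l x = a \<bullet> x"
proof (rule that)
  fix x
  have "l x = l (\<Sum>j\<in>UNIV. (x $ j) *\<^sub>R lat (axis j 1))" using lat_axis_expansion[of x] by simp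
  also have "\<dots> = (\<chi> j. l (lat (axis j 1))) \<bullet> x"
    by (simp add: linear_sum[OF assms] linear_scale[OF assms] inner_vec_def mult.commute)
  finally show "l x = (\<chi> j. l (lat (axis j 1))) \<bullet> x" .
qed

section \<open>Real coordinates and cones of a lattice basis\<close>

text \<open>\<open>lattice_basis\<close> speaks of integer combinations only, so the real
  coordinates come from expanding the unit vectors over the integers and extending linearly. This
  keeps them integral on the lattice.\<close>

definition coord :: "('n \<Rightarrow> int ^ 'n) \<Rightarrow> 'n \<Rightarrow> real ^ 'n \<Rightarrow> real" where
  "coord B k x = (\<Sum>j\<in>UNIV. (x $ j) * of_int ((THE c. axis j 1 = (\<Sum>k\<in>UNIV. c k *s B k)) k))"

context
  fixes B :: "'n \<Rightarrow> int ^ 'n"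
  assumes B: "lattice_basis B"
begin

lemma axis_lattice_coords:
  "axis j 1 = (\<Sum>k\<in>UNIV. (THE c. axis j 1 = (\<Sum>k\<in>UNIV. c k *s B k)) k *s B k)"
  using theI'[of "\<lambda>c. axis j 1 = (\<Sum>k\<in>UNIV. c k *s B k)"] B unfolding lattice_basis_def by blast

lemma linear_coord: "linear (coord B k)"
  by (rule linearI) (auto simp: coord_def sum.distrib algebra_simps sum_distrib_left)

lemma coord_expansion: "(\<Sum>k\<in>UNIV. coord B k x *\<^sub>R lat (B k)) = x"
proof -
  let ?a = "\<lambda>j. THE c. axis j 1 = (\<Sum>k\<in>UNIV. c k *s B k)"
  have "(\<Sum>k\<in>UNIV. coord B k x *\<^sub>R lat (B k)) = (\<Sum>k\<in>UNIV. \<Sum>j\<in>UNIV. (x $ j) *\<^sub>R lat (?a j k *s B k))"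
    by (simp add: coord_def scaleR_sum_left lat_smult)
  also have "\<dots> = (\<Sum>j\<in>UNIV. (x $ j) *\<^sub>R lat (\<Sum>k\<in>UNIV. ?a j k *s B k))"
    by (subst sum.swap) (simp add: scaleR_sum_right lat_sum)
  also have "\<dots> = (\<Sum>j\<in>UNIV. (x $ j) *\<^sub>R lat (axis j 1))"
    by (simp add: axis_lattice_coords[symmetric])
  finally show ?thesis using lat_axis_expansion[of x] by simp
qed

lemma coord_lat: "\<exists>c. v = (\<Sum>k\<in>UNIV. c k *s B k) \<and> (\<forall>k. coord B k (lat v) = of_int (c k))"
proof -
  let ?a = "\<lambda>j. THE c. axis j 1 = (\<Sum>k\<in>UNIV. c k *s B k)"
  let ?c = "\<lambda>k. \<Sum>j\<in>UNIV. v $ j * ?a j k"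
  have 1: "coord B k (lat v) = of_int (?c k)" for k
    by (simp add: coord_def lat_def)
  have "lat (\<Sum>k\<in>UNIV. ?c k *s B k) = (\<Sum>k\<in>UNIV. coord B k (lat v) *\<^sub>R lat (B k))"
    by (simp add: lat_sum lat_smult 1)
  hence "v = (\<Sum>k\<in>UNIV. ?c k *s B k)" by (simp add: coord_expansion lat_inject)
  with 1 show ?thesis by (intro exI[of _ ?c]) blast
qed

lemma coord_basis: "coord B k (lat (B l)) = (if k = l then 1 else 0)"
proof -
  obtain c where c: "B l = (\<Sum>k\<in>UNIV. c k *s B k)" "\<And>k. coord B k (lat (B l)) = of_int (c k)"
    using coord_lat by metis
  have d: "B l = (\<Sum>k\<in>UNIV. (if k = l then 1 else 0) *s B k)"
    by (subst sum_eq_single[of _ l]) simp_all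
  define F where "F = (\<lambda>d. \<Sum>k\<in>UNIV. d k *s B k)"
  have "\<exists>!d. B l = F d" using B unfolding lattice_basis_def F_def by blast
  moreover have "B l = F c" unfolding F_def by (rule c(1))
  moreover have "B l = F (\<lambda>k. if k = l then 1 else 0)" unfolding F_def by (rule d)
  ultimately have "c = (\<lambda>k. if k = l then 1 else 0)" by blast
  thus ?thesis using c(2) by simp
qed

text \<open>Coordinates of a lattice vector are integers, so \<open>v\<close> is an integer multiple
  of \<open>B k\<close>; primitivity makes the factor 1 up to sign, and \<open>t \<ge> 0\<close>
  fixes the sign.\<close>

lemma primitive_on_basis_ray:
  assumes "primitive_vec v" "lat v = t *\<^sub>R lat (B k)" "t \<ge> 0"
  shows "v = B k"
proof -
  obtain c where c: "v = (\<Sum>k\<in>UNIV. c k *s B k)" "\<And>l. coord B l (lat v) = of_int (c l)"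
    using coord_lat by metis
  have cl: "of_int (c l) = (if l = k then t else 0)" for l
    unfolding c(2)[symmetric] assms(2) linear_scale[OF linear_coord] by (simp add: coord_basis)
  have "c l = 0" if "l \<noteq> k" for l using cl[of l] that by simp
  hence "v = c k *s B k"
    by (subst c(1), subst sum_eq_single[of _ k]) simp_all
  moreover from this assms(1) have "\<bar>c k\<bar> = 1" unfolding primitive_vec_def by blast
  moreover have "c k \<ge> 0" using cl[of k] assms(3) by simp
  ultimately show ?thesis by simp
qed

lemma cone_gen_basis:
  "cone_gen (B ` J) = {x. \<forall>k. coord B k x \<ge> 0 \<and> (k \<notin> J \<longrightarrow> coord B k x = 0)}" (is "_ = ?R")
proof
  show "cone_gen (B ` J) \<subseteq> ?R"
    unfolding cone_gen_def
  proof (rule hull_minimal)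
    show "lat ` B ` J \<subseteq> ?R" by (auto simp: coord_basis)
    show "convex_cone ?R"
      unfolding convex_cone_iff
      by (auto simp: linear_0[OF linear_coord] linear_add[OF linear_coord] linear_scale[OF linear_coord])
  qed
  show "?R \<subseteq> cone_gen (B ` J)"
  proof
    fix x assume x: "x \<in> ?R"
    have cc: "convex_cone (cone_gen (B ` J))"
      unfolding cone_gen_def by (rule convex_cone_convex_cone_hull)
    have "(\<Sum>k\<in>K. coord B k x *\<^sub>R lat (B k)) \<in> cone_gen (B ` J)" if "finite K" for K
      using that
    proof induction
      case empty
      show ?case using convex_cone_contains_0[OF cc] by simp
    next
      case (insert k K)
      have "coord B k x *\<^sub>R lat (B k) \<in> cone_gen (B ` J)"
      proof (cases "k \<in> J")
        case True
        hence "lat (B k) \<in> cone_gen (B ` J)" by (simp add: cone_gen_def hull_inc)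
        thus ?thesis using x convex_cone_scaleR[OF cc] by simp
      next
        case False
        thus ?thesis using x convex_cone_contains_0[OF cc] by simp
      qed
      thus ?case using insert convex_cone_add[OF cc] by simp
    qed
    from this[of UNIV] show "x \<in> cone_gen (B ` J)" by (simp add: coord_expansion)
  qed
qed

text \<open>A coordinate that vanishes inside a segment of the cone vanishes at both ends, since it
  is nonnegative there.\<close>

lemma cone_gen_subset_face:
  "cone_gen (B ` J) face_of cone_gen (range B)"
  unfolding face_of_def
proof (intro conjI ballI impI)
  show "convex (cone_gen (B ` J))" unfolding cone_gen_def by (rule convex_convex_cone_hull)
  show "cone_gen (B ` J) \<subseteq> cone_gen (range B)" unfolding cone_gen_basis by auto
next
  fix a b x assume a: "a \<in> cone_gen (range B)" and b: "b \<in> cone_gen (range B)" and x: "x \<in> cone_gen (B ` J)"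
    and o: "x \<in> open_segment a b"
  obtain u where u: "0 < u" "u < 1" "x = (1 - u) *\<^sub>R a + u *\<^sub>R b" using o by (auto simp: in_segment)
  have "coord B k a = 0 \<and> coord B k b = 0" if "k \<notin> J" for k
  proof -
    have "0 = coord B k x" using x that unfolding cone_gen_basis by simp
    also have "\<dots> = (1 - u) * coord B k a + u * coord B k b"
      unfolding u(3) by (simp add: linear_add[OF linear_coord] linear_scale[OF linear_coord])
    finally have "(1 - u) * coord B k a + u * coord B k b = 0" by simp
    moreover have "(1 - u) * coord B k a \<ge> 0" "u * coord B k b \<ge> 0"
      using a b u unfolding cone_gen_basis by auto
    ultimately have "(1 - u) * coord B k a = 0" "u * coord B k b = 0" by linarith+
    thus ?thesis using u by simp
  qed
  thus "a \<in> cone_gen (B ` J)" "b \<in> cone_gen (B ` J)"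
    using a b unfolding cone_gen_basis by auto
qed

lemma lat_basis_nonzero: "lat (B k) \<noteq> 0"
  using coord_basis[of k k] linear_0[OF linear_coord[of k]] by auto

lemma cone_gen_single: "cone_gen {B k} = {t *\<^sub>R lat (B k) | t. t \<ge> 0}"
proof -
  have "x = coord B k x *\<^sub>R lat (B k)" if "\<forall>l. l \<noteq> k \<longrightarrow> coord B l x = 0" for x
    by (subst (1) coord_expansion[of x, symmetric], subst sum_eq_single[of _ k]) (use that in simp_all)
  hence "cone_gen (B ` {k}) = {t *\<^sub>R lat (B k) | t. t \<ge> 0}"
    unfolding cone_gen_basis by (auto simp: linear_scale[OF linear_coord] coord_basis)
  thus ?thesis by simp
qed

lemma dim_cone_gen_single: "dim (cone_gen {B k}) = 1"
proof -
  have "lat (B k) \<in> cone_gen {B k}" by (simp add: cone_gen_def hull_inc)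
  moreover have "cone_gen {B k} \<subseteq> span {lat (B k)}"
    unfolding cone_gen_single by (auto intro: span_base span_scale)
  ultimately have "dim (cone_gen {B k}) = dim {lat (B k)}"
    by (intro antisym dim_mono) (auto simp: span_base)
  thus ?thesis by (simp add: lat_basis_nonzero)
qed

lemma closed_cone_gen_basis: "closed (cone_gen (range B))"
proof -
  have "cone_gen (range B) = (\<Inter>k. {x. 0 \<le> coord B k x})"
    unfolding cone_gen_basis by auto
  thus ?thesis
    by (auto intro!: closed_INT closed_Collect_le linear_continuous_on linear_coord
       simp: linear_conv_bounded_linear[symmetric])
qed

lemma negligible_cone_gen_basis:
  assumes "J \<noteq> UNIV"
  shows "negligible (cone_gen (B ` J))"
proof -
  obtain k where k: "k \<notin> J" using assms by auto
  obtain a where a: "\<And>x. coord B k x = a \<bullet> x" using linear_functional_inner[OF linear_coord] by metis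
  have "a \<noteq> 0" using a[of "lat (B k)"] by (auto simp: coord_basis)
  hence "negligible {x. a \<bullet> x = 0}" by (intro negligible_hyperplane) auto
  moreover have "cone_gen (B ` J) \<subseteq> {x. a \<bullet> x = 0}"
    unfolding cone_gen_basis using k a by auto
  ultimately show ?thesis by (rule negligible_subset)
qed

lemma interior_cone_gen_basis: "(\<Sum>k\<in>UNIV. lat (B k)) \<in> interior (cone_gen (range B))"
proof (rule interiorI)
  have "{x. \<forall>k. 0 < coord B k x} = (\<Inter>k. {x. 0 < coord B k x})" by auto
  thus "open {x. \<forall>k. 0 < coord B k x}"
    by (auto intro!: open_INT open_Collect_less linear_continuous_on linear_coord
       simp: linear_conv_bounded_linear[symmetric])
  show "(\<Sum>k\<in>UNIV. lat (B k)) \<in> {x. \<forall>k. 0 < coord B k x}"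
    by (simp add: linear_sum[OF linear_coord] coord_basis)
  show "{x. \<forall>k. 0 < coord B k x} \<subseteq> cone_gen (range B)"
    unfolding cone_gen_basis by (auto intro: less_imp_le)
qed

end

section \<open>Faces of convex cones\<close>

text \<open>\<open>x + y\<close> is the midpoint of \<open>x\<close> and
  \<open>x + 2 *\<^sub>R y\<close>, so a face that contains it contains both ends.\<close>

lemma face_of_cone_summand:
  assumes "F face_of K" "convex_cone K" "x \<in> K" "y \<in> K" "x + y \<in> F"
  shows "x \<in> F"
proof (cases "y = 0")
  case False
  have "x + y = (1 - 1/2) *\<^sub>R x + (1/2) *\<^sub>R (x + 2 *\<^sub>R y)"
    by (simp add: algebra_simps flip: scaleR_left.add)
  hence "x + y \<in> open_segment x (x + 2 *\<^sub>R y)"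
    using False unfolding in_segment by (intro conjI exI[of _ "1/2"]) auto
  moreover have "x + 2 *\<^sub>R y \<in> K"
    using assms(2-4) by (intro convex_cone_add convex_cone_scaleR) auto
  ultimately show ?thesis using face_ofD[OF assms(1)] assms(3,5) by blast
qed (use assms in auto)

lemma convex_cone_sum:
  assumes "convex_cone K" "finite S" "\<And>i. i \<in> S \<Longrightarrow> u i \<in> K"
  shows "sum u S \<in> K"
  using assms(2,3) by (induction S) (auto intro: convex_cone_add[OF assms(1)] convex_cone_contains_0[OF assms(1)])

lemma face_of_cone_summands:
  assumes "F face_of K" "convex_cone K" "finite S" "\<And>i. i \<in> S \<Longrightarrow> u i \<in> K" "sum u S \<in> F" "i \<in> S"
  shows "u i \<in> F"
  using face_of_cone_summand[OF assms(1,2), of "u i" "sum u (S - {i})"]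
    convex_cone_sum[OF assms(2), of "S - {i}" u] assms(3-6) by (auto simp: sum.remove)

section \<open>The simplicial complex of a projective fan\<close>

locale projective_fan =
  fixes \<Sigma> :: "(real ^ 'n) set set" and \<psi> :: "real ^ 'n \<Rightarrow> real" and \<rho> :: "'d::finite \<Rightarrow> int ^ 'n"
  assumes smooth: "smooth_fan \<Sigma>" and complete: "complete_fan \<Sigma>"
    and strictly_convex: "strictly_convex_PL \<Sigma> \<psi>" and rays: "ray_generators \<Sigma> \<rho>"
begin

text \<open>The facets of the simplicial complex of \<open>\<Sigma>\<close>, as sets of ray indices.
  Enumerating them by \<open>'n\<close> builds in the full dimension.\<close>

definition facets :: "'d set set" where
  "facets = {range b | b :: 'n \<Rightarrow> 'd. lattice_basis (\<lambda>k. \<rho> (b k)) \<and> cone_gen (range (\<lambda>k. \<rho> (b k))) \<in> \<Sigma>}"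

abbreviation cn :: "'d set \<Rightarrow> (real ^ 'n) set" where
  "cn A \<equiv> cone_gen (\<rho> ` A)"

lemma fan: "is_fan \<Sigma>"
  using complete complete_fan_def by blast

lemma facetsE:
  assumes "A \<in> facets"
  obtains b where "A = range b" "lattice_basis (\<lambda>k. \<rho> (b k))" "cn A = cone_gen (range (\<lambda>k. \<rho> (b k)))" "cn A \<in> \<Sigma>"
    "inj b"
proof -
  obtain b :: "'n \<Rightarrow> 'd" where b: "A = range b" "lattice_basis (\<lambda>k. \<rho> (b k))" "cone_gen (range (\<lambda>k. \<rho> (b k))) \<in> \<Sigma>"
    using assms unfolding facets_def by blast
  have "range (\<lambda>k. \<rho> (b k)) = \<rho> ` A" using b(1) by auto
  moreover have "inj b"
    by (rule injI) (metis (no_types, lifting) b(2) coord_basis zero_neq_one)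
  ultimately show ?thesis using that b by auto
qed

lemma finite_facets: "finite facets" by simp

text \<open>Coordinates indexed by rays instead of by \<open>'n\<close>. The enumeration of
  \<open>A\<close> is chosen arbitrarily; linearity and \<open>fcoord_basis\<close> determine the
  result for every choice.\<close>

definition fcoord :: "'d set \<Rightarrow> 'd \<Rightarrow> real ^ 'n \<Rightarrow> real" where
  "fcoord A i = (let b = (SOME b. A = range b \<and> lattice_basis (\<lambda>k. \<rho> (b k))) in
     coord (\<lambda>k. \<rho> (b k)) (inv_into UNIV b i))"

lemma
  assumes "A \<in> facets"
  shows linear_fcoord: "i \<in> A \<Longrightarrow> linear (fcoord A i)"
    and fcoord_expansion: "(\<Sum>i\<in>A. fcoord A i x *\<^sub>R lat (\<rho> i)) = x"
    and fcoord_basis: "i \<in> A \<Longrightarrow> j \<in> A \<Longrightarrow> fcoord A i (lat (\<rho> j)) = (if i = j then 1 else 0)"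
    and mem_cn: "x \<in> cn A \<longleftrightarrow> (\<forall>i\<in>A. fcoord A i x \<ge> 0)"
proof -
  define b where "b = (SOME b. A = range b \<and> lattice_basis (\<lambda>k. \<rho> (b k)))"
  have "\<exists>b. A = range b \<and> lattice_basis (\<lambda>k. \<rho> (b k))" using facetsE[OF assms] by metis
  from someI_ex[OF this] have b: "A = range b" "lattice_basis (\<lambda>k. \<rho> (b k))" by (simp_all add: b_def)
  have inj: "inj b"
    by (rule injI) (metis (no_types, lifting) b(2) coord_basis zero_neq_one)
  have f: "fcoord A (b k) = coord (\<lambda>k. \<rho> (b k)) k" for k
    by (simp add: fcoord_def b_def[symmetric] inj)
  show "i \<in> A \<Longrightarrow> linear (fcoord A i)" using b(1) f linear_coord[OF b(2)] by auto
  show "(\<Sum>i\<in>A. fcoord A i x *\<^sub>R lat (\<rho> i)) = x"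
    unfolding b(1) sum.reindex[OF inj] o_def f[unfolded b(1)] by (rule coord_expansion[OF b(2)])
  show "i \<in> A \<Longrightarrow> j \<in> A \<Longrightarrow> fcoord A i (lat (\<rho> j)) = (if i = j then 1 else 0)"
    using b(1) f coord_basis[OF b(2)] inj by (auto dest: injD)
  have "\<rho> ` A = range (\<lambda>k. \<rho> (b k))" using b(1) by auto
  thus "x \<in> cn A \<longleftrightarrow> (\<forall>i\<in>A. fcoord A i x \<ge> 0)"
    using cone_gen_basis[OF b(2), of UNIV] f by (auto simp: b(1))
qed

lemma convex_cone_cone_gen: "convex_cone (cone_gen S)"
  unfolding cone_gen_def by (rule convex_cone_convex_cone_hull)

lemma generator_mem_cn: "i \<in> A \<Longrightarrow> lat (\<rho> i) \<in> cn A"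
  unfolding cone_gen_def by (simp add: hull_inc)

lemma primitive_rays: "primitive_vec (\<rho> i)" and inj_rays: "inj \<rho>"
  using rays unfolding ray_generators_def by auto

text \<open>Each edge of the cone is a one-dimensional cone of the fan, hence spanned by some
  \<open>\<rho> i\<close>, and primitivity of \<open>\<rho> i\<close> identifies it with the basis
  vector.\<close>

lemma full_cone_is_facet:
  assumes "lattice_basis B" "cone_gen (range B) \<in> \<Sigma>"
  shows "\<exists>A\<in>facets. cone_gen (range B) = cn A"
proof -
  have "\<exists>i. \<rho> i = B k" for k
  proof -
    have "cone_gen {B k} face_of cone_gen (range B)" using cone_gen_subset_face[OF assms(1), of "{k}"] by simp
    moreover have "cone_gen {B k} \<noteq> {}" unfolding cone_gen_def by (rule convex_cone_hull_nonempty)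
    ultimately have "cone_gen {B k} \<in> \<Sigma>" using fan assms(2) unfolding is_fan_def by blast
    hence "cone_gen {B k} \<in> range (\<lambda>i. cone_gen {\<rho> i})"
      using rays dim_cone_gen_single[OF assms(1), of k] unfolding ray_generators_def by auto
    then obtain i where i: "cone_gen {B k} = cone_gen {\<rho> i}" by auto
    have "lat (\<rho> i) \<in> cone_gen {\<rho> i}" by (simp add: cone_gen_def hull_inc)
    then obtain t where "t \<ge> 0" "lat (\<rho> i) = t *\<^sub>R lat (B k)"
      using i cone_gen_single[OF assms(1), of k] by auto
    thus ?thesis using primitive_on_basis_ray[OF assms(1) primitive_rays] by metis
  qed
  then obtain b where b: "\<And>k. \<rho> (b k) = B k" by metis
  have "range B = \<rho> ` range b" using b by (auto simp: image_image)
  moreover have "range b \<in> facets" unfolding facets_def using assms b by auto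
  ultimately show ?thesis by metis
qed

text \<open>The uncovered part is open, and it lies in the union of the finitely many
  lower-dimensional cones, which has measure zero. Hence it is empty.\<close>

lemma facets_cover: "(\<Union>A\<in>facets. cn A) = UNIV"
proof (rule ccontr)
  let ?U = "- (\<Union>A\<in>facets. cn A)"
  assume "(\<Union>A\<in>facets. cn A) \<noteq> UNIV"
  hence "?U \<noteq> {}" by auto
  moreover have "open ?U"
  proof (intro open_Compl closed_UN finite_facets ballI)
    fix A assume "A \<in> facets"
    thus "closed (cn A)" using closed_cone_gen_basis facetsE by metis
  qed
  moreover have "negligible ?U"
  proof (rule negligible_subset)
    let ?N = "\<Union>{\<sigma>\<in>\<Sigma>. negligible \<sigma>}"
    show "negligible ?N" using fan unfolding is_fan_def by (intro negligible_Union) auto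
    show "?U \<subseteq> ?N"
    proof
      fix x assume x: "x \<in> ?U"
      obtain \<sigma> where \<sigma>: "\<sigma> \<in> \<Sigma>" "x \<in> \<sigma>" using complete unfolding complete_fan_def by blast
      obtain B J where BJ: "lattice_basis B" "\<sigma> = cone_gen (B ` J)"
        using smooth \<sigma>(1) unfolding smooth_fan_def by blast
      have "J \<noteq> UNIV"
      proof
        assume "J = UNIV"
        then obtain A where "A \<in> facets" "\<sigma> = cn A" using full_cone_is_facet[OF BJ(1)] BJ(2) \<sigma>(1) by auto
        thus False using x \<sigma>(2) by auto
      qed
      thus "x \<in> ?N" using negligible_cone_gen_basis[OF BJ(1)] BJ(2) \<sigma> by auto
    qed
  qed
  ultimately show False using open_not_negligible by blast
qed

lemma cn_in_fan: "A \<in> facets \<Longrightarrow> cn A \<in> \<Sigma>"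
  using facetsE by metis

lemma ray_in_fan: "cone_gen {\<rho> i} \<in> \<Sigma>"
  using rays unfolding ray_generators_def by auto

lemma Int_face_of: "\<sigma> \<in> \<Sigma> \<Longrightarrow> \<tau> \<in> \<Sigma> \<Longrightarrow> (\<sigma> \<inter> \<tau>) face_of \<sigma>"
  using fan unfolding is_fan_def by blast

text \<open>If \<open>lat (\<rho> i)\<close> lies in the cone, the part of its ray inside the cone
  is a face, so it contains every summand of \<open>lat (\<rho> i)\<close> in the coordinates of
  \<open>A\<close>. A nonzero summand makes the ray an edge of the cone, and primitivity identifies
  the generators.\<close>

lemma generator_mem_cn_iff:
  assumes "A \<in> facets"
  shows "lat (\<rho> i) \<in> cn A \<longleftrightarrow> i \<in> A"
proof
  assume mem: "lat (\<rho> i) \<in> cn A"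
  have face: "(cn A \<inter> cone_gen {\<rho> i}) face_of cn A"
    by (rule Int_face_of[OF cn_in_fan[OF assms] ray_in_fan])
  have "\<rho> i \<noteq> 0"
  proof
    assume "\<rho> i = 0"
    hence "\<rho> i = 0 *s 0" by simp
    hence "\<bar>0::int\<bar> = 1" using primitive_rays unfolding primitive_vec_def by blast
    thus False by simp
  qed
  hence nz: "lat (\<rho> i) \<noteq> 0" using lat_inject[of "\<rho> i" 0] by (simp add: lat_zero)
  hence "\<exists>j\<in>A. fcoord A j (lat (\<rho> i)) \<noteq> 0"
    using fcoord_expansion[OF assms, of "lat (\<rho> i)"] by (metis (no_types, lifting) scaleR_zero_left sum.neutral)
  then obtain j where j: "j \<in> A" "fcoord A j (lat (\<rho> i)) \<noteq> 0" by blast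
  have "fcoord A j (lat (\<rho> i)) *\<^sub>R lat (\<rho> j) \<in> cn A \<inter> cone_gen {\<rho> i}"
  proof (rule face_of_cone_summands[OF face convex_cone_cone_gen _ _ _ j(1)])
    show "fcoord A j (lat (\<rho> i)) *\<^sub>R lat (\<rho> j) \<in> cn A" if "j \<in> A" for j
      using mem mem_cn[OF assms] that
      by (intro convex_cone_scaleR[OF convex_cone_cone_gen] generator_mem_cn) auto
    show "(\<Sum>j\<in>A. fcoord A j (lat (\<rho> i)) *\<^sub>R lat (\<rho> j)) \<in> cn A \<inter> cone_gen {\<rho> i}"
      unfolding fcoord_expansion[OF assms] using mem generator_mem_cn[of i "{i}"] by simp
  qed simp
  moreover have "cone_gen {\<rho> i} = {t *\<^sub>R lat (\<rho> i) | t. t \<ge> 0}"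
  proof -
    have "convex_cone {t *\<^sub>R lat (\<rho> i) | t. t \<ge> 0}"
      unfolding convex_cone_iff
    proof (intro conjI ballI allI impI)
      show "0 \<in> {t *\<^sub>R lat (\<rho> i) | t. t \<ge> 0}" by (auto intro: exI[of _ 0])
    next
      fix x y assume "x \<in> {t *\<^sub>R lat (\<rho> i) | t. t \<ge> 0}" "y \<in> {t *\<^sub>R lat (\<rho> i) | t. t \<ge> 0}"
      thus "x + y \<in> {t *\<^sub>R lat (\<rho> i) | t. t \<ge> 0}"
        by (auto simp flip: scaleR_left.add intro: add_nonneg_nonneg)
    qed (auto intro: mult_nonneg_nonneg)
    hence "cone_gen {\<rho> i} \<subseteq> {t *\<^sub>R lat (\<rho> i) | t. t \<ge> 0}"
      unfolding cone_gen_def by (intro hull_minimal) (auto intro: exI[of _ 1])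
    moreover have "{t *\<^sub>R lat (\<rho> i) | t. t \<ge> 0} \<subseteq> cone_gen {\<rho> i}"
      using generator_mem_cn[of i "{i}"] by (auto intro: convex_cone_scaleR[OF convex_cone_cone_gen])
    ultimately show ?thesis by blast
  qed
  ultimately obtain t where t: "t \<ge> 0" "fcoord A j (lat (\<rho> i)) *\<^sub>R lat (\<rho> j) = t *\<^sub>R lat (\<rho> i)" by auto
  obtain b where b: "A = range b" "lattice_basis (\<lambda>k. \<rho> (b k))" using facetsE[OF assms] by metis
  obtain k where k: "j = b k" using j(1) b(1) by auto
  have "t \<noteq> 0" using t(2) j(2) lat_basis_nonzero[OF b(2), of k] k by auto
  hence "lat (\<rho> i) = (fcoord A j (lat (\<rho> i)) / t) *\<^sub>R lat (\<rho> (b k))"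
    using t(2) k by (metis divideR_right scaleR_scaleR divide_inverse_commute)
  moreover have "fcoord A j (lat (\<rho> i)) / t \<ge> 0"
    using mem mem_cn[OF assms] j(1) t(1) by (intro divide_nonneg_nonneg) auto
  ultimately have "\<rho> i = \<rho> (b k)" using primitive_on_basis_ray[OF b(2) primitive_rays] by blast
  thus "i \<in> A" using inj_rays k j(1) by (auto dest: injD)
qed (rule generator_mem_cn)

text \<open>The sum of the generators in \<open>S\<close> lies in some full-dimensional cone by
  \<open>facets_cover\<close>. That cone meets \<open>\<sigma>\<close> in a face of
  \<open>\<sigma>\<close>, which contains each summand as soon as it contains the sum.\<close>

lemma faces_iff:
  "S \<notin> nonfaces \<Sigma> \<rho> \<longleftrightarrow> (\<exists>A\<in>facets. S \<subseteq> A)"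
proof
  assume "S \<notin> nonfaces \<Sigma> \<rho>"
  then obtain \<sigma> where \<sigma>: "\<sigma> \<in> \<Sigma>" "\<And>i. i \<in> S \<Longrightarrow> lat (\<rho> i) \<in> \<sigma>" unfolding nonfaces_def by blast
  have cc: "convex_cone \<sigma>" using fan \<sigma>(1) convex_cone_cone_gen unfolding is_fan_def by metis
  obtain A where A: "A \<in> facets" "(\<Sum>i\<in>S. lat (\<rho> i)) \<in> cn A" using facets_cover by blast
  have "(\<Sum>i\<in>S. lat (\<rho> i)) \<in> \<sigma>" using \<sigma>(2) by (intro convex_cone_sum[OF cc]) auto
  hence "(\<Sum>i\<in>S. lat (\<rho> i)) \<in> \<sigma> \<inter> cn A" using A(2) by simp
  hence "lat (\<rho> i) \<in> \<sigma> \<inter> cn A" if "i \<in> S" for i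
    using face_of_cone_summands[OF Int_face_of[OF \<sigma>(1) cn_in_fan[OF A(1)]] cc, of S "\<lambda>i. lat (\<rho> i)" i]
      \<sigma>(2) that by simp
  hence "S \<subseteq> A" using generator_mem_cn_iff[OF A(1)] by auto
  thus "\<exists>A\<in>facets. S \<subseteq> A" using A(1) by blast
next
  assume "\<exists>A\<in>facets. S \<subseteq> A"
  thus "S \<notin> nonfaces \<Sigma> \<rho>" unfolding nonfaces_def using cn_in_fan generator_mem_cn by blast
qed

text \<open>A cone \<open>\<tau>\<close> of the fan that contains \<open>cn A\<close> has it as a
  face, and this face contains interior points of \<open>\<tau>\<close>.\<close>

lemma maximal_cn:
  assumes "A \<in> facets"
  shows "maximal_cone \<Sigma> (cn A)"
  unfolding maximal_cone_def
proof (intro conjI ballI impI)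
  fix \<tau> assume \<tau>: "\<tau> \<in> \<Sigma>" "cn A \<subseteq> \<tau>"
  obtain b where b: "lattice_basis (\<lambda>k. \<rho> (b k))" "cn A = cone_gen (range (\<lambda>k. \<rho> (b k)))"
    using facetsE[OF assms] by metis
  have "\<tau> \<inter> cn A = cn A" using \<tau>(2) by auto
  with Int_face_of[OF \<tau>(1) cn_in_fan[OF assms]] have "cn A face_of \<tau>" by simp
  moreover have "cn A \<inter> interior \<tau> \<noteq> {}"
    using interior_cone_gen_basis[OF b(1)] interior_mono[OF \<tau>(2)] interior_subset[of "cn A"]
    unfolding b(2)[symmetric] by blast
  ultimately show "\<tau> = cn A" using face_of_disjoint_interior by blast
qed (rule cn_in_fan[OF assms])

section \<open>Support functions and wall crossing\<close>

definition supp_fn :: "'d set \<Rightarrow> real ^ 'n \<Rightarrow> real" where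
  "supp_fn A = (SOME l. linear l \<and> (\<forall>x\<in>cn A. \<psi> x = l x))"

lemma
  assumes "A \<in> facets"
  shows linear_supp_fn: "linear (supp_fn A)"
    and supp_fn_eq: "x \<in> cn A \<Longrightarrow> supp_fn A x = \<psi> x"
proof -
  have "\<exists>l. linear l \<and> (\<forall>x\<in>cn A. \<psi> x = l x)"
    using strictly_convex cn_in_fan[OF assms] unfolding strictly_convex_PL_def integral_PL_def by blast
  from someI_ex[OF this, folded supp_fn_def] show "linear (supp_fn A)" "x \<in> cn A \<Longrightarrow> supp_fn A x = \<psi> x"
    by simp_all
qed

text \<open>\<open>\<psi>\<close> is linear on the cone and convex everywhere. A small move from the
  interior point \<open>p\<close> towards \<open>x\<close> stays in the cone, and comparing
  linearity with convexity along this segment gives the inequality at \<open>x\<close>.\<close>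

lemma supp_fn_le:
  assumes A: "A \<in> facets"
  shows "supp_fn A x \<le> \<psi> x"
proof -
  let ?l = "supp_fn A"
  define p where "p = (\<Sum>i\<in>A. lat (\<rho> i))"
  define s where "s = 1 + (\<Sum>i\<in>A. \<bar>fcoord A i x\<bar>)"
  have s: "s \<ge> 1" unfolding s_def by (simp add: sum_nonneg)
  \<comment> \<open>With this \<open>\<epsilon>\<close> the coordinates of
    \<open>(1 - \<epsilon>) *\<^sub>R p + \<epsilon> *\<^sub>R x\<close> are
    \<open>\<epsilon> * (s + fcoord A i x)\<close>, and \<open>s\<close> exceeds every
    \<open>\<bar>fcoord A i x\<bar>\<close>.\<close>
  define \<epsilon> where "\<epsilon> = 1 / (1 + s)"
  have \<epsilon>: "0 < \<epsilon>" "\<epsilon> < 1" "1 - \<epsilon> = \<epsilon> * s" using s by (auto simp: \<epsilon>_def field_simps)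
  have p: "fcoord A i p = 1" if "i \<in> A" for i
    using that by (simp add: p_def linear_sum[OF linear_fcoord[OF A]] fcoord_basis[OF A])
  have pA: "p \<in> cn A" using p mem_cn[OF A] by simp
  have y: "(1 - \<epsilon>) *\<^sub>R p + \<epsilon> *\<^sub>R x \<in> cn A"
    unfolding mem_cn[OF A]
  proof
    fix i assume i: "i \<in> A"
    have "\<bar>fcoord A i x\<bar> \<le> s" unfolding s_def using i member_le_sum[of i A "\<lambda>i. \<bar>fcoord A i x\<bar>"] by auto
    hence "0 \<le> \<epsilon> * (s + fcoord A i x)" using \<epsilon>(1) by (intro mult_nonneg_nonneg) auto
    also have "\<dots> = fcoord A i ((1 - \<epsilon>) *\<^sub>R p + \<epsilon> *\<^sub>R x)"
      unfolding linear_add[OF linear_fcoord[OF A i]] linear_scale[OF linear_fcoord[OF A i]] p[OF i] real_scaleR_def \<epsilon>(3)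
      by (simp add: algebra_simps)
    finally show "0 \<le> fcoord A i ((1 - \<epsilon>) *\<^sub>R p + \<epsilon> *\<^sub>R x)" .
  qed
  have "(1 - \<epsilon>) * ?l p + \<epsilon> * ?l x = ?l ((1 - \<epsilon>) *\<^sub>R p + \<epsilon> *\<^sub>R x)"
    by (simp add: linear_add[OF linear_supp_fn[OF A]] linear_scale[OF linear_supp_fn[OF A]])
  also have "\<dots> = \<psi> ((1 - \<epsilon>) *\<^sub>R p + \<epsilon> *\<^sub>R x)" by (rule supp_fn_eq[OF A y])
  also have "\<dots> \<le> (1 - \<epsilon>) * \<psi> p + \<epsilon> * \<psi> x"
    using strictly_convex \<epsilon> convex_onD[of UNIV \<psi> \<epsilon> p x] unfolding strictly_convex_PL_def by auto
  finally have "\<epsilon> * ?l x \<le> \<epsilon> * \<psi> x" by (simp add: supp_fn_eq[OF A pA])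
  thus ?thesis using \<epsilon>(1) by simp
qed

lemma supp_fn_neq:
  assumes "A \<in> facets" "A' \<in> facets" "A \<noteq> A'"
  shows "supp_fn A \<noteq> supp_fn A'"
proof
  assume eq: "supp_fn A = supp_fn A'"
  have "\<forall>x\<in>cn A \<union> cn A'. \<psi> x = supp_fn A x"
    using supp_fn_eq[OF assms(1)] supp_fn_eq[OF assms(2)] eq by auto
  hence "cn A = cn A'"
    using strictly_convex maximal_cn[OF assms(1)] maximal_cn[OF assms(2)] linear_supp_fn[OF assms(1)]
    unfolding strictly_convex_PL_def by blast
  hence "A = A'" using generator_mem_cn_iff[OF assms(1)] generator_mem_cn_iff[OF assms(2)] by auto
  with assms(3) show False by simp
qed

text \<open>Points just beyond the wall opposite to the ray \<open>i\<close> lie, infinitely often,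
  in one cone \<open>cn A'\<close>, which in the limit contains the wall. Hence the two support
  functions differ by a multiple of the coordinate that vanishes on the wall. The sign of
  \<open>c\<close> is convexity, and \<open>c \<noteq> 0\<close> is strict convexity.\<close>

lemma wall_crossing:
  assumes A: "A \<in> facets" and i: "i \<in> A"
  obtains A' c where "A' \<in> facets" "A - {i} \<subseteq> A'" "c > 0"
    "\<And>x. supp_fn A' x = supp_fn A x - c * fcoord A i x"
proof -
  define p where "p = (\<Sum>j\<in>A-{i}. lat (\<rho> j))"
  \<comment> \<open>\<open>p\<close> lies in the relative interior of the wall, and
    \<open>q n\<close> tends to it from outside the cone.\<close>
  define q where "q = (\<lambda>n::nat. p - (1 / (real n + 1)) *\<^sub>R lat (\<rho> i))"
  have "\<forall>n\<in>UNIV. \<exists>A'\<in>facets. q n \<in> cn A'" using facets_cover by blast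
  from pigeonhole_infinite_rel[OF infinite_UNIV_nat finite_facets this]
  obtain A' where A': "A' \<in> facets" and inf: "infinite {n. q n \<in> cn A'}" by auto
  obtain n where n: "q n \<in> cn A'" using inf by (metis (mono_tags, lifting) finite.emptyI not_finite_existsD)
  have qi: "fcoord A i (q n) < 0"
  proof -
    have "fcoord A i p = 0"
      using i by (simp add: p_def linear_sum[OF linear_fcoord[OF A i]] fcoord_basis[OF A])
    thus ?thesis
      using i by (simp add: q_def linear_diff[OF linear_fcoord[OF A i]] linear_scale[OF linear_fcoord[OF A i]] fcoord_basis[OF A])
  qed
  have ne: "A' \<noteq> A" using n qi mem_cn[OF A] i by force
  have closed: "closed (cn A')" using facetsE[OF A'] closed_cone_gen_basis by metis
  have p: "p \<in> cn A'"
  proof -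
    obtain r :: "nat \<Rightarrow> nat" where r: "strict_mono r" "\<And>n. q (r n) \<in> cn A'"
      using infinite_enumerate[OF inf] by auto
    have "(\<lambda>n. p - (1 / (real n + 1)) *\<^sub>R lat (\<rho> i)) \<longlonglongrightarrow> p - 0 *\<^sub>R lat (\<rho> i)"
      by (intro tendsto_intros) (use LIMSEQ_inverse_real_of_nat in \<open>simp add: inverse_eq_divide add.commute\<close>)
    hence "q \<longlonglongrightarrow> p" by (simp add: q_def)
    from LIMSEQ_subseq_LIMSEQ[OF this r(1)] show ?thesis
      using closed_sequentially[OF closed, of "q \<circ> r"] r(2) by (simp add: o_def)
  qed
  have "p \<in> cn A" unfolding p_def using generator_mem_cn by (intro convex_cone_sum[OF convex_cone_cone_gen]) auto
  hence "p \<in> cn A \<inter> cn A'" using p by simp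
  hence "lat (\<rho> j) \<in> cn A \<inter> cn A'" if "j \<in> A - {i}" for j
    using face_of_cone_summands[OF Int_face_of[OF cn_in_fan[OF A] cn_in_fan[OF A']] convex_cone_cone_gen, of "A - {i}" "\<lambda>j. lat (\<rho> j)"]
      that generator_mem_cn unfolding p_def by auto
  hence sub: "A - {i} \<subseteq> A'" using generator_mem_cn_iff[OF A'] by auto
  define c where "c = supp_fn A (lat (\<rho> i)) - supp_fn A' (lat (\<rho> i))"
  have eq: "supp_fn A' x = supp_fn A x - c * fcoord A i x" for x
  proof -
    have *: "supp_fn A'' x = (\<Sum>j\<in>A. fcoord A j x * supp_fn A'' (lat (\<rho> j)))" if "A'' \<in> facets" for A''
      using arg_cong[OF fcoord_expansion[OF A, of x], of "supp_fn A''"]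
      by (simp add: linear_sum[OF linear_supp_fn[OF that]] linear_scale[OF linear_supp_fn[OF that]])
    have "supp_fn A (lat (\<rho> j)) = supp_fn A' (lat (\<rho> j))" if "j \<in> A - {i}" for j
      using that sub generator_mem_cn by (auto simp: supp_fn_eq[OF A] supp_fn_eq[OF A'])
    hence "(\<Sum>j\<in>A-{i}. fcoord A j x * supp_fn A (lat (\<rho> j))) = (\<Sum>j\<in>A-{i}. fcoord A j x * supp_fn A' (lat (\<rho> j)))"
      by (intro sum.cong) auto
    thus ?thesis
      unfolding *[OF A] *[OF A'] using i by (simp add: sum.remove[of A i] c_def algebra_simps)
  qed
  have "c \<ge> 0" unfolding c_def
    using supp_fn_le[OF A', of "lat (\<rho> i)"] supp_fn_eq[OF A generator_mem_cn[OF i]] by simp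
  moreover have "c \<noteq> 0" using supp_fn_neq[OF A A'] ne eq by auto
  ultimately show ?thesis using that[OF A' sub _ eq] by simp
qed

text \<open>
  The Bruggesser-Mani line shelling, in the dual form: the functionals \<open>supp_fn A\<close> are the vertices of
  a simple polytope, and they are ordered by their value at a generic vector \<open>v\<close>.
\<close>

lemma shelling:
  obtains w :: "'d set \<Rightarrow> real" and r :: "'d set \<Rightarrow> 'd set" where
    "inj_on w facets"
    "\<And>A. A \<in> facets \<Longrightarrow> r A \<subseteq> A"
    "\<And>A A'. A \<in> facets \<Longrightarrow> A' \<in> facets \<Longrightarrow> w A' < w A \<Longrightarrow> \<not> r A \<subseteq> A'"
    "\<And>A i. A \<in> facets \<Longrightarrow> i \<in> r A \<Longrightarrow> \<exists>A'\<in>facets. w A' < w A \<and> A - {i} \<subseteq> A'"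
proof -
  let ?P = "{(A, A'). A \<in> facets \<and> A' \<in> facets \<and> A \<noteq> A'}"
  \<comment> \<open>Two distinct support functions agree on a hyperplane only, so a generic
    \<open>v\<close> separates all of them.\<close>
  have "negligible (\<Union>(A,A')\<in>?P. {x. supp_fn A x = supp_fn A' x})"
  proof (rule negligible_Union)
    fix T assume "T \<in> (\<lambda>(A,A'). {x. supp_fn A x = supp_fn A' x}) ` ?P"
    then obtain A A' where A: "A \<in> facets" "A' \<in> facets" "A \<noteq> A'" and T: "T = {x. supp_fn A x = supp_fn A' x}"
      by auto
    obtain a a' where a: "\<And>x. supp_fn A x = a \<bullet> x" "\<And>x. supp_fn A' x = a' \<bullet> x"
      using linear_functional_inner[OF linear_supp_fn[OF A(1)]] linear_functional_inner[OF linear_supp_fn[OF A(2)]] by metis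
    have "a - a' \<noteq> 0" using supp_fn_neq[OF A] a by auto
    moreover have "T = {x. (a - a') \<bullet> x = 0}" using T a by (auto simp: inner_diff_left)
    ultimately show "negligible T" using negligible_hyperplane by blast
  qed simp
  hence "(\<Union>(A,A')\<in>?P. {x. supp_fn A x = supp_fn A' x}) \<noteq> UNIV" using open_not_negligible[OF open_UNIV UNIV_not_empty] by metis
  then obtain v where v: "\<And>A A'. A \<in> facets \<Longrightarrow> A' \<in> facets \<Longrightarrow> A \<noteq> A' \<Longrightarrow> supp_fn A v \<noteq> supp_fn A' v"
    by blast
  show ?thesis
  \<comment> \<open>By \<open>wall_crossing\<close>, passing the wall opposite to \<open>i\<close>
    changes the value at \<open>v\<close> by \<open>- c * fcoord A i v\<close>; the restriction set
    \<open>r A\<close> collects the walls whose crossing lowers it.\<close>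
  proof (rule that[of "\<lambda>A. supp_fn A v" "\<lambda>A. {i\<in>A. fcoord A i v > 0}"])
    show "inj_on (\<lambda>A. supp_fn A v) facets" using v by (meson inj_onI)
    fix A A' assume A: "A \<in> facets" "A' \<in> facets" "supp_fn A' v < supp_fn A v"
    show "\<not> {i\<in>A. fcoord A i v > 0} \<subseteq> A'"
    proof
      assume sub: "{i\<in>A. fcoord A i v > 0} \<subseteq> A'"
      have *: "supp_fn A'' v = (\<Sum>j\<in>A. fcoord A j v * supp_fn A'' (lat (\<rho> j)))" if "A'' \<in> facets" for A''
        using arg_cong[OF fcoord_expansion[OF A(1), of v], of "supp_fn A''"]
        by (simp add: linear_sum[OF linear_supp_fn[OF that]] linear_scale[OF linear_supp_fn[OF that]])
      have "supp_fn A v \<le> supp_fn A' v"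
        unfolding *[OF A(1)] *[OF A(2)]
      \<comment> \<open>Where the coordinate is positive both functions equal \<open>\<psi>\<close>;
        where it is not, the inequality \<open>supp_fn_le\<close> is multiplied by a nonpositive
        number.\<close>
      proof (rule sum_mono)
        fix j assume j: "j \<in> A"
        have eA: "supp_fn A (lat (\<rho> j)) = \<psi> (lat (\<rho> j))" using j by (simp add: supp_fn_eq[OF A(1)] generator_mem_cn)
        show "fcoord A j v * supp_fn A (lat (\<rho> j)) \<le> fcoord A j v * supp_fn A' (lat (\<rho> j))"
        proof (cases "fcoord A j v > 0")
          case True
          hence "j \<in> A'" using sub j by auto
          thus ?thesis using eA by (simp add: supp_fn_eq[OF A(2)] generator_mem_cn)
        next
          case False
          thus ?thesis using eA supp_fn_le[OF A(2)] by (intro mult_left_mono_neg) auto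
        qed
      qed
      with A(3) show False by simp
    qed
  next
    fix A i assume A: "A \<in> facets" "i \<in> {i\<in>A. fcoord A i v > 0}"
    hence i: "i \<in> A" "fcoord A i v > 0" by auto
    obtain A' c where "A' \<in> facets" "A - {i} \<subseteq> A'" "c > 0" "\<And>x. supp_fn A' x = supp_fn A x - c * fcoord A i x"
      using wall_crossing[OF A(1) i(1)] by metis
    thus "\<exists>A'\<in>facets. supp_fn A' v < supp_fn A v \<and> A - {i} \<subseteq> A'"
      using i(2) by (intro bexI[of _ A']) auto
  qed auto
qed

end


section \<open>Mixed complexes exact in positive degrees\<close>

text \<open>Closure and additivity in the vector are what coset arithmetic and the Cauchy product
  work with, and both quotients and power series inherit them.\<close>

locale smodule = abelian_group V for V :: "('c::comm_ring_1, 'm) module" (structure) +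
  assumes smult_closed [simp, intro]: "x \<in> carrier V \<Longrightarrow> a \<odot> x \<in> carrier V"
    and smult_add: "x \<in> carrier V \<Longrightarrow> y \<in> carrier V \<Longrightarrow> a \<odot> (x \<oplus> y) = a \<odot> x \<oplus> a \<odot> y"

context abelian_group
begin

lemma minus_add_cancel: "x \<in> carrier G \<Longrightarrow> y \<in> carrier G \<Longrightarrow> (x \<ominus> y) \<oplus> y = x"
  by (simp add: minus_eq a_assoc l_neg)

lemma add_minus_cancel: "x \<in> carrier G \<Longrightarrow> y \<in> carrier G \<Longrightarrow> (x \<oplus> y) \<ominus> y = x"
  by (simp add: minus_eq a_assoc r_neg)

lemma minus_eq_iff: "x \<in> carrier G \<Longrightarrow> y \<in> carrier G \<Longrightarrow> z \<in> carrier G \<Longrightarrow> x \<ominus> y = z \<longleftrightarrow> x = z \<oplus> y"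
  using minus_add_cancel add_minus_cancel by metis

lemma add_eq_iff_minus: "x \<in> carrier G \<Longrightarrow> y \<in> carrier G \<Longrightarrow> x \<oplus> y = \<zero> \<longleftrightarrow> y = \<ominus> x"
  by (metis minus_equality minus_minus r_neg a_comm a_inv_closed)

lemma double_diff: "x \<in> carrier G \<Longrightarrow> y \<in> carrier G \<Longrightarrow> x \<ominus> (x \<ominus> y) = y"
  by (simp add: minus_eq minus_add r_neg1 r_neg2)

lemma additive_subgroup_closedI:
  assumes "H \<subseteq> carrier G" "\<zero> \<in> H" "\<And>x y. x \<in> H \<Longrightarrow> y \<in> H \<Longrightarrow> x \<oplus> y \<in> H" "\<And>x. x \<in> H \<Longrightarrow> \<ominus> x \<in> H"
  shows "additive_subgroup H G"
  by (rule additive_subgroupI, rule group.subgroupI[OF a_group]) (use assms in \<open>auto simp: a_inv_def\<close>)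

lemma mem_a_r_coset: "y \<in> H +> x \<longleftrightarrow> (\<exists>h\<in>H. y = h \<oplus> x)"
  by (auto simp: a_r_coset_def')

lemma a_r_coset_absorb:
  assumes "additive_subgroup H G" "x \<in> H"
  shows "H +> x = H"
  using a_coset_join2[OF _ additive_subgroup.a_subgroup[OF assms(1)] assms(2)]
    additive_subgroup.a_subset[OF assms(1)] assms(2) by blast

lemma a_r_coset_eq_iff:
  assumes "additive_subgroup H G" "x \<in> carrier G" "y \<in> carrier G"
  shows "H +> x = H +> y \<longleftrightarrow> x \<ominus> y \<in> H"
proof -
  interpret additive_subgroup H G by fact
  have "abelian_subgroup H G" by (rule abelian_subgroupI3[OF assms(1) abelian_group_axioms])
  then interpret abelian_subgroup H G .
  show ?thesis
  proof
    assume "H +> x = H +> y"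
    hence "x \<in> H +> y" using a_rcos_self[OF assms(2)] by simp
    then obtain h where "h \<in> H" "x = h \<oplus> y" by (auto simp: mem_a_r_coset)
    thus "x \<ominus> y \<in> H" using assms(3) a_subset by (auto simp: add_minus_cancel)
  next
    assume "x \<ominus> y \<in> H"
    hence "x \<in> H +> y" using minus_add_cancel[OF assms(2,3)] by (auto simp: mem_a_r_coset intro: bexI[of _ "x \<ominus> y"])
    thus "H +> x = H +> y" using a_repr_independence assms(3) a_subgroup by metis
  qed
qed

end

lemma singleton_abelian_group:
  assumes "carrier M = {\<zero>\<^bsub>M\<^esub>}" "\<zero>\<^bsub>M\<^esub> \<oplus>\<^bsub>M\<^esub> \<zero>\<^bsub>M\<^esub> = \<zero>\<^bsub>M\<^esub>"
  shows "abelian_group M"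
  by (rule abelian_groupI) (use assms in auto)

definition lin_map :: "('c, 'm) module \<Rightarrow> ('c, 'k) module \<Rightarrow> ('m \<Rightarrow> 'k) \<Rightarrow> bool" where
  "lin_map V W f \<longleftrightarrow> (\<forall>x\<in>carrier V. f x \<in> carrier W) \<and>
     (\<forall>x\<in>carrier V. \<forall>y\<in>carrier V. f (x \<oplus>\<^bsub>V\<^esub> y) = f x \<oplus>\<^bsub>W\<^esub> f y) \<and>
     (\<forall>a. \<forall>x\<in>carrier V. f (a \<odot>\<^bsub>V\<^esub> x) = a \<odot>\<^bsub>W\<^esub> f x)"

locale lin_map_pair = V?: abelian_group V + W?: abelian_group W
  for V :: "('c, 'm) module" and W :: "('c, 'k) module" +
  fixes f
  assumes lin: "lin_map V W f"
begin

lemma closed: "x \<in> carrier V \<Longrightarrow> f x \<in> carrier W"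
  and add: "x \<in> carrier V \<Longrightarrow> y \<in> carrier V \<Longrightarrow> f (x \<oplus>\<^bsub>V\<^esub> y) = f x \<oplus>\<^bsub>W\<^esub> f y"
  and smult: "x \<in> carrier V \<Longrightarrow> f (a \<odot>\<^bsub>V\<^esub> x) = a \<odot>\<^bsub>W\<^esub> f x"
  using lin unfolding lin_map_def by auto

lemma zero: "f \<zero>\<^bsub>V\<^esub> = \<zero>\<^bsub>W\<^esub>"
  using add[of "\<zero>\<^bsub>V\<^esub>" "\<zero>\<^bsub>V\<^esub>"] closed[of "\<zero>\<^bsub>V\<^esub>"] W.add.l_cancel_one by simp

lemma neg: "x \<in> carrier V \<Longrightarrow> f (\<ominus>\<^bsub>V\<^esub> x) = \<ominus>\<^bsub>W\<^esub> f x"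
  using add[of x "\<ominus>\<^bsub>V\<^esub> x"] by (metis V.a_inv_closed V.r_neg W.add_eq_iff_minus closed zero)

lemma diff: "x \<in> carrier V \<Longrightarrow> y \<in> carrier V \<Longrightarrow> f (x \<ominus>\<^bsub>V\<^esub> y) = f x \<ominus>\<^bsub>W\<^esub> f y"
  by (simp add: V.minus_eq W.minus_eq add neg)

lemma finsum: "finite I \<Longrightarrow> g \<in> I \<rightarrow> carrier V \<Longrightarrow>
    f (\<Oplus>\<^bsub>V\<^esub>i\<in>I. g i) = (\<Oplus>\<^bsub>W\<^esub>i\<in>I. f (g i))"
proof (induction I rule: finite_induct)
  case (insert i I)
  have "(\<lambda>i. f (g i)) \<in> I \<rightarrow> carrier W" using insert.prems closed by auto
  thus ?case using insert closed by (simp add: V.finsum_insert W.finsum_insert add V.finsum_closed)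
qed (simp add: zero)

end

lemma lin_map_pairI: "abelian_group V \<Longrightarrow> abelian_group W \<Longrightarrow> lin_map V W f \<Longrightarrow> lin_map_pair V W f"
  by (simp add: lin_map_pair_def lin_map_pair_axioms_def)

context smodule
begin

lemma pser_carrier: "carrier (pser_module V) = {x. \<forall>j. x j \<in> carrier V}"
  and pser_zero: "\<zero>\<^bsub>pser_module V\<^esub> = (\<lambda>j. \<zero>)"
  and pser_add: "x \<oplus>\<^bsub>pser_module V\<^esub> y = (\<lambda>j. x j \<oplus> y j)"
  and pser_smult: "a \<odot>\<^bsub>pser_module V\<^esub> x = (\<lambda>j. \<Oplus>i\<in>{..j}. fps_nth a i \<odot> x (j - i))"
  by (simp_all add: pser_module_def)

lemma pser_smodule: "smodule (pser_module V)"
proof (intro smodule.intro smodule_axioms.intro)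
  show "abelian_group (pser_module V)"
  proof (rule abelian_groupI)
    fix x assume "x \<in> carrier (pser_module V)"
    thus "\<exists>y\<in>carrier (pser_module V). y \<oplus>\<^bsub>pser_module V\<^esub> x = \<zero>\<^bsub>pser_module V\<^esub>"
      by (intro bexI[of _ "\<lambda>j. \<ominus> x j"]) (auto simp: pser_carrier pser_zero pser_add l_neg)
  qed (auto simp: pser_carrier pser_zero pser_add a_assoc intro: a_comm)
next
  fix x :: "nat \<Rightarrow> 'm" and a assume x: "x \<in> carrier (pser_module V)"
  thus "a \<odot>\<^bsub>pser_module V\<^esub> x \<in> carrier (pser_module V)"
    by (auto simp: pser_carrier pser_smult intro!: finsum_closed)
  fix y assume y: "y \<in> carrier (pser_module V)"
  show "a \<odot>\<^bsub>pser_module V\<^esub> (x \<oplus>\<^bsub>pser_module V\<^esub> y) = a \<odot>\<^bsub>pser_module V\<^esub> x \<oplus>\<^bsub>pser_module V\<^esub> a \<odot>\<^bsub>pser_module V\<^esub> y"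
    using x y by (auto simp: pser_carrier pser_smult pser_add smult_add finsum_addf Pi_def)
qed

lemma pser_neg: "x \<in> carrier (pser_module V) \<Longrightarrow> \<ominus>\<^bsub>pser_module V\<^esub> x = (\<lambda>j. \<ominus> x j)"
proof -
  assume x: "x \<in> carrier (pser_module V)"
  interpret P: smodule "pser_module V" by (rule pser_smodule)
  show ?thesis
    by (rule P.minus_equality) (use x in \<open>auto simp: pser_carrier pser_zero pser_add l_neg\<close>)
qed

lemma pser_diff: "x \<in> carrier (pser_module V) \<Longrightarrow> y \<in> carrier (pser_module V) \<Longrightarrow>
    x \<ominus>\<^bsub>pser_module V\<^esub> y = (\<lambda>j. x j \<ominus> y j)"
  by (simp add: a_minus_def pser_neg pser_add)

lemma smult_zero: "a \<odot> \<zero> = \<zero>"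
  using smult_add[of \<zero> \<zero> a] add.l_cancel_one[of "a \<odot> \<zero>" "a \<odot> \<zero>"] by simp

lemma smult_neg: "x \<in> carrier V \<Longrightarrow> a \<odot> (\<ominus> x) = \<ominus> (a \<odot> x)"
  using smult_add[of x "\<ominus> x" a] add_eq_iff_minus[of "a \<odot> x" "a \<odot> (\<ominus> x)"] by (simp add: r_neg smult_zero)

lemma smult_diff: "x \<in> carrier V \<Longrightarrow> y \<in> carrier V \<Longrightarrow> a \<odot> (x \<ominus> y) = a \<odot> x \<ominus> a \<odot> y"
  by (simp add: minus_eq smult_add smult_neg)

lemma quot_carrier: "carrier (quot_module V B) = {B +> x | x. x \<in> carrier V}"
  and quot_zero: "\<zero>\<^bsub>quot_module V B\<^esub> = B"
  by (auto simp: quot_module_def A_RCOSETS_def' a_r_coset_def')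

text \<open>\<open>quot_module\<close> scales a coset by a union over its elements; as
  \<open>B\<close> is closed under \<open>a\<close>, all elements contribute the same coset.\<close>

lemma quot_smult:
  assumes B: "additive_subgroup B V" "\<And>b. b \<in> B \<Longrightarrow> a \<odot> b \<in> B" and x: "x \<in> carrier V"
  shows "a \<odot>\<^bsub>quot_module V B\<^esub> (B +> x) = B +> (a \<odot> x)"
proof -
  have sub: "B \<subseteq> carrier V" by (rule additive_subgroup.a_subset[OF B(1)])
  have "B +> (a \<odot> y) = B +> (a \<odot> x)" if y: "y \<in> B +> x" for y
  proof -
    obtain b where b: "b \<in> B" "y = b \<oplus> x" using y by (auto simp: mem_a_r_coset)
    have "a \<odot> y = a \<odot> b \<oplus> a \<odot> x" unfolding b(2) using b(1) sub x by (intro smult_add) auto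
    hence "a \<odot> y \<ominus> a \<odot> x = a \<odot> b" using b sub x by (simp add: add_minus_cancel subset_iff)
    thus ?thesis using b B(2)[OF b(1)] sub x
      by (subst a_r_coset_eq_iff[OF B(1)]) auto
  qed
  moreover have "x \<in> B +> x"
    using additive_subgroup.zero_closed[OF B(1)] x by (auto simp: mem_a_r_coset intro!: bexI[of _ \<zero>])
  ultimately have "(\<Union>y\<in>B +> x. B +> (a \<odot> y)) = B +> (a \<odot> x)" by blast
  thus ?thesis by (simp add: quot_module_def)
qed

lemma quot_add:
  assumes B: "additive_subgroup B V" and "x \<in> carrier V" "y \<in> carrier V"
  shows "(B +> x) \<oplus>\<^bsub>quot_module V B\<^esub> (B +> y) = B +> (x \<oplus> y)"
proof -
  interpret abelian_subgroup B V by (rule abelian_subgroupI3[OF B abelian_group_axioms])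
  show ?thesis using a_rcos_sum[OF assms(2,3)] by (simp add: quot_module_def)
qed

lemma quot_abelian_group:
  assumes B: "additive_subgroup B V"
  shows "abelian_group (quot_module V B)"
proof -
  have z: "\<zero>\<^bsub>quot_module V B\<^esub> = B +> \<zero>"
    using a_r_coset_absorb[OF B additive_subgroup.zero_closed[OF B]] by (simp add: quot_zero)
  show ?thesis
  proof (rule abelian_groupI)
    fix x assume "x \<in> carrier (quot_module V B)"
    then obtain x' where "x = B +> x'" "x' \<in> carrier V" by (auto simp: quot_carrier)
    thus "\<exists>y\<in>carrier (quot_module V B). y \<oplus>\<^bsub>quot_module V B\<^esub> x = \<zero>\<^bsub>quot_module V B\<^esub>"
      by (intro bexI[of _ "B +> (\<ominus> x')"]) (auto simp: quot_carrier quot_add[OF B] l_neg z)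
  next
    fix x y assume "x \<in> carrier (quot_module V B)" "y \<in> carrier (quot_module V B)"
    then obtain x' y' where xy: "x = B +> x'" "x' \<in> carrier V" "y = B +> y'" "y' \<in> carrier V"
      by (auto simp: quot_carrier)
    show "x \<oplus>\<^bsub>quot_module V B\<^esub> y \<in> carrier (quot_module V B)"
      using xy by (auto simp: quot_add[OF B] quot_carrier)
    show "x \<oplus>\<^bsub>quot_module V B\<^esub> y = y \<oplus>\<^bsub>quot_module V B\<^esub> x"
      using xy by (simp add: quot_add[OF B] a_comm)
    fix w assume "w \<in> carrier (quot_module V B)"
    then obtain w' where "w = B +> w'" "w' \<in> carrier V" by (auto simp: quot_carrier)
    thus "x \<oplus>\<^bsub>quot_module V B\<^esub> y \<oplus>\<^bsub>quot_module V B\<^esub> w = x \<oplus>\<^bsub>quot_module V B\<^esub> (y \<oplus>\<^bsub>quot_module V B\<^esub> w)"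
      using xy by (simp add: quot_add[OF B] a_assoc)
  next
    show "\<zero>\<^bsub>quot_module V B\<^esub> \<in> carrier (quot_module V B)" by (auto simp: quot_carrier z)
    fix x assume "x \<in> carrier (quot_module V B)"
    thus "\<zero>\<^bsub>quot_module V B\<^esub> \<oplus>\<^bsub>quot_module V B\<^esub> x = x"
      by (auto simp: quot_carrier z quot_add[OF B])
  qed
qed

lemma quot_smodule:
  assumes B: "additive_subgroup B V" "\<And>a b. b \<in> B \<Longrightarrow> a \<odot> b \<in> B"
  shows "smodule (quot_module V B)"
proof (intro smodule.intro smodule_axioms.intro quot_abelian_group[OF B(1)])
  show "x \<in> carrier (quot_module V B) \<Longrightarrow> a \<odot>\<^bsub>quot_module V B\<^esub> x \<in> carrier (quot_module V B)" for a x
    using quot_smult[OF B] by (auto simp: quot_carrier)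
  fix a x y assume "x \<in> carrier (quot_module V B)" "y \<in> carrier (quot_module V B)"
  thus "a \<odot>\<^bsub>quot_module V B\<^esub> (x \<oplus>\<^bsub>quot_module V B\<^esub> y) =
      a \<odot>\<^bsub>quot_module V B\<^esub> x \<oplus>\<^bsub>quot_module V B\<^esub> a \<odot>\<^bsub>quot_module V B\<^esub> y"
    by (auto simp: quot_carrier quot_add[OF B(1)] quot_smult[OF B] smult_add)
qed

text \<open>When every cycle is a boundary, \<open>homology\<close> is a quotient of this form, with
  the single element \<open>B\<close>.\<close>

lemma quot_self:
  assumes B: "additive_subgroup B V" "\<And>a b. b \<in> B \<Longrightarrow> a \<odot> b \<in> B"
  defines "Q \<equiv> quot_module (V\<lparr>carrier := B\<rparr>) B"
  shows "carrier Q = {\<zero>\<^bsub>Q\<^esub>}" "\<zero>\<^bsub>Q\<^esub> \<oplus>\<^bsub>Q\<^esub> \<zero>\<^bsub>Q\<^esub> = \<zero>\<^bsub>Q\<^esub>" "a \<odot>\<^bsub>Q\<^esub> \<zero>\<^bsub>Q\<^esub> = \<zero>\<^bsub>Q\<^esub>"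
proof -
  have coset: "B +>\<^bsub>V\<lparr>carrier := B\<rparr>\<^esub> x = B +> x" for x
    by (simp add: a_r_coset_def')
  have abs: "x \<in> B \<Longrightarrow> B +> x = B" for x by (rule a_r_coset_absorb[OF B(1)])
  have ne: "\<zero> \<in> B" by (rule additive_subgroup.zero_closed[OF B(1)])
  show "carrier Q = {\<zero>\<^bsub>Q\<^esub>}"
  proof -
    have "(\<Union>x\<in>B. {B +> x}) = {B}" using abs ne by blast
    thus ?thesis by (simp add: Q_def quot_module_def A_RCOSETS_def' a_r_coset_def')
  qed
  have "B <+> B = B" by (rule subgroup_add_id[OF additive_subgroup.a_subgroup[OF B(1)]])
  thus "\<zero>\<^bsub>Q\<^esub> \<oplus>\<^bsub>Q\<^esub> \<zero>\<^bsub>Q\<^esub> = \<zero>\<^bsub>Q\<^esub>" by (simp add: Q_def quot_module_def set_add_def')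
  have "(\<Union>y\<in>B. B +> (a \<odot> y)) = B" using B(2) abs ne by blast
  thus "a \<odot>\<^bsub>Q\<^esub> \<zero>\<^bsub>Q\<^esub> = \<zero>\<^bsub>Q\<^esub>"
    by (simp add: Q_def quot_module_def coset)
qed

end

lemma module_iso_singletons:
  assumes "carrier M = {\<zero>\<^bsub>M\<^esub>}" "\<zero>\<^bsub>M\<^esub> \<oplus>\<^bsub>M\<^esub> \<zero>\<^bsub>M\<^esub> = \<zero>\<^bsub>M\<^esub>" "\<And>a. a \<odot>\<^bsub>M\<^esub> \<zero>\<^bsub>M\<^esub> = \<zero>\<^bsub>M\<^esub>"
    and "carrier N = {\<zero>\<^bsub>N\<^esub>}" "\<zero>\<^bsub>N\<^esub> \<oplus>\<^bsub>N\<^esub> \<zero>\<^bsub>N\<^esub> = \<zero>\<^bsub>N\<^esub>" "\<And>a. a \<odot>\<^bsub>N\<^esub> \<zero>\<^bsub>N\<^esub> = \<zero>\<^bsub>N\<^esub>"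
  shows "module_iso M N"
  unfolding module_iso_def using assms by (intro exI[of _ "\<lambda>_. \<zero>\<^bsub>N\<^esub>"]) (auto simp: bij_betw_def)

text \<open>The natural map goes from series of homology classes to classes of series, opposite to
  the direction in which the isomorphism is stated; hence the inversion.\<close>

lemma module_iso_sym:
  assumes M: "smodule M" and N: "smodule N" and \<phi>: "bij_betw \<phi> (carrier M) (carrier N)" "lin_map M N \<phi>"
  shows "module_iso N M"
proof -
  interpret M: smodule M by (rule M)
  interpret N: smodule N by (rule N)
  let ?g = "inv_into (carrier M) \<phi>"
  have g: "?g y \<in> carrier M" "\<phi> (?g y) = y" if "y \<in> carrier N" for y
    using that \<phi>(1) by (auto simp: bij_betw_def inv_into_into f_inv_into_f)
  have g': "?g (\<phi> x) = x" if "x \<in> carrier M" for x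
    using that \<phi>(1) by (auto simp: bij_betw_def)
  show ?thesis
    unfolding module_iso_def
  proof (intro exI[of _ ?g] conjI ballI allI)
    show "bij_betw ?g (carrier N) (carrier M)" by (rule bij_betw_inv_into[OF \<phi>(1)])
    fix x y assume x: "x \<in> carrier N" and y: "y \<in> carrier N"
    have "\<phi> (?g x \<oplus>\<^bsub>M\<^esub> ?g y) = x \<oplus>\<^bsub>N\<^esub> y" using g[OF x] g[OF y] \<phi>(2) by (simp add: lin_map_def)
    thus "?g (x \<oplus>\<^bsub>N\<^esub> y) = ?g x \<oplus>\<^bsub>M\<^esub> ?g y" using g'[of "?g x \<oplus>\<^bsub>M\<^esub> ?g y"] g[OF x] g[OF y] by simp
  next
    fix a x assume x: "x \<in> carrier N"
    have "\<phi> (a \<odot>\<^bsub>M\<^esub> ?g x) = a \<odot>\<^bsub>N\<^esub> x" using g[OF x] \<phi>(2) by (simp add: lin_map_def)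
    thus "?g (a \<odot>\<^bsub>N\<^esub> x) = a \<odot>\<^bsub>M\<^esub> ?g x" using g'[of "a \<odot>\<^bsub>M\<^esub> ?g x"] g[OF x] by simp
  qed
qed

section \<open>Vector spaces and linear complements\<close>

locale vspace = smodule V for V :: "('c::field, 'm) module" (structure) +
  assumes smult_plus: "x \<in> carrier V \<Longrightarrow> (a + b) \<odot> x = a \<odot> x \<oplus> b \<odot> x"
    and smult_assoc: "x \<in> carrier V \<Longrightarrow> (a * b) \<odot> x = a \<odot> (b \<odot> x)"
    and smult_one: "x \<in> carrier V \<Longrightarrow> 1 \<odot> x = x"
begin

lemma zero_smult: "x \<in> carrier V \<Longrightarrow> 0 \<odot> x = \<zero>"
  using smult_plus[of x 0 0] add.l_cancel_one[of "0 \<odot> x" "0 \<odot> x"] by simp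

lemma minus_one_smult: "x \<in> carrier V \<Longrightarrow> (-1) \<odot> x = \<ominus> x"
  using smult_plus[of x "-1" 1] zero_smult[of x] smult_one[of x] minus_equality[of "(-1) \<odot> x" x] by simp

definition subsp :: "'m set \<Rightarrow> bool" where
  "subsp H \<longleftrightarrow> H \<subseteq> carrier V \<and> \<zero> \<in> H \<and> (\<forall>x\<in>H. \<forall>y\<in>H. x \<oplus> y \<in> H) \<and> (\<forall>a. \<forall>x\<in>H. a \<odot> x \<in> H)"

lemma subsp_neg: "subsp H \<Longrightarrow> x \<in> H \<Longrightarrow> \<ominus> x \<in> H"
  using minus_one_smult[of x] unfolding subsp_def by (metis subsetD)

lemma subsp_diff: "subsp H \<Longrightarrow> x \<in> H \<Longrightarrow> y \<in> H \<Longrightarrow> x \<ominus> y \<in> H"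
  using subsp_neg unfolding subsp_def minus_eq by blast

lemma subsp_additive_subgroup: "subsp H \<Longrightarrow> additive_subgroup H V"
  by (rule additive_subgroup_closedI) (auto simp: subsp_def intro: subsp_neg)

text \<open>Zorn's lemma gives a maximal subspace \<open>H\<close> that meets \<open>B\<close> in
  zero, and \<open>p\<close> is the projection onto \<open>H\<close> along \<open>B\<close>. Its
  linearity later makes the choice of representatives in a quotient linear.\<close>

lemma complement_projection:
  assumes B: "subsp B"
  obtains p where "lin_map V V p" "\<And>x. x \<in> carrier V \<Longrightarrow> x \<ominus> p x \<in> B" "\<And>b. b \<in> B \<Longrightarrow> p b = \<zero>"
proof -
  let ?A = "{H. subsp H \<and> H \<inter> B = {\<zero>}}"
  have "\<exists>M\<in>?A. \<forall>X\<in>?A. M \<subseteq> X \<longrightarrow> X = M"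
  proof (rule subset_Zorn_nonempty)
    have "{\<zero>} \<in> ?A" using B by (auto simp: subsp_def smult_zero)
    thus "?A \<noteq> {}" by blast
    fix \<C> assume ne: "\<C> \<noteq> {}" and ch: "subset.chain ?A \<C>"
    have C: "subsp H" "H \<inter> B = {\<zero>}" if "H \<in> \<C>" for H using ch that by (auto simp: subset.chain_def)
    have lin: "H \<subseteq> H' \<or> H' \<subseteq> H" if "H \<in> \<C>" "H' \<in> \<C>" for H H'
      using ch that by (auto simp: subset_chain_def)
    have "subsp (\<Union>\<C>)"
      unfolding subsp_def
    proof (intro conjI ballI allI)
      show "\<Union>\<C> \<subseteq> carrier V" "\<zero> \<in> \<Union>\<C>" using C(1) ne unfolding subsp_def by blast+
      fix x y assume "x \<in> \<Union>\<C>" "y \<in> \<Union>\<C>"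
      then obtain H H' where HH: "H \<in> \<C>" "H' \<in> \<C>" "x \<in> H" "y \<in> H'" by blast
      then obtain K where "K \<in> \<C>" "x \<in> K" "y \<in> K" using lin[of H H'] by blast
      thus "x \<oplus> y \<in> \<Union>\<C>" using C(1)[of K] unfolding subsp_def by blast
    next
      fix a x assume "x \<in> \<Union>\<C>"
      then obtain K where "K \<in> \<C>" "x \<in> K" by blast
      thus "a \<odot> x \<in> \<Union>\<C>" using C(1)[of K] unfolding subsp_def by blast
    qed
    moreover have "\<Union>\<C> \<inter> B = {\<zero>}" using C(2) ne by auto
    ultimately show "\<Union>\<C> \<in> ?A" by simp
  qed
  then obtain H where H: "subsp H" "H \<inter> B = {\<zero>}" and max: "\<And>X. subsp X \<Longrightarrow> X \<inter> B = {\<zero>} \<Longrightarrow> H \<subseteq> X \<Longrightarrow> X = H"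
    by auto
  note Hs = H(1)[unfolded subsp_def] and Bs = B[unfolded subsp_def]
  \<comment> \<open>If \<open>x\<close> were not in \<open>H + B\<close>, adjoining it to
    \<open>H\<close> would contradict maximality: an element of \<open>B\<close> with a nonzero
    multiple of \<open>x\<close> in it can be rescaled to exhibit \<open>x\<close> as an element of
    \<open>H + B\<close>.\<close>
  have ex: "\<exists>h\<in>H. x \<ominus> h \<in> B" if x: "x \<in> carrier V" for x
  proof (rule ccontr)
    assume no: "\<not> (\<exists>h\<in>H. x \<ominus> h \<in> B)"
    let ?X = "{h \<oplus> c \<odot> x | h c. h \<in> H}"
    have "subsp ?X"
      unfolding subsp_def
    proof (intro conjI ballI allI)
      show "?X \<subseteq> carrier V" using Hs x by auto
      show "\<zero> \<in> ?X" using Hs x zero_smult[OF x] by (auto intro!: exI[of _ \<zero>] exI[of _ 0])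
      fix y z assume "y \<in> ?X" "z \<in> ?X"
      then obtain h c h' c' where *: "y = h \<oplus> c \<odot> x" "h \<in> H" "z = h' \<oplus> c' \<odot> x" "h' \<in> H" by blast
      have "h \<in> carrier V" "h' \<in> carrier V" using * Hs by auto
      hence "y \<oplus> z = (h \<oplus> h') \<oplus> (c + c') \<odot> x" using * x by (simp add: smult_plus a_ac)
      thus "y \<oplus> z \<in> ?X" using Hs * by blast
    next
      fix a y assume "y \<in> ?X"
      then obtain h c where *: "y = h \<oplus> c \<odot> x" "h \<in> H" by blast
      have "h \<in> carrier V" using * Hs by auto
      hence "a \<odot> y = a \<odot> h \<oplus> (a * c) \<odot> x" using * x by (simp add: smult_add smult_assoc)
      thus "a \<odot> y \<in> ?X" using Hs * by blast
    qed
    moreover have "?X \<inter> B = {\<zero>}"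
    proof -
      have "y = \<zero>" if yX: "y \<in> ?X" and yB: "y \<in> B" for y
      proof -
        obtain h c where *: "y = h \<oplus> c \<odot> x" "h \<in> H" using yX by blast
        have hV: "h \<in> carrier V" using * Hs by auto
        show ?thesis
        proof (cases "c = 0")
          case True
          hence "y = h" using * hV zero_smult[OF x] by simp
          thus ?thesis using yB * H(2) by auto
        next
          case False
          have "inverse c \<odot> y = inverse c \<odot> h \<oplus> x"
            unfolding *(1) using hV x False by (simp add: smult_add smult_one flip: smult_assoc)
          also have "\<dots> = x \<ominus> (- inverse c) \<odot> h"
            using hV x minus_one_smult[of "(- inverse c) \<odot> h"] smult_assoc[of h "-1" "- inverse c"]
            by (simp add: minus_eq a_comm)
          finally have "x \<ominus> (- inverse c) \<odot> h \<in> B" using Bs yB by metis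
          moreover have "(- inverse c) \<odot> h \<in> H" using Hs * by blast
          ultimately show ?thesis using no by blast
        qed
      qed
      moreover have "\<zero> \<in> ?X" using \<open>subsp ?X\<close> unfolding subsp_def by blast
      ultimately show ?thesis using Bs by blast
    qed
    moreover have "H \<subseteq> ?X"
    proof
      fix h assume h: "h \<in> H"
      hence "h = h \<oplus> 0 \<odot> x" using Hs zero_smult[OF x] by auto
      thus "h \<in> ?X" using h by blast
    qed
    ultimately have "?X = H" by (rule max)
    moreover have "\<zero> \<oplus> 1 \<odot> x \<in> ?X" using Hs by blast
    hence "x \<in> ?X" using x by (simp add: smult_one)
    ultimately have "x \<in> H" by simp
    moreover have "x \<ominus> x \<in> B" using Bs x by (simp add: minus_eq r_neg)
    ultimately show False using no by blast
  qed
  define p where "p x = (SOME h. h \<in> H \<and> x \<ominus> h \<in> B)" for x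
  have p: "p x \<in> H" "x \<ominus> p x \<in> B" if "x \<in> carrier V" for x
    using someI_ex[of "\<lambda>h. h \<in> H \<and> x \<ominus> h \<in> B"] ex[OF that] unfolding p_def by auto
  \<comment> \<open>Two candidates differ by an element of \<open>H \<inter> B\<close>. Linearity of
    \<open>p\<close> follows from this uniqueness.\<close>
  have uniq: "p x = h" if "x \<in> carrier V" "h \<in> H" "x \<ominus> h \<in> B" for x h
  proof -
    have V: "h \<in> carrier V" "p x \<in> carrier V" using that p Hs by auto
    have "(x \<ominus> h) \<ominus> (x \<ominus> p x) = p x \<ominus> h"
    proof -
      have "(x \<ominus> h) \<ominus> (x \<ominus> p x) = (x \<ominus> (x \<ominus> p x)) \<ominus> h"
        using V that(1) by (simp add: minus_eq a_ac)
      thus ?thesis using V that(1) by (simp add: double_diff)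
    qed
    hence "p x \<ominus> h \<in> H \<inter> B" using subsp_diff[OF B that(3) p(2)[OF that(1)]] subsp_diff[OF H(1) p(1)[OF that(1)] that(2)] by auto
    hence "p x \<ominus> h = \<zero>" using H(2) by blast
    thus ?thesis using V by (simp add: minus_eq_iff)
  qed
  show ?thesis
  proof (rule that)
    show "lin_map V V p"
      unfolding lin_map_def
    proof (intro conjI ballI allI)
      show "p x \<in> carrier V" if "x \<in> carrier V" for x using p[OF that] Hs by auto
      fix x y assume x: "x \<in> carrier V" and y: "y \<in> carrier V"
      have V: "p x \<in> carrier V" "p y \<in> carrier V" using x y p Hs by auto
      have "(x \<oplus> y) \<ominus> (p x \<oplus> p y) = (x \<ominus> p x) \<oplus> (y \<ominus> p y)"
        using x y V by (simp add: minus_eq minus_add a_ac)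
      thus "p (x \<oplus> y) = p x \<oplus> p y" using x y p Hs Bs by (intro uniq) auto
    next
      fix a x assume x: "x \<in> carrier V"
      have V: "p x \<in> carrier V" using x p Hs by auto
      have "a \<odot> (x \<ominus> p x) = a \<odot> x \<ominus> a \<odot> p x"
        by (rule smult_diff[OF x V])
      hence "a \<odot> x \<ominus> a \<odot> p x \<in> B" using p(2)[OF x] Bs by metis
      thus "p (a \<odot> x) = a \<odot> p x" using x p[OF x] Hs Bs by (intro uniq) auto
    qed
    show "x \<in> carrier V \<Longrightarrow> x \<ominus> p x \<in> B" for x by (rule p)
    show "b \<in> B \<Longrightarrow> p b = \<zero>" for b
      using Hs Bs subsp_diff[OF B, of b \<zero>] by (intro uniq) auto
  qed
qed

end


section \<open>Spectral sequence and homology of a mixed complex\<close>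

text \<open>\<open>d0\<close>, \<open>d1\<close> and \<open>D\<close> abstract \<open>{f,-}\<close>,
  \<open>\<partial>\<close> and \<open>{f,-} + u\<partial>\<close>. The three identities are the
  coefficients of the square of \<open>D\<close>. The formula for \<open>D\<close> is tied to
  sequences from a single \<open>C i\<close>, because the addition belongs to a module of definite
  degree.\<close>

locale mixed_complex =
  fixes C :: "int \<Rightarrow> ('c::field, 'm) module" and d0 d1 :: "'m \<Rightarrow> 'm" and D :: "(nat \<Rightarrow> 'm) \<Rightarrow> nat \<Rightarrow> 'm"
  assumes vs: "vspace (C i)"
    and d0: "lin_map (C i) (C (i - 1)) d0"
    and d1: "lin_map (C i) (C (i - 1)) d1"
    and d0d0: "x \<in> carrier (C i) \<Longrightarrow> d0 (d0 x) = \<zero>\<^bsub>C (i - 2)\<^esub>"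
    and d0d1: "x \<in> carrier (C i) \<Longrightarrow> d0 (d1 x) \<oplus>\<^bsub>C (i - 2)\<^esub> d1 (d0 x) = \<zero>\<^bsub>C (i - 2)\<^esub>"
    and d1d1: "x \<in> carrier (C i) \<Longrightarrow> d1 (d1 x) = \<zero>\<^bsub>C (i - 2)\<^esub>"
    and neg: "i < 0 \<Longrightarrow> carrier (C i) = {\<zero>\<^bsub>C i\<^esub>}"
    and exact: "i \<ge> 1 \<Longrightarrow> x \<in> carrier (C i) \<Longrightarrow> d0 x = \<zero>\<^bsub>C (i - 1)\<^esub> \<Longrightarrow> \<exists>y\<in>carrier (C (i + 1)). d0 y = x"
    and D: "(\<And>j. X j \<in> carrier (C i)) \<Longrightarrow>
      D X = (\<lambda>j. case j of 0 \<Rightarrow> d0 (X 0) | Suc k \<Rightarrow> d0 (X (Suc k)) \<oplus>\<^bsub>C (i - 1)\<^esub> d1 (X k))"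
begin

abbreviation P :: "int \<Rightarrow> ('c fps, nat \<Rightarrow> 'm) module" where
  "P i \<equiv> pser_module (C i)"

lemma smod: "smodule (C i)"
  using vs vspace_def by blast

lemma grp: "abelian_group (C i)"
  using smod smodule_def by blast

lemma smodP: "smodule (P i)"
  by (rule smodule.pser_smodule[OF smod])

lemma grpP: "abelian_group (P i)"
  using smodP smodule_def by blast

lemmas carrierP = smodule.pser_carrier[OF smod]
  and zeroP = smodule.pser_zero[OF smod]
  and addP = smodule.pser_add[OF smod]
  and smultP = smodule.pser_smult[OF smod]
  and diffP = smodule.pser_diff[OF smod]

lemmas L0 = lin_map_pairI[OF grp grp d0]
lemmas L1 = lin_map_pairI[OF grp grp d1]

lemma L0': "lin_map_pair (C (i + 1)) (C i) d0" and L1': "lin_map_pair (C (i + 1)) (C i) d1"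
  using L0[of "i + 1"] L1[of "i + 1"] by simp_all

lemma L0'': "lin_map_pair (C (i - 1)) (C (i - 2)) d0" and L1'': "lin_map_pair (C (i - 1)) (C (i - 2)) d1"
  using L0[of "i - 1"] L1[of "i - 1"] by simp_all

lemma D_0: "x \<in> carrier (P i) \<Longrightarrow> D x 0 = d0 (x 0)"
  and D_Suc: "x \<in> carrier (P i) \<Longrightarrow> D x (Suc k) = d0 (x (Suc k)) \<oplus>\<^bsub>C (i - 1)\<^esub> d1 (x k)"
  by (subst D[of _ i]; simp add: carrierP)+

lemma D_lin: "lin_map (P i) (P (i - 1)) D"
proof -
  interpret A: vspace "C i" by (rule vs)
  interpret B: vspace "C (i - 1)" by (rule vs)
  interpret D0: lin_map_pair "C i" "C (i - 1)" d0 by (rule L0)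
  interpret D1: lin_map_pair "C i" "C (i - 1)" d1 by (rule L1)
  have cl: "D x j \<in> carrier (C (i - 1))" if "x \<in> carrier (P i)" for x j
    by (cases j) (use that D0.closed D1.closed in \<open>auto simp: D_0[OF that] D_Suc[OF that] carrierP\<close>)
  show ?thesis
    unfolding lin_map_def
  proof (intro conjI ballI allI)
    show "x \<in> carrier (P i) \<Longrightarrow> D x \<in> carrier (P (i - 1))" for x using cl by (simp add: carrierP)
  next
    fix x y assume x: "x \<in> carrier (P i)" and y: "y \<in> carrier (P i)"
    have xy: "x \<oplus>\<^bsub>P i\<^esub> y \<in> carrier (P i)" using x y by (auto simp: carrierP addP)
    have xc: "x j \<in> carrier (C i)" "y j \<in> carrier (C i)" for j using x y by (auto simp: carrierP)
    show "D (x \<oplus>\<^bsub>P i\<^esub> y) = D x \<oplus>\<^bsub>P (i - 1)\<^esub> D y"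
    proof
      fix j show "D (x \<oplus>\<^bsub>P i\<^esub> y) j = (D x \<oplus>\<^bsub>P (i - 1)\<^esub> D y) j"
      proof (cases j)
        case 0
        thus ?thesis unfolding addP[of "i-1"] 0 D_0[OF xy] D_0[OF x] D_0[OF y]
          by (simp add: addP D0.add xc)
      next
        case (Suc k)
        show ?thesis unfolding addP[of "i-1"] Suc D_Suc[OF xy] D_Suc[OF x] D_Suc[OF y]
          by (simp add: addP D0.add D1.add xc D0.closed D1.closed B.a_ac)
      qed
    qed
  next
    fix a x assume x: "x \<in> carrier (P i)"
    have ax: "a \<odot>\<^bsub>P i\<^esub> x \<in> carrier (P i)" by (rule smodule.smult_closed[OF smodP x])
    have xc: "x j \<in> carrier (C i)" for j using x by (auto simp: carrierP)
    show "D (a \<odot>\<^bsub>P i\<^esub> x) = a \<odot>\<^bsub>P (i - 1)\<^esub> D x"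
    proof
      fix j show "D (a \<odot>\<^bsub>P i\<^esub> x) j = (a \<odot>\<^bsub>P (i - 1)\<^esub> D x) j"
      proof (cases j)
        case 0
        have "{..0::nat} = {0}" by auto
        thus ?thesis unfolding smultP[of "i-1"] 0 D_0[OF ax]
          by (simp add: smultP D_0[OF x] D0.smult xc D0.closed)
      next
        case (Suc k)
        let ?f = "\<lambda>l. fps_nth a l \<odot>\<^bsub>C (i - 1)\<^esub> d0 (x (Suc k - l))"
        let ?h = "\<lambda>l. fps_nth a l \<odot>\<^bsub>C (i - 1)\<^esub> d1 (x (k - l))"
        have fc: "?f l \<in> carrier (C (i - 1))" "?h l \<in> carrier (C (i - 1))" for l
          using xc D0.closed D1.closed by auto
        have "D (a \<odot>\<^bsub>P i\<^esub> x) (Suc k) = finsum (C (i - 1)) ?f {..Suc k} \<oplus>\<^bsub>C (i - 1)\<^esub> finsum (C (i - 1)) ?h {..k}"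
          unfolding D_Suc[OF ax] by (simp add: smultP D0.finsum D1.finsum D0.smult D1.smult xc Pi_def del: A.finsum_Suc B.finsum_Suc)
        \<comment> \<open>The term of index \<open>Suc k\<close> multiplies \<open>D x 0\<close>,
          which has no \<open>d1\<close> part; the remaining two sums run over the same range and
          combine termwise.\<close>
        also have "finsum (C (i - 1)) ?f {..Suc k} = ?f (Suc k) \<oplus>\<^bsub>C (i - 1)\<^esub> finsum (C (i - 1)) ?f {..k}"
          by (rule B.finsum_Suc) (use fc in auto)
        also have "\<dots> \<oplus>\<^bsub>C (i - 1)\<^esub> finsum (C (i - 1)) ?h {..k} =
            ?f (Suc k) \<oplus>\<^bsub>C (i - 1)\<^esub> (finsum (C (i - 1)) (\<lambda>l. ?f l \<oplus>\<^bsub>C (i - 1)\<^esub> ?h l) {..k})"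
        proof -
          have "finsum (C (i - 1)) ?f {..k} \<in> carrier (C (i - 1))" "finsum (C (i - 1)) ?h {..k} \<in> carrier (C (i - 1))"
            using fc by (auto intro!: B.finsum_closed)
          moreover have "finsum (C (i - 1)) (\<lambda>l. ?f l \<oplus>\<^bsub>C (i - 1)\<^esub> ?h l) {..k} =
              finsum (C (i - 1)) ?f {..k} \<oplus>\<^bsub>C (i - 1)\<^esub> finsum (C (i - 1)) ?h {..k}"
            using fc by (intro B.finsum_addf) auto
          ultimately show ?thesis using fc(1)[of "Suc k"] by (simp add: B.a_assoc)
        qed
        also have "finsum (C (i - 1)) (\<lambda>l. ?f l \<oplus>\<^bsub>C (i - 1)\<^esub> ?h l) {..k} =
            finsum (C (i - 1)) (\<lambda>l. fps_nth a l \<odot>\<^bsub>C (i - 1)\<^esub> D x (Suc k - l)) {..k}"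
        proof (rule B.finsum_cong', rule refl)
          show "(\<lambda>l. fps_nth a l \<odot>\<^bsub>C (i - 1)\<^esub> D x (Suc k - l)) \<in> {..k} \<rightarrow> carrier (C (i - 1))" using cl[OF x] by auto
          fix l assume "l \<in> {..k}"
          hence "Suc k - l = Suc (k - l)" by auto
          thus "?f l \<oplus>\<^bsub>C (i - 1)\<^esub> ?h l = fps_nth a l \<odot>\<^bsub>C (i - 1)\<^esub> D x (Suc k - l)"
            using xc D0.closed D1.closed by (simp add: D_Suc[OF x] B.smult_add)
        qed
        also have "?f (Suc k) = fps_nth a (Suc k) \<odot>\<^bsub>C (i - 1)\<^esub> D x (Suc k - Suc k)" by (simp add: D_0[OF x])
        also have "fps_nth a (Suc k) \<odot>\<^bsub>C (i - 1)\<^esub> D x (Suc k - Suc k) \<oplus>\<^bsub>C (i - 1)\<^esub>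
           finsum (C (i - 1)) (\<lambda>l. fps_nth a l \<odot>\<^bsub>C (i - 1)\<^esub> D x (Suc k - l)) {..k} =
           finsum (C (i - 1)) (\<lambda>l. fps_nth a l \<odot>\<^bsub>C (i - 1)\<^esub> D x (Suc k - l)) {..Suc k}"
          by (rule B.finsum_Suc[symmetric]) (use cl[OF x] in auto)
        finally show ?thesis unfolding smultP[of "i-1"] Suc .
      qed
    qed
  qed
qed

lemmas LD = lin_map_pairI[OF grpP grpP D_lin]

lemma LD': "lin_map_pair (P (i + 1)) (P i) D"
  using LD[of "i + 1"] by simp

text \<open>The coefficient of \<open>u^0\<close> uses \<open>d0d0\<close>, that of
  \<open>u^1\<close> also the anticommutation \<open>d0d1\<close>, and all higher ones also
  \<open>d1d1\<close>.\<close>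

lemma D_D:
  assumes x: "x \<in> carrier (P i)"
  shows "D (D x) = \<zero>\<^bsub>P (i - 2)\<^esub>"
proof -
  interpret A: vspace "C i" by (rule vs)
  interpret B: vspace "C (i - 1)" by (rule vs)
  interpret E: vspace "C (i - 2)" by (rule vs)
  interpret D0: lin_map_pair "C i" "C (i - 1)" d0 by (rule L0)
  interpret D1: lin_map_pair "C i" "C (i - 1)" d1 by (rule L1)
  interpret D0': lin_map_pair "C (i - 1)" "C (i - 2)" d0 by (rule L0'')
  interpret D1': lin_map_pair "C (i - 1)" "C (i - 2)" d1 by (rule L1'')
  have Dx: "D x \<in> carrier (P (i - 1))" by (rule lin_map_pair.closed[OF LD x])
  have xc: "x j \<in> carrier (C i)" for j using x by (auto simp: carrierP)
  note DS = D_Suc[OF Dx, simplified]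
  note cls = D0.closed D1.closed D0'.closed D1'.closed
  have "D (D x) j = \<zero>\<^bsub>C (i - 2)\<^esub>" for j
  proof (cases j)
    case 0
    thus ?thesis by (simp add: D_0[OF Dx] D_0[OF x] d0d0 xc)
  next
    case (Suc k)
    have *: "d0 (d0 u \<oplus>\<^bsub>C (i - 1)\<^esub> d1 v) = d0 (d1 v)" if "u \<in> carrier (C i)" "v \<in> carrier (C i)" for u v
      using that by (simp add: D0'.add cls d0d0)
    show ?thesis
    proof (cases k)
      case 0
      thus ?thesis using Suc d0d1[OF xc] by (simp add: DS D_Suc[OF x] D_0[OF x] * xc)
    next
      case (Suc l)
      have "d1 (D x k) = d1 (d0 (x k))"
        unfolding Suc D_Suc[OF x] by (simp add: D1'.add cls xc d1d1)
      thus ?thesis using \<open>j = Suc k\<close> d0d1[OF xc] by (simp add: DS D_Suc[OF x] * xc)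
    qed
  qed
  thus ?thesis by (auto simp: zeroP)
qed

lemma D_D':
  assumes "x \<in> carrier (P (i + 1))"
  shows "D (D x) = \<zero>\<^bsub>P (i - 1)\<^esub>"
  using D_D[OF assms] by simp

text \<open>The equation is solved one power of \<open>u\<close> at a time: \<open>y (Suc k)\<close>
  is a \<open>d0\<close>-preimage of the difference of \<open>x (Suc k)\<close> and
  \<open>d1 (y k)\<close>.\<close>

lemma exactP:
  assumes i: "i \<ge> 1" and x: "x \<in> carrier (P i)" and Dx: "D x = \<zero>\<^bsub>P (i - 1)\<^esub>"
  shows "\<exists>y\<in>carrier (P (i + 1)). D y = x"
proof -
  interpret A: vspace "C i" by (rule vs)
  interpret B: vspace "C (i - 1)" by (rule vs)
  interpret E: vspace "C (i + 1)" by (rule vs)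
  interpret D0: lin_map_pair "C i" "C (i - 1)" d0 by (rule L0)
  interpret D1: lin_map_pair "C i" "C (i - 1)" d1 by (rule L1)
  interpret D0': lin_map_pair "C (i + 1)" "C i" d0 by (rule L0')
  interpret D1': lin_map_pair "C (i + 1)" "C i" d1 by (rule L1')
  note cls = D0.closed D1.closed D0'.closed D1'.closed
  have xc: "x j \<in> carrier (C i)" for j using x by (auto simp: carrierP)
  have Dxj: "D x j = \<zero>\<^bsub>C (i - 1)\<^esub>" for j using Dx by (simp add: zeroP)
  define g where "g z = (SOME y. y \<in> carrier (C (i + 1)) \<and> d0 y = z)" for z
  have g: "g z \<in> carrier (C (i + 1))" "d0 (g z) = z" if "z \<in> carrier (C i)" "d0 z = \<zero>\<^bsub>C (i - 1)\<^esub>" for z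
    using someI_ex[of "\<lambda>y. y \<in> carrier (C (i + 1)) \<and> d0 y = z"] exact[OF i that] unfolding g_def by auto
  define y where "y = rec_nat (g (x 0)) (\<lambda>k yk. g (x (Suc k) \<ominus>\<^bsub>C i\<^esub> d1 yk))"
  have y0: "y 0 = g (x 0)" and yS: "y (Suc k) = g (x (Suc k) \<ominus>\<^bsub>C i\<^esub> d1 (y k))" for k
    by (simp_all add: y_def)
  have anti: "d0 (d1 v) = \<ominus>\<^bsub>C (i - 1)\<^esub> d1 (d0 v)" if "v \<in> carrier (C (i + 1))" for v
    using d0d1[OF that] B.add_eq_iff_minus[of "d1 (d0 v)" "d0 (d1 v)"] that by (simp add: cls B.a_comm)
  \<comment> \<open>The last conjunct makes the next right-hand side a cycle:
    \<open>d0 (d1 (y k))\<close> is the negative of \<open>d1 (d0 (y k)) = d1 (x k)\<close>, so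
    \<open>d0\<close> of the right-hand side is the coefficient \<open>D x (Suc k)\<close>, which is
    zero.\<close>
  have y: "y k \<in> carrier (C (i + 1)) \<and> d0 (y k) = (case k of 0 \<Rightarrow> x 0 | Suc l \<Rightarrow> x k \<ominus>\<^bsub>C i\<^esub> d1 (y l)) \<and>
    d1 (d0 (y k)) = d1 (x k)" for k
  proof (induction k)
    case 0
    have "d0 (x 0) = \<zero>\<^bsub>C (i - 1)\<^esub>" using Dxj[of 0] by (simp add: D_0[OF x])
    thus ?case using g[OF xc] by (simp add: y0)
  next
    case (Suc k)
    hence yk: "y k \<in> carrier (C (i + 1))" "d1 (d0 (y k)) = d1 (x k)" by auto
    let ?z = "x (Suc k) \<ominus>\<^bsub>C i\<^esub> d1 (y k)"
    have z: "?z \<in> carrier (C i)" using xc yk cls by simp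
    have "d0 ?z = d0 (x (Suc k)) \<oplus>\<^bsub>C (i - 1)\<^esub> d1 (x k)"
      using xc yk anti[OF yk(1)] by (simp add: D0.diff cls B.minus_eq)
    also have "\<dots> = \<zero>\<^bsub>C (i - 1)\<^esub>" using Dxj[of "Suc k"] by (simp add: D_Suc[OF x])
    finally have "g ?z \<in> carrier (C (i + 1))" "d0 (g ?z) = ?z" using g[OF z] by auto
    moreover have "d1 ?z = d1 (x (Suc k))"
      using xc yk d1d1[OF yk(1)] by (simp add: D1.diff cls B.minus_eq)
    ultimately show ?case by (simp add: yS)
  qed
  have yP: "y \<in> carrier (P (i + 1))" using y by (simp add: carrierP)
  have "D y j = x j" for j
  proof (cases j)
    case 0
    thus ?thesis using y[of 0] by (simp add: D_0[OF yP])
  next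
    case (Suc k)
    thus ?thesis using y[of "Suc k"] y[of k] xc cls by (simp add: D_Suc[OF yP] A.minus_add_cancel)
  qed
  thus ?thesis using yP by auto
qed

text \<open>Multiplication by a power of \<open>u\<close> is a shift of the coefficients. For
  \<open>p < 0\<close> the conversion \<open>nat p\<close> gives 0, so there the filtration is the
  whole module.\<close>

lemma u_adic_iff: "x \<in> u_adic P p i \<longleftrightarrow> x \<in> carrier (P i) \<and> (\<forall>j<nat p. x j = \<zero>\<^bsub>C i\<^esub>)"
proof -
  interpret A: vspace "C i" by (rule vs)
  have sh: "fps_X ^ n \<odot>\<^bsub>P i\<^esub> x = (\<lambda>j. if j < n then \<zero>\<^bsub>C i\<^esub> else x (j - n))" if "x \<in> carrier (P i)" for x n
  proof
    fix j
    have xc: "x j \<in> carrier (C i)" for j using that by (auto simp: carrierP)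
    have "(fps_X ^ n \<odot>\<^bsub>P i\<^esub> x) j = finsum (C i) (\<lambda>l. if n = l then x (j - l) else \<zero>\<^bsub>C i\<^esub>) {..j}"
      unfolding smultP
      by (rule A.finsum_cong'[OF refl]) (use xc A.smult_one[OF xc] A.zero_smult[OF xc] in \<open>auto simp: fps_X_power_nth\<close>)
    also have "\<dots> = (if j < n then \<zero>\<^bsub>C i\<^esub> else x (j - n))"
    proof (cases "j < n")
      case True
      hence "finsum (C i) (\<lambda>l. if n = l then x (j - l) else \<zero>\<^bsub>C i\<^esub>) {..j} = finsum (C i) (\<lambda>l. \<zero>\<^bsub>C i\<^esub>) {..j}"
        by (intro A.finsum_cong'[OF refl]) auto
      thus ?thesis using True by (simp add: A.finsum_zero)
    next
      case False
      have "finsum (C i) (\<lambda>l. if n = l then x (j - l) else \<zero>\<^bsub>C i\<^esub>) {..j} = x (j - n)"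
        by (rule A.add.finprod_singleton) (use False xc in auto)
      thus ?thesis using False by simp
    qed
    finally show "(fps_X ^ n \<odot>\<^bsub>P i\<^esub> x) j = (if j < n then \<zero>\<^bsub>C i\<^esub> else x (j - n))" .
  qed
  show ?thesis
  proof
    assume "x \<in> u_adic P p i"
    thus "x \<in> carrier (P i) \<and> (\<forall>j<nat p. x j = \<zero>\<^bsub>C i\<^esub>)"
      unfolding u_adic_def by (auto simp: sh) (auto simp: carrierP)
  next
    assume x: "x \<in> carrier (P i) \<and> (\<forall>j<nat p. x j = \<zero>\<^bsub>C i\<^esub>)"
    have "(\<lambda>j. x (j + nat p)) \<in> carrier (P i)" using x by (auto simp: carrierP)
    moreover have "x = fps_X ^ nat p \<odot>\<^bsub>P i\<^esub> (\<lambda>j. x (j + nat p))"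
      using x by (subst sh[OF calculation]) auto
    ultimately show "x \<in> u_adic P p i" unfolding u_adic_def by blast
  qed
qed

lemma u_adic_additive_subgroup: "additive_subgroup (u_adic P p i) (P i)"
proof -
  interpret A: vspace "C i" by (rule vs)
  interpret AP: smodule "P i" by (rule smodP)
  show ?thesis
    by (rule AP.additive_subgroup_closedI)
       (auto simp: u_adic_iff addP zeroP A.pser_neg carrierP)
qed

lemma ss_Z_additive_subgroup: "additive_subgroup (ss_Z D (u_adic P) r p i) (P i)"
proof -
  interpret AP: smodule "P i" by (rule smodP)
  interpret BP: smodule "P (i - 1)" by (rule smodP)
  interpret L: lin_map_pair "P i" "P (i - 1)" D by (rule LD)
  interpret F: additive_subgroup "u_adic P p i" "P i" by (rule u_adic_additive_subgroup)
  interpret G: additive_subgroup "u_adic P (p + r) (i - 1)" "P (i - 1)" by (rule u_adic_additive_subgroup)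
  have sub: "x \<in> u_adic P p i \<Longrightarrow> x \<in> carrier (P i)" for x using F.a_subset by auto
  show ?thesis
  proof (rule AP.additive_subgroup_closedI)
    show "ss_Z D (u_adic P) r p i \<subseteq> carrier (P i)" using sub by (auto simp: ss_Z_def)
    show "\<zero>\<^bsub>P i\<^esub> \<in> ss_Z D (u_adic P) r p i" by (simp add: ss_Z_def L.zero)
    show "x \<oplus>\<^bsub>P i\<^esub> y \<in> ss_Z D (u_adic P) r p i"
      if "x \<in> ss_Z D (u_adic P) r p i" "y \<in> ss_Z D (u_adic P) r p i" for x y
      using that sub by (auto simp: ss_Z_def L.add)
    show "\<ominus>\<^bsub>P i\<^esub> x \<in> ss_Z D (u_adic P) r p i" if "x \<in> ss_Z D (u_adic P) r p i" for x
      using that sub F.a_inv_closed G.a_inv_closed by (auto simp: ss_Z_def L.neg)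
  qed
qed

lemma image_additive_subgroup:
  assumes "additive_subgroup H (P (i + 1))"
  shows "additive_subgroup (D ` H) (P i)"
proof -
  interpret AP: smodule "P i" by (rule smodP)
  interpret L: lin_map_pair "P (i + 1)" "P i" D by (rule LD')
  interpret F: additive_subgroup H "P (i + 1)" by (rule assms)
  have sub: "x \<in> H \<Longrightarrow> x \<in> carrier (P (i + 1))" for x using F.a_subset by auto
  show ?thesis
  proof (rule AP.additive_subgroup_closedI)
    show "D ` H \<subseteq> carrier (P i)" using sub L.closed by auto
    show "\<zero>\<^bsub>P i\<^esub> \<in> D ` H" using L.zero F.zero_closed by (metis imageI)
    show "\<And>x y. x \<in> D ` H \<Longrightarrow> y \<in> D ` H \<Longrightarrow> x \<oplus>\<^bsub>P i\<^esub> y \<in> D ` H"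
      using sub by (auto simp flip: L.add)
    show "\<And>x. x \<in> D ` H \<Longrightarrow> \<ominus>\<^bsub>P i\<^esub> x \<in> D ` H"
      using sub F.a_inv_closed by (auto simp flip: L.neg)
  qed
qed

lemma ss_B_additive_subgroup: "additive_subgroup (ss_B P D (u_adic P) r p i) (P i)"
  unfolding ss_B_def
  by (intro abelian_group.add_additive_subgroups grpP ss_Z_additive_subgroup image_additive_subgroup)

text \<open>The leading coefficient of an element of \<open>Z\<close> is a \<open>d0\<close>-cycle,
  hence a \<open>d0\<close>-boundary if \<open>i \<ge> 1\<close>. Subtracting a suitable
  \<open>D w\<close> moves the element one step up in the filtration without changing its image
  under \<open>D\<close>; by definition of \<open>ss_B\<close> that image is then zero on the
  page.\<close>

lemma degenerates: "degenerates_at_E1 P D (u_adic P)"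
  unfolding degenerates_at_E1_def
proof (intro allI impI ballI)
  fix r p i :: int and K
  assume r: "r \<ge> 1" and K: "K \<in> carrier (ss_page P D (u_adic P) r p i)"
  let ?Z = "ss_Z D (u_adic P)" and ?B = "ss_B P D (u_adic P)"
  interpret AP: smodule "P i" by (rule smodP)
  interpret BP: smodule "P (i - 1)" by (rule smodP)
  interpret L: lin_map_pair "P i" "P (i - 1)" D by (rule LD)
  interpret L': lin_map_pair "P (i + 1)" "P i" D by (rule LD')
  interpret Z: additive_subgroup "?Z r p i" "P i" by (rule ss_Z_additive_subgroup)
  have sub: "x \<in> u_adic P p i \<Longrightarrow> x \<in> carrier (P i)" for x p i by (simp add: u_adic_iff)
  have mono: "x \<in> u_adic P (p + 1) i \<Longrightarrow> x \<in> u_adic P p i" for x p i by (simp add: u_adic_iff)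
  obtain x0 where x0: "x0 \<in> ?Z r p i" "K = ?B r p i +>\<^bsub>P i\<^esub> x0"
    using K by (auto simp: ss_page_def quot_module_def A_RCOSETS_def' a_r_coset_def')
  \<comment> \<open>\<open>ss_diff\<close> takes a union over all elements of \<open>K\<close>, so
    the whole coset has to lie in \<open>?Z r p i\<close>, not only the representative.\<close>
  have BZ: "?B r p i \<subseteq> ?Z r p i"
  proof
    fix b assume "b \<in> ?B r p i"
    then obtain b1 b2 where b: "b = b1 \<oplus>\<^bsub>P i\<^esub> D b2" "b1 \<in> ?Z (r - 1) (p + 1) i" "b2 \<in> ?Z (r - 1) (p - r + 1) (i + 1)"
      by (auto simp: ss_B_def set_add_def')
    have "b1 \<in> ?Z r p i" using b(2) mono by (auto simp: ss_Z_def algebra_simps)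
    moreover have "b2 \<in> carrier (P (i + 1))" using b(3) sub by (auto simp: ss_Z_def)
    hence "D b2 \<in> ?Z r p i"
      using b(3) D_D' additive_subgroup.zero_closed[OF u_adic_additive_subgroup] by (auto simp: ss_Z_def)
    ultimately show "b \<in> ?Z r p i" unfolding b(1) by (rule Z.a_closed)
  qed
  have KZ: "K \<subseteq> ?Z r p i"
    unfolding x0(2) using BZ x0(1) by (auto simp: AP.mem_a_r_coset intro!: Z.a_closed)
  have Kne: "K \<noteq> {}"
    unfolding x0(2) using additive_subgroup.zero_closed[OF ss_B_additive_subgroup] by (auto simp: a_r_coset_def')
  have main: "D x \<in> ?B r (p + r) (i - 1)" if x: "x \<in> ?Z r p i" for x
  proof -
    have xF: "x \<in> u_adic P p i" and DxF: "D x \<in> u_adic P (p + r) (i - 1)" using x by (auto simp: ss_Z_def)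
    have xP: "x \<in> carrier (P i)" using sub xF by blast
    have "\<exists>y\<in>u_adic P (p + 1) i. D y = D x"
    \<comment> \<open>For \<open>p < 0\<close> the steps \<open>p\<close> and \<open>p + 1\<close>
      of the filtration coincide; for \<open>i < 1\<close> the target of \<open>D\<close> is
      zero.\<close>
    proof (cases "i < 1 \<or> p < 0")
      case True
      show ?thesis
      proof (cases "p < 0")
        case True
        thus ?thesis using xF by (intro bexI[of _ x]) (auto simp: u_adic_iff)
      next
        case False
        hence "i - 1 < 0" using True by auto
        hence "D z = (\<lambda>_. \<zero>\<^bsub>C (i - 1)\<^esub>)" if "z \<in> carrier (P i)" for z
          using L.closed[OF that] neg[of "i - 1"] by (auto simp: carrierP)
        hence "D x = D \<zero>\<^bsub>P i\<^esub>" using xP AP.zero_closed by metis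
        thus ?thesis using additive_subgroup.zero_closed[OF u_adic_additive_subgroup] by metis
      qed
    next
      case False
      hence i: "i \<ge> 1" and p: "p \<ge> 0" by auto
      interpret A: vspace "C i" by (rule vs)
      interpret A': vspace "C (i + 1)" by (rule vs)
      interpret D0: lin_map_pair "C i" "C (i - 1)" d0 by (rule L0)
      interpret D1: lin_map_pair "C i" "C (i - 1)" d1 by (rule L1)
      interpret D0': lin_map_pair "C (i + 1)" "C i" d0 by (rule L0')
      interpret D1': lin_map_pair "C (i + 1)" "C i" d1 by (rule L1')
      define n where "n = nat p"
      have xc: "x j \<in> carrier (C i)" for j using xP by (auto simp: carrierP)
      have xz: "x j = \<zero>\<^bsub>C i\<^esub>" if "j < n" for j using xF that by (simp add: u_adic_iff n_def)
      \<comment> \<open>Here \<open>r \<ge> 1\<close> enters: \<open>D x\<close> lies in step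
        \<open>p + r\<close>, so its coefficient of index \<open>p\<close> vanishes.\<close>
      have "D x n = \<zero>\<^bsub>C (i - 1)\<^esub>" using DxF r p by (auto simp: u_adic_iff n_def)
      moreover have "D x n = d0 (x n)"
      proof (cases n)
        case 0
        thus ?thesis by (simp add: D_0[OF xP])
      next
        case (Suc k)
        hence "x k = \<zero>\<^bsub>C i\<^esub>" using xz by simp
        thus ?thesis using Suc xc D0.closed by (simp add: D_Suc[OF xP] D1.zero)
      qed
      ultimately obtain v where v: "v \<in> carrier (C (i + 1))" "d0 v = x n" using exact[OF i xc, of n] by auto
      \<comment> \<open>\<open>w\<close> is \<open>v u^n\<close>, so the first nonzero coefficient
        that \<open>D w\<close> can have is \<open>d0 v = x n\<close>, at index
        \<open>n\<close>.\<close>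
      define w where "w = (\<lambda>j. if j = n then v else \<zero>\<^bsub>C (i + 1)\<^esub>)"
      have w: "w \<in> carrier (P (i + 1))" using v by (auto simp: carrierP w_def)
      have Dw: "D w j = \<zero>\<^bsub>C i\<^esub>" if "j < n" for j
      proof (cases j)
        case 0
        thus ?thesis using that unfolding 0 D_0[OF w] by (simp add: w_def D0'.zero)
      next
        case (Suc k)
        thus ?thesis using that unfolding Suc D_Suc[OF w] by (simp add: w_def D0'.zero D1'.zero)
      qed
      have Dwn: "D w n = x n"
      proof (cases n)
        case 0
        have "D w 0 = x 0" using v 0 unfolding D_0[OF w] by (simp add: w_def)
        thus ?thesis using 0 by simp
      next
        case (Suc k)
        have "D w (Suc k) = x (Suc k)"
          using v xc[of "Suc k"] Suc unfolding D_Suc[OF w] by (simp add: w_def D1'.zero)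
        thus ?thesis using Suc by simp
      qed
      let ?y = "x \<ominus>\<^bsub>P i\<^esub> D w"
      have DwP: "D w \<in> carrier (P i)" by (rule L'.closed[OF w])
      have yP: "?y \<in> carrier (P i)" using xP DwP by simp
      moreover have "?y j = \<zero>\<^bsub>C i\<^esub>" if "j < nat (p + 1)" for j
      proof -
        have "j < n \<or> j = n" using that p by (auto simp: n_def)
        hence "x j = D w j" using xz Dw Dwn by metis
        thus ?thesis using xc[of j] by (simp add: A.pser_diff[OF xP DwP] A.minus_eq A.r_neg)
      qed
      ultimately have "?y \<in> u_adic P (p + 1) i" by (simp add: u_adic_iff)
      moreover have "D ?y = D x"
        using L.diff[OF xP DwP] D_D'[OF w] L.closed[OF xP] by (simp add: BP.minus_eq)
      ultimately show ?thesis by blast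
    qed
    then obtain y where y: "y \<in> u_adic P (p + 1) i" "D y = D x" by blast
    \<comment> \<open>\<open>p + r - r + 1\<close> is the index that \<open>ss_B\<close> prescribes
      at position \<open>p + r\<close>; it equals \<open>p + 1\<close>.\<close>
    have "y \<in> ?Z (r - 1) (p + r - r + 1) (i - 1 + 1)"
      using y DxF by (auto simp: ss_Z_def)
    moreover have "\<zero>\<^bsub>P (i - 1)\<^esub> \<in> ?Z (r - 1) (p + r + 1) (i - 1)"
      by (rule additive_subgroup.zero_closed[OF ss_Z_additive_subgroup])
    moreover have "D x = \<zero>\<^bsub>P (i - 1)\<^esub> \<oplus>\<^bsub>P (i - 1)\<^esub> D y" using y(2) L.closed[OF xP] by simp
    ultimately show ?thesis unfolding ss_B_def set_add_def' by blast
  qed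
  have "?B r (p + r) (i - 1) +>\<^bsub>P (i - 1)\<^esub> D x = ?B r (p + r) (i - 1)" if "x \<in> K" for x
    by (rule BP.a_r_coset_absorb[OF ss_B_additive_subgroup main]) (use that KZ in auto)
  hence "ss_diff P D (u_adic P) r p i K = ?B r (p + r) (i - 1)"
    unfolding ss_diff_def using Kne by blast
  thus "ss_diff P D (u_adic P) r p i K = \<zero>\<^bsub>ss_page P D (u_adic P) r (p + r) (i - 1)\<^esub>"
    by (simp add: ss_page_def quot_module_def)
qed

lemma carrier_additive_subgroup: "abelian_group G \<Longrightarrow> additive_subgroup (carrier G) G"
  by (rule abelian_group.additive_subgroup_closedI)
     (auto simp: abelian_group.a_inv_closed abelian_monoid.a_closed[OF abelian_group.axioms(1)]
        abelian_monoid.zero_closed[OF abelian_group.axioms(1)])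

lemma bounds_smult_closed:
  assumes "b \<in> D ` carrier (P (i + 1))"
  shows "a \<odot>\<^bsub>P i\<^esub> b \<in> D ` carrier (P (i + 1))"
proof -
  interpret L: lin_map_pair "P (i + 1)" "P i" D by (rule LD')
  show ?thesis using assms smodule.smult_closed[OF smodP, of _ "i + 1"] by (auto simp flip: L.smult)
qed

lemma d0_bounds_subsp: "vspace.subsp (C i) (d0 ` carrier (C (i + 1)))"
proof -
  interpret A: vspace "C i" by (rule vs)
  interpret E: vspace "C (i + 1)" by (rule vs)
  interpret L: lin_map_pair "C (i + 1)" "C i" d0 by (rule L0')
  show ?thesis
    unfolding A.subsp_def
  proof (intro conjI ballI allI)
    show "\<zero>\<^bsub>C i\<^esub> \<in> d0 ` carrier (C (i + 1))" using L.zero E.zero_closed by (metis imageI)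
  qed (auto simp: L.closed simp flip: L.add L.smult)
qed

text \<open>Both sides are zero: by exactness for positive \<open>i\<close>, and because the modules
  vanish for negative \<open>i\<close>.\<close>

lemma homology_iso_trivial:
  assumes i: "i \<noteq> 0"
  shows "module_iso (homology P D i) (pser_module (homology C d0 i))"
proof -
  interpret A: vspace "C i" by (rule vs)
  interpret AP: smodule "P i" by (rule smodP)
  interpret D0: lin_map_pair "C (i + 1)" "C i" d0 by (rule L0')
  interpret L: lin_map_pair "P (i + 1)" "P i" D by (rule LD')
  let ?B = "D ` carrier (P (i + 1))" and ?Bz = "d0 ` carrier (C (i + 1))"
  have B: "additive_subgroup ?B (P i)"
    by (rule image_additive_subgroup[OF carrier_additive_subgroup[OF grpP]])
  have B0: "additive_subgroup ?Bz (C i)"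
    by (rule A.subsp_additive_subgroup[OF d0_bounds_subsp])
  have Z: "{x \<in> carrier (P i). D x = \<zero>\<^bsub>P (i - 1)\<^esub>} = ?B"
  proof (intro equalityI subsetI)
    fix x assume x: "x \<in> {x \<in> carrier (P i). D x = \<zero>\<^bsub>P (i - 1)\<^esub>}"
    show "x \<in> ?B"
    proof (cases "i \<ge> 1")
      case True
      thus ?thesis using exactP[OF True] x by blast
    next
      case False
      hence "x = \<zero>\<^bsub>P i\<^esub>" using x i neg[of i] by (auto simp: carrierP zeroP)
      thus ?thesis using additive_subgroup.zero_closed[OF B] by simp
    qed
  qed (auto simp: D_D' L.closed)
  have Z0: "{x \<in> carrier (C i). d0 x = \<zero>\<^bsub>C (i - 1)\<^esub>} = ?Bz"
  proof (intro equalityI subsetI)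
    fix x assume x: "x \<in> {x \<in> carrier (C i). d0 x = \<zero>\<^bsub>C (i - 1)\<^esub>}"
    show "x \<in> ?Bz"
    proof (cases "i \<ge> 1")
      case True
      thus ?thesis using exact[OF True] x by blast
    next
      case False
      hence "x = \<zero>\<^bsub>C i\<^esub>" using x i neg[of i] by auto
      thus ?thesis using additive_subgroup.zero_closed[OF B0] by simp
    qed
  next
    fix x assume "x \<in> ?Bz"
    then obtain y where y: "y \<in> carrier (C (i + 1))" "x = d0 y" by blast
    have "d0 (d0 y) = \<zero>\<^bsub>C (i - 1)\<^esub>" using d0d0[OF y(1)] by simp
    thus "x \<in> {x \<in> carrier (C i). d0 x = \<zero>\<^bsub>C (i - 1)\<^esub>}" using y D0.closed by simp
  qed
  let ?N = "homology C d0 i"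
  have N: "?N = quot_module ((C i)\<lparr>carrier := ?Bz\<rparr>) ?Bz" unfolding homology_def Z0 ..
  have B0s: "\<And>a b. b \<in> ?Bz \<Longrightarrow> a \<odot>\<^bsub>C i\<^esub> b \<in> ?Bz"
    using d0_bounds_subsp[of i] unfolding A.subsp_def by blast
  note n = A.quot_self[OF B0 B0s, folded N]
  have "smodule ?N"
    by (intro smodule.intro smodule_axioms.intro singleton_abelian_group n(1,2)) (auto simp: n)
  then interpret N: smodule ?N .
  interpret NP: smodule "pser_module ?N" by (rule N.pser_smodule)
  note m = AP.quot_self[OF B bounds_smult_closed]
  show ?thesis
  proof (rule module_iso_singletons)
    show "carrier (homology P D i) = {\<zero>\<^bsub>homology P D i\<^esub>}"
      "\<zero>\<^bsub>homology P D i\<^esub> \<oplus>\<^bsub>homology P D i\<^esub> \<zero>\<^bsub>homology P D i\<^esub> = \<zero>\<^bsub>homology P D i\<^esub>"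
      "\<And>a. a \<odot>\<^bsub>homology P D i\<^esub> \<zero>\<^bsub>homology P D i\<^esub> = \<zero>\<^bsub>homology P D i\<^esub>"
      unfolding homology_def Z using m by blast+
    show "carrier (pser_module ?N) = {\<zero>\<^bsub>pser_module ?N\<^esub>}"
      by (auto simp: N.pser_carrier N.pser_zero n(1))
  qed (auto simp: NP.smult_zero)
qed

text \<open>In degree 0 homology is a cokernel. Each class modulo \<open>B0\<close> has one
  representative in the complement of \<open>B0\<close>, and \<open>\<iota>\<close> sends a series
  of classes to the class of the series of these representatives. Injectivity is
  \<open>D_rigid\<close>; surjectivity normalizes a series coefficient by coefficient.\<close>

lemma homology_iso_zero: "module_iso (homology P D 0) (pser_module (homology C d0 0))"
proof -
  interpret A: vspace "C 0" by (rule vs)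
  interpret E: vspace "C 1" by (rule vs)
  interpret AP: smodule "P 0" by (rule smodP)
  interpret D0: lin_map_pair "C 1" "C 0" d0 using L0[of 1] by simp
  interpret D1: lin_map_pair "C 1" "C 0" d1 using L1[of 1] by simp
  interpret L: lin_map_pair "P 1" "P 0" D using LD[of 1] by simp
  define B where "B = D ` carrier (P 1)"
  define B0 where "B0 = d0 ` carrier (C 1)"
  have B: "additive_subgroup B (P 0)"
    using image_additive_subgroup[OF carrier_additive_subgroup[OF grpP], of 0] by (simp add: B_def)
  have sB0: "A.subsp B0" using d0_bounds_subsp[of 0] by (simp add: B0_def)
  have B0: "additive_subgroup B0 (C 0)"
    by (rule A.subsp_additive_subgroup[OF sB0])
  have Bs: "\<And>a b. b \<in> B \<Longrightarrow> a \<odot>\<^bsub>P 0\<^esub> b \<in> B" using bounds_smult_closed[of _ 0] by (simp add: B_def)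
  have B0s: "\<And>a b. b \<in> B0 \<Longrightarrow> a \<odot>\<^bsub>C 0\<^esub> b \<in> B0" using sB0 unfolding A.subsp_def by blast
  have "D x = \<zero>\<^bsub>P (-1)\<^esub>" if "x \<in> carrier (P 0)" for x
    using lin_map_pair.closed[OF LD that] neg[of "-1"] by (auto simp: carrierP zeroP)
  hence "{x \<in> carrier (P 0). D x = \<zero>\<^bsub>P (-1)\<^esub>} = carrier (P 0)" by auto
  hence HP: "homology P D 0 = quot_module (P 0) B" by (simp add: homology_def B_def)
  have "d0 x = \<zero>\<^bsub>C (-1)\<^esub>" if "x \<in> carrier (C 0)" for x
    using lin_map_pair.closed[OF L0 that] neg[of "-1"] by auto
  hence "{x \<in> carrier (C 0). d0 x = \<zero>\<^bsub>C (-1)\<^esub>} = carrier (C 0)" by auto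
  hence HC: "homology C d0 0 = quot_module (C 0) B0" by (simp add: homology_def B0_def)
  let ?Q = "quot_module (C 0) B0" and ?R = "quot_module (P 0) B"
  interpret Q: smodule ?Q by (rule A.quot_smodule[OF B0 B0s])
  interpret R: smodule ?R by (rule AP.quot_smodule[OF B Bs])
  obtain p where p: "lin_map (C 0) (C 0) p" "\<And>x. x \<in> carrier (C 0) \<Longrightarrow> x \<ominus>\<^bsub>C 0\<^esub> p x \<in> B0"
    "\<And>b. b \<in> B0 \<Longrightarrow> p b = \<zero>\<^bsub>C 0\<^esub>"
    using A.complement_projection[OF sB0] by metis
  interpret p: lin_map_pair "C 0" "C 0" p by (rule lin_map_pairI[OF grp grp p(1)])
  have B0c: "b \<in> B0 \<Longrightarrow> b \<in> carrier (C 0)" for b using additive_subgroup.a_subset[OF B0] by auto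
  have pp: "p (p x) = p x" if "x \<in> carrier (C 0)" for x
    using p(3)[OF p(2)[OF that]] that p.closed by (simp add: p.diff A.minus_eq_iff)
  \<comment> \<open>\<open>p\<close> kills \<open>B0\<close>, so it is constant on cosets and the
    chosen element does not matter.\<close>
  define s where "s K = p (SOME x. x \<in> K)" for K
  have s: "s (B0 +>\<^bsub>C 0\<^esub> x) = p x" if x: "x \<in> carrier (C 0)" for x
  proof -
    have "x \<in> B0 +>\<^bsub>C 0\<^esub> x"
      using additive_subgroup.zero_closed[OF B0] x by (auto simp: A.mem_a_r_coset intro!: bexI[of _ "\<zero>\<^bsub>C 0\<^esub>"])
    hence "(SOME y. y \<in> B0 +>\<^bsub>C 0\<^esub> x) \<in> B0 +>\<^bsub>C 0\<^esub> x" by (rule someI)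
    then obtain b where b: "b \<in> B0" "(SOME y. y \<in> B0 +>\<^bsub>C 0\<^esub> x) = b \<oplus>\<^bsub>C 0\<^esub> x"
      unfolding A.mem_a_r_coset by blast
    thus ?thesis using x B0c p.closed by (simp add: s_def p.add p(3))
  qed
  have s_lin: "lin_map ?Q (C 0) s"
    unfolding lin_map_def
    by (auto simp: A.quot_carrier s p.closed A.quot_add[OF B0] A.quot_smult[OF B0 B0s] p.add p.smult)
  interpret s: lin_map_pair ?Q "C 0" s by (rule lin_map_pairI[OF Q.abelian_group_axioms grp s_lin])
  have coset_s: "K = B0 +>\<^bsub>C 0\<^esub> s K" "p (s K) = s K" if K: "K \<in> carrier ?Q" for K
  proof -
    obtain x where x: "x \<in> carrier (C 0)" "K = B0 +>\<^bsub>C 0\<^esub> x" using K by (auto simp: A.quot_carrier)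
    show "p (s K) = s K" using x by (simp add: s pp)
    show "K = B0 +>\<^bsub>C 0\<^esub> s K"
      unfolding x(2) s[OF x(1)]
      using p(2)[OF x(1)] A.a_r_coset_eq_iff[OF B0 x(1) p.closed[OF x(1)]] by simp
  qed
  \<comment> \<open>The leading coefficient of a boundary lies in \<open>B0\<close>; if it is also
    in the complement, it is zero. Then the series can be divided by \<open>u\<close> and the
    argument repeated.\<close>
  have D_rigid: "D y j = \<zero>\<^bsub>C 0\<^esub>" if "y \<in> carrier (P 1)" "\<And>j. p (D y j) = D y j" for y j
    using that
  proof (induction j arbitrary: y)
    case (0 y)
    have "D y 0 = d0 (y 0)" by (rule D_0[OF 0(1)])
    hence "D y 0 \<in> B0" using 0(1) by (auto simp: B0_def carrierP)
    thus ?case using 0(2)[of 0] p(3) by simp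
  next
    case (Suc j y)
    have yc: "y k \<in> carrier (C 1)" for k using Suc.prems(1) by (auto simp: carrierP)
    have "D y 0 = d0 (y 0)" by (rule D_0[OF Suc.prems(1)])
    hence "D y 0 \<in> B0" using yc by (auto simp: B0_def)
    hence "D y 0 = \<zero>\<^bsub>C 0\<^esub>" using Suc.prems(2)[of 0] p(3) by simp
    then obtain w where w: "w \<in> carrier (C 2)" "d0 w = y 0"
      using exact[of 1 "y 0"] yc D_0[OF Suc.prems(1)] by auto
    interpret D0': lin_map_pair "C 2" "C 1" d0 using L0[of 2] by simp
    interpret D1': lin_map_pair "C 2" "C 1" d1 using L1[of 2] by simp
    \<comment> \<open>\<open>y'\<close> is \<open>(y - D w) / u\<close>: the constant coefficient
      cancels because \<open>d0 w = y 0\<close>, and \<open>D y'\<close> is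
      \<open>D y / u\<close>.\<close>
    define y' where "y' = (\<lambda>k. case k of 0 \<Rightarrow> y 1 \<ominus>\<^bsub>C 1\<^esub> d1 w | Suc l \<Rightarrow> y (Suc (Suc l)))"
    have y': "y' \<in> carrier (P 1)" using yc D1'.closed[OF w(1)] by (auto simp: carrierP y'_def split: nat.split)
    have anti: "d0 (d1 w) = \<ominus>\<^bsub>C 0\<^esub> d1 (y 0)"
      using d0d1[OF w(1)] w D1'.closed D0.closed D1.closed yc A.add_eq_iff_minus[of "d1 (y 0)" "d0 (d1 w)"]
      by (simp add: A.a_comm)
    have eq: "D y' k = D y (Suc k)" for k
    proof (cases k)
      case 0
      show ?thesis unfolding 0 D_0[OF y'] D_Suc[OF Suc.prems(1)]
        using yc D1'.closed[OF w(1)] D0.closed D1.closed anti by (simp add: y'_def D0.diff A.minus_eq)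
    next
      case (Suc l)
      show ?thesis
      proof (cases l)
        case 0
        have "d1 (y 1 \<ominus>\<^bsub>C 1\<^esub> d1 w) = d1 (y 1)"
          using yc D1'.closed[OF w(1)] D1.closed d1d1[OF w(1)] by (simp add: D1.diff A.minus_eq)
        thus ?thesis unfolding Suc 0 D_Suc[OF y'] D_Suc[OF Suc.prems(1)] by (simp add: y'_def)
      next
        case (Suc m)
        show ?thesis unfolding \<open>k = Suc l\<close> Suc D_Suc[OF y'] D_Suc[OF Suc.prems(1)] by (simp add: y'_def)
      qed
    qed
    show ?case using Suc.IH[OF y'] Suc.prems(2) unfolding eq by blast
  qed
  define \<iota> where "\<iota> K = B +>\<^bsub>P 0\<^esub> (\<lambda>j. s (K j))" for K
  have sK: "(\<lambda>j. s (K j)) \<in> carrier (P 0)" if "K \<in> carrier (pser_module ?Q)" for K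
    using that s.closed by (auto simp: carrierP Q.pser_carrier)
  have lin: "lin_map (pser_module ?Q) ?R \<iota>"
    unfolding lin_map_def
  proof (intro conjI ballI allI)
    show "\<iota> K \<in> carrier ?R" if "K \<in> carrier (pser_module ?Q)" for K
      using sK[OF that] by (auto simp: \<iota>_def AP.quot_carrier)
  next
    fix K K' assume K: "K \<in> carrier (pser_module ?Q)" and K': "K' \<in> carrier (pser_module ?Q)"
    have "(\<lambda>j. s ((K \<oplus>\<^bsub>pser_module ?Q\<^esub> K') j)) = (\<lambda>j. s (K j)) \<oplus>\<^bsub>P 0\<^esub> (\<lambda>j. s (K' j))"
      using K K' by (auto simp: Q.pser_add addP Q.pser_carrier s.add)
    thus "\<iota> (K \<oplus>\<^bsub>pser_module ?Q\<^esub> K') = \<iota> K \<oplus>\<^bsub>?R\<^esub> \<iota> K'"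
      unfolding \<iota>_def AP.quot_add[OF B sK[OF K] sK[OF K']] by simp
  next
    fix a K assume K: "K \<in> carrier (pser_module ?Q)"
    have Kc: "K j \<in> carrier ?Q" for j using K by (auto simp: Q.pser_carrier)
    have "(\<lambda>j. s ((a \<odot>\<^bsub>pser_module ?Q\<^esub> K) j)) = a \<odot>\<^bsub>P 0\<^esub> (\<lambda>j. s (K j))"
      by (simp add: Q.pser_smult smultP s.finsum s.smult Kc Pi_def)
    show "\<iota> (a \<odot>\<^bsub>pser_module ?Q\<^esub> K) = a \<odot>\<^bsub>?R\<^esub> \<iota> K"
    proof -
      have "a \<odot>\<^bsub>?R\<^esub> (B +>\<^bsub>P 0\<^esub> (\<lambda>j. s (K j))) = B +>\<^bsub>P 0\<^esub> (a \<odot>\<^bsub>P 0\<^esub> (\<lambda>j. s (K j)))"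
        by (rule AP.quot_smult[OF B Bs sK[OF K]])
      thus ?thesis using \<open>(\<lambda>j. s ((a \<odot>\<^bsub>pser_module ?Q\<^esub> K) j)) = a \<odot>\<^bsub>P 0\<^esub> (\<lambda>j. s (K j))\<close>
        by (simp only: \<iota>_def)
    qed
  qed
  have "inj_on \<iota> (carrier (pser_module ?Q))"
  proof (rule inj_onI, rule ext)
    fix K K' j assume K: "K \<in> carrier (pser_module ?Q)" and K': "K' \<in> carrier (pser_module ?Q)" and eq: "\<iota> K = \<iota> K'"
    have Kc: "K j \<in> carrier ?Q" "K' j \<in> carrier ?Q" for j using K K' by (auto simp: Q.pser_carrier)
    have "(\<lambda>j. s (K j)) \<ominus>\<^bsub>P 0\<^esub> (\<lambda>j. s (K' j)) \<in> B"
      using eq AP.a_r_coset_eq_iff[OF B sK[OF K] sK[OF K']] by (simp add: \<iota>_def)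
    then obtain y where y: "y \<in> carrier (P 1)" "D y = (\<lambda>j. s (K j)) \<ominus>\<^bsub>P 0\<^esub> (\<lambda>j. s (K' j))"
      by (auto simp: B_def)
    have Dy: "D y j = s (K j) \<ominus>\<^bsub>C 0\<^esub> s (K' j)" for j by (simp add: y(2) diffP[OF sK[OF K] sK[OF K']])
    have "p (D y j) = D y j" for j
      using Kc s.closed by (simp add: Dy p.diff coset_s(2))
    from D_rigid[OF y(1) this, of j] have "s (K j) = s (K' j)"
      using Kc s.closed by (simp add: Dy A.minus_eq_iff)
    thus "K j = K' j" using coset_s(1)[OF Kc(1)] coset_s(1)[OF Kc(2)] by metis
  qed
  moreover have "\<exists>K\<in>carrier (pser_module ?Q). \<iota> K = B +>\<^bsub>P 0\<^esub> x" if x: "x \<in> carrier (P 0)" for x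
  proof -
    have xc: "x j \<in> carrier (C 0)" for j using x by (auto simp: carrierP)
    define g where "g z = (SOME y. y \<in> carrier (C 1) \<and> d0 y = z \<ominus>\<^bsub>C 0\<^esub> p z)" for z
    have g: "g z \<in> carrier (C 1) \<and> d0 (g z) = z \<ominus>\<^bsub>C 0\<^esub> p z" if "z \<in> carrier (C 0)" for z
    proof -
      have "\<exists>y. y \<in> carrier (C 1) \<and> d0 y = z \<ominus>\<^bsub>C 0\<^esub> p z" using p(2)[OF that] by (auto simp: B0_def)
      from someI_ex[OF this] show ?thesis unfolding g_def .
    qed
    \<comment> \<open>Each coefficient of \<open>x - D y\<close> is to be a value of
      \<open>p\<close>: \<open>d0 (y (Suc k))\<close> removes the \<open>B0\<close>-part of the
      difference of \<open>x (Suc k)\<close> and \<open>d1 (y k)\<close>.\<close>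
    define y where "y = rec_nat (g (x 0)) (\<lambda>k yk. g (x (Suc k) \<ominus>\<^bsub>C 0\<^esub> d1 yk))"
    have y0: "y 0 = g (x 0)" and yS: "y (Suc k) = g (x (Suc k) \<ominus>\<^bsub>C 0\<^esub> d1 (y k))" for k
      by (simp_all add: y_def)
    have yc: "y k \<in> carrier (C 1)" for k
      by (induction k) (use g xc D1.closed in \<open>auto simp: y0 yS\<close>)
    hence y: "y \<in> carrier (P 1)" by (auto simp: carrierP)
    have Dyc: "D y \<in> carrier (P 0)" by (rule L.closed[OF y])
    have "\<exists>z\<in>carrier (C 0). x j \<ominus>\<^bsub>C 0\<^esub> D y j = p z" for j
    proof (cases j)
      case 0
      have "x 0 \<ominus>\<^bsub>C 0\<^esub> D y 0 = p (x 0)"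
        using g[OF xc] xc p.closed by (simp add: D_0[OF y] y0 A.double_diff)
      thus ?thesis using 0 xc by blast
    next
      case (Suc k)
      let ?z = "x (Suc k) \<ominus>\<^bsub>C 0\<^esub> d1 (y k)"
      have z: "?z \<in> carrier (C 0)" using xc yc D1.closed by simp
      have pz: "p ?z \<in> carrier (C 0)" and d1y: "d1 (y k) \<in> carrier (C 0)" using z p.closed yc D1.closed by auto
      have "D y (Suc k) = (?z \<ominus>\<^bsub>C 0\<^esub> p ?z) \<oplus>\<^bsub>C 0\<^esub> d1 (y k)"
        using g[OF z] by (simp add: D_Suc[OF y, simplified] yS)
      also have "\<dots> = (?z \<oplus>\<^bsub>C 0\<^esub> d1 (y k)) \<ominus>\<^bsub>C 0\<^esub> p ?z"
        using z pz d1y by (simp only: A.minus_eq[of ?z "p ?z"] A.minus_eq[of "_ \<oplus>\<^bsub>C 0\<^esub> _"]) (simp add: A.a_ac)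
      also have "?z \<oplus>\<^bsub>C 0\<^esub> d1 (y k) = x (Suc k)" by (rule A.minus_add_cancel[OF xc d1y])
      finally have "x (Suc k) \<ominus>\<^bsub>C 0\<^esub> D y (Suc k) = p ?z"
        using xc pz by (simp add: A.double_diff)
      thus ?thesis using Suc z by blast
    qed
    then obtain z where z: "\<And>j. z j \<in> carrier (C 0)" "\<And>j. x j \<ominus>\<^bsub>C 0\<^esub> D y j = p (z j)" by metis
    define K where "K = (\<lambda>j. B0 +>\<^bsub>C 0\<^esub> z j)"
    have K: "K \<in> carrier (pser_module ?Q)" using z by (auto simp: Q.pser_carrier A.quot_carrier K_def)
    have "\<iota> K = B +>\<^bsub>P 0\<^esub> (x \<ominus>\<^bsub>P 0\<^esub> D y)"
      using z by (simp add: \<iota>_def K_def s diffP[OF x Dyc])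
    also have "\<dots> = B +>\<^bsub>P 0\<^esub> x"
    proof -
      have "x \<ominus>\<^bsub>P 0\<^esub> (x \<ominus>\<^bsub>P 0\<^esub> D y) \<in> B" using x Dyc y by (simp add: AP.double_diff B_def)
      thus ?thesis using AP.a_r_coset_eq_iff[OF B x, of "x \<ominus>\<^bsub>P 0\<^esub> D y"] x Dyc by simp
    qed
    finally show ?thesis using K by blast
  qed
  hence "carrier ?R \<subseteq> \<iota> ` carrier (pser_module ?Q)" by (force simp: AP.quot_carrier)
  ultimately have "bij_betw \<iota> (carrier (pser_module ?Q)) (carrier ?R)"
    using lin unfolding bij_betw_def lin_map_def by auto
  thus ?thesis unfolding HP HC
    by (rule module_iso_sym[OF Q.pser_smodule R.smodule_axioms _ lin])
qed

lemma homology_iso: "module_iso (homology P D i) (pser_module (homology C d0 i))"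
  using homology_iso_trivial homology_iso_zero by (cases "i = 0") auto

end


section \<open>Koszul complexes of entire functions\<close>

text \<open>Exterior algebra over \<open>\<complex>\<close>, elements being families of coefficients indexed by sets:
  contraction with a basis covector, exterior multiplication by a basis vector, contraction with \<open>l\<close>.\<close>

definition sg :: "'n::{finite,linorder} \<Rightarrow> 'n set \<Rightarrow> complex" where
  "sg k I = (-1) ^ card {l\<in>I. l < k}"

definition ctr :: "'n::{finite,linorder} \<Rightarrow> ('n set \<Rightarrow> complex) \<Rightarrow> 'n set \<Rightarrow> complex" where
  "ctr k G I = (if k \<in> I then 0 else sg k I * G (insert k I))"

definition wedge :: "'n::{finite,linorder} \<Rightarrow> ('n set \<Rightarrow> complex) \<Rightarrow> 'n set \<Rightarrow> complex" where
  "wedge k G I = (if k \<in> I then sg k I * G (I - {k}) else 0)"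

definition contr :: "('n::{finite,linorder} \<Rightarrow> complex) \<Rightarrow> ('n set \<Rightarrow> complex) \<Rightarrow> 'n set \<Rightarrow> complex" where
  "contr l G I = (\<Sum>k\<in>UNIV. l k * ctr k G I)"

abbreviation koszul ::
  "('n::{finite,linorder} \<Rightarrow> 'z \<Rightarrow> complex) \<Rightarrow> ('n set \<Rightarrow> 'z \<Rightarrow> complex) \<Rightarrow> 'n set \<Rightarrow> 'z \<Rightarrow> complex" where
  "koszul lam g I z \<equiv> contr (\<lambda>k. lam k z) (\<lambda>J. g J z) I"

section \<open>Identities in the exterior algebra\<close>

lemma sg_square: "sg k I * sg k I = 1"
  by (simp add: sg_def flip: power_add)

lemma sg_insert: "k \<notin> I \<Longrightarrow> sg l (insert k I) = (if k < l then - sg l I else sg l I)"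
proof -
  assume "k \<notin> I"
  moreover have "{j \<in> insert k I. j < l} = (if k < l then insert k {j\<in>I. j < l} else {j\<in>I. j < l})" by auto
  ultimately show ?thesis by (simp add: sg_def)
qed

lemma sg_self: "sg k (insert k I) = sg k I" "sg k (I - {k}) = sg k I"
proof -
  have "{j \<in> insert k I. j < k} = {j \<in> I. j < k}" "{j \<in> I - {k}. j < k} = {j \<in> I. j < k}" by auto
  thus "sg k (insert k I) = sg k I" "sg k (I - {k}) = sg k I" by (simp_all add: sg_def)
qed

lemma ctr_anticommute: "ctr k (ctr l G) I = - ctr l (ctr k G) I"
proof (cases "k = l \<or> k \<in> I \<or> l \<in> I")
  case False
  hence *: "k \<noteq> l" "k \<notin> I" "l \<notin> I" by auto
  thus ?thesis by (auto simp: ctr_def sg_insert insert_commute)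
qed (auto simp: ctr_def)

text \<open>With \<open>ctr_wedge_same\<close> this is the canonical anticommutation relation. The
  sign comes from \<open>sg_insert\<close>: of \<open>k\<close> and \<open>m\<close> exactly one
  precedes the other.\<close>

lemma ctr_wedge:
  assumes "k \<noteq> m"
  shows "ctr k (wedge m G) I = - wedge m (ctr k G) I"
proof (cases "k \<notin> I \<and> m \<in> I")
  case True
  define J where "J = I - {m}"
  have J: "I = insert m J" "m \<notin> J" "k \<notin> J" using True by (auto simp: J_def)
  have "insert k I - {m} = insert k (I - {m})" using assms by auto
  thus ?thesis
    using True assms J sg_insert[of k J m] sg_insert[of m J k] sg_self(1)[of m J] sg_self(1)[of m "insert k J"]
    by (auto simp: ctr_def wedge_def insert_commute[of k m] split: if_splits)
qed (use assms in \<open>auto simp: ctr_def wedge_def\<close>)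

lemma ctr_wedge_same: "ctr m (wedge m G) I = G I - wedge m (ctr m G) I"
proof (cases "m \<in> I")
  case True
  thus ?thesis using sg_square[of m I] by (simp add: ctr_def wedge_def sg_self insert_absorb flip: mult.assoc)
next
  case False
  thus ?thesis using sg_square[of m I] by (simp add: ctr_def wedge_def sg_self flip: mult.assoc)
qed

lemma wedge_sum: "wedge m (\<lambda>J. \<Sum>k\<in>K. f k J) I = (\<Sum>k\<in>K. wedge m (f k) I)"
  by (simp add: wedge_def sum_distrib_left)

lemma wedge_scale: "wedge m (\<lambda>J. a * G J) I = a * wedge m G I"
  by (simp add: wedge_def)

lemma ctr_sum: "ctr m (\<lambda>J. \<Sum>k\<in>K. f k J) I = (\<Sum>k\<in>K. ctr m (f k) I)"
  by (simp add: ctr_def sum_distrib_left)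

lemma ctr_scale: "ctr m (\<lambda>J. a * G J) I = a * ctr m G I"
  by (simp add: ctr_def)

lemma ctr_add: "ctr m (\<lambda>J. F J + G J) I = ctr m F I + ctr m G I"
  by (simp add: ctr_def distrib_left)

lemma ctr_diff: "ctr m (\<lambda>J. F J - G J) I = ctr m F I - ctr m G I"
  by (simp add: ctr_def right_diff_distrib)

lemma contr_add: "contr l (\<lambda>J. F J + G J) I = contr l F I + contr l G I"
  by (simp add: contr_def ctr_add distrib_left sum.distrib)

lemma contr_diff: "contr l (\<lambda>J. F J - G J) I = contr l F I - contr l G I"
  by (simp add: contr_def ctr_diff right_diff_distrib sum_subtractf)

lemma contr_scale: "contr l (\<lambda>J. a * G J) I = a * contr l G I"
  by (simp add: contr_def ctr_scale sum_distrib_left mult.left_commute)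

text \<open>The anticommutation relations summed with weights: \<open>wedge m\<close> is a homotopy
  between multiplication by \<open>l m\<close> and zero. Division by \<open>l m\<close> will turn it
  into a homotopy for the identity.\<close>

lemma contr_wedge: "contr l (wedge m G) I = l m * G I - wedge m (contr l G) I"
proof -
  have "contr l (wedge m G) I = l m * ctr m (wedge m G) I + (\<Sum>k\<in>UNIV-{m}. l k * ctr k (wedge m G) I)"
    by (simp add: contr_def sum.remove)
  also have "\<dots> = l m * G I - (l m * wedge m (ctr m G) I + (\<Sum>k\<in>UNIV-{m}. l k * wedge m (ctr k G) I))"
    by (simp add: ctr_wedge_same ctr_wedge right_diff_distrib sum_negf)
  also have "l m * wedge m (ctr m G) I + (\<Sum>k\<in>UNIV-{m}. l k * wedge m (ctr k G) I) = (\<Sum>k\<in>UNIV. l k * wedge m (ctr k G) I)"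
    by (simp add: sum.remove)
  also have "\<dots> = wedge m (contr l G) I"
    by (simp add: contr_def[abs_def] wedge_sum wedge_scale)
  finally show ?thesis .
qed

lemma antisymmetric_double_sum:
  assumes "\<And>k l. f k l = - f l (k::'k::finite) "
  shows "(\<Sum>k\<in>UNIV. \<Sum>l\<in>UNIV. f k l :: complex) = 0"
proof -
  have "(\<Sum>k\<in>UNIV. \<Sum>l\<in>UNIV. f k l) = (\<Sum>k\<in>UNIV. \<Sum>l\<in>UNIV. - f l k)"
    by (intro sum.cong refl assms)
  also have "\<dots> = - (\<Sum>k\<in>UNIV. \<Sum>l\<in>UNIV. f k l)"
    by (subst sum.swap) (simp add: sum_negf)
  finally show ?thesis by simp
qed

lemma contr_contr: "contr l (contr l G) I = 0"
proof -
  have "contr l (contr l G) I = (\<Sum>k\<in>UNIV. \<Sum>m\<in>UNIV. l k * l m * ctr k (ctr m G) I)"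
    by (simp add: contr_def[of l "contr l G"]) (simp add: contr_def[abs_def] ctr_sum ctr_scale sum_distrib_left mult.assoc)
  also have "\<dots> = 0"
  proof (rule antisymmetric_double_sum)
    show "l k * l m * ctr k (ctr m G) I = - (l m * l k * ctr m (ctr k G) I)" for k m
      using ctr_anticommute[of k m G I] by simp
  qed
  finally show ?thesis .
qed

section \<open>The Koszul complex of linear coordinates\<close>

text \<open>Serves to cancel a factor from an identity: on a line through \<open>z\<close> the
  factor has finitely many zeros, the set \<open>T\<close>, and continuity fills the gaps.\<close>

lemma zero_by_lines:
  fixes f :: "complex ^ 'd \<Rightarrow> complex"
  assumes "continuous_on U f" "open U" "z \<in> U" "finite T"
    and zero: "\<And>t. t \<notin> T \<Longrightarrow> z + t *s b \<in> U \<Longrightarrow> f (z + t *s b) = 0"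
  shows "f z = 0"
proof -
  let ?l = "\<lambda>t. z + t *s b"
  have l: "continuous_on UNIV ?l" by (intro continuous_intros)
  have V: "open (?l -` U)" by (rule open_vimage[OF assms(2) l])
  have "continuous_on (?l -` U) (\<lambda>t. f (?l t))"
    by (rule continuous_on_compose2[OF assms(1) continuous_on_subset[OF l]]) auto
  moreover have 0: "0 \<in> ?l -` U" using assms(3) by simp
  ultimately have "isCont (\<lambda>t. f (?l t)) 0" using V by (simp add: continuous_on_eq_continuous_at)
  hence "((\<lambda>t. f (?l t)) \<longlongrightarrow> f (?l 0)) (at 0)" by (simp add: isCont_def)
  moreover have "eventually (\<lambda>t. f (?l t) = 0) (at 0)"
  proof -
    have "eventually (\<lambda>t. t \<notin> T) (at 0)"
      using islimpt_finite[OF assms(4)] islimpt_iff_eventually by blast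
    moreover have "eventually (\<lambda>t. t \<in> ?l -` U) (at 0)"
      by (rule eventually_at_in_open'[OF V 0])
    ultimately show ?thesis by eventually_elim (rule zero, auto)
  qed
  hence "((\<lambda>t. f (?l t)) \<longlongrightarrow> 0) (at 0)" by (rule tendsto_eventually)
  ultimately have "f (?l 0) = 0" by (rule tendsto_unique[OF trivial_limit_at])
  thus ?thesis by simp
qed

definition entire_forms :: "int \<Rightarrow> ('n::{finite,linorder} set \<Rightarrow> complex ^ 'd \<Rightarrow> complex) set" where
  "entire_forms i = {g. (\<forall>I. holo_on (g I) UNIV) \<and> (\<forall>I. int (card I) \<noteq> i \<longrightarrow> g I = (\<lambda>_. 0))}"

lemma clinear_form_holo:
  assumes "clinear_form lam"
  shows "holo_on lam U"
proof -
  obtain a where "\<And>z. lam z = (\<Sum>i\<in>UNIV. a i * z $ i)" using assms unfolding clinear_form_def by blast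
  hence "lam = (\<lambda>z. \<Sum>i\<in>UNIV. a i * z $ i)" by auto
  thus ?thesis by (auto intro!: holo_on_sum holo_on_mult holo_on_const holo_on_nth)
qed

lemma holo_on_contr:
  assumes "\<And>k. holo_on (lam k) U" "\<And>I. holo_on (g I) U"
  shows "holo_on (\<lambda>z. koszul lam g I z) U"
  unfolding contr_def
proof (rule holo_on_sum, rule holo_on_mult[OF assms(1)])
  show "holo_on (\<lambda>z. ctr k (\<lambda>J. g J z) I) U" for k
    using assms(2) by (cases "k \<in> I") (auto simp: ctr_def intro: holo_on_const holo_on_mult)
qed

lemma contr_graded:
  assumes "\<And>J. int (card J) \<noteq> i \<Longrightarrow> G J = 0" "int (card I) \<noteq> i - 1"
  shows "contr l G I = 0"
proof -
  have "ctr k G I = 0" for k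
  proof (cases "k \<in> I")
    case False
    hence "int (card (insert k I)) \<noteq> i" using assms(2) by simp
    thus ?thesis using assms(1)[of "insert k I"] by (simp add: ctr_def)
  qed (simp add: ctr_def)
  thus ?thesis by (simp add: contr_def)
qed

lemma contr_entire_forms:
  assumes "\<And>k. holo_on (lam k) UNIV" "g \<in> entire_forms i"
  shows "(\<lambda>I z. koszul lam g I z) \<in> entire_forms (i - 1)"
proof -
  have g: "holo_on (g I) UNIV" "int (card I) \<noteq> i \<Longrightarrow> g I = (\<lambda>_. 0)" for I
    using assms(2) unfolding entire_forms_def by auto
  have "koszul lam g I z = 0" if "int (card I) \<noteq> i - 1" for I z
    by (rule contr_graded[OF _ that]) (simp add: g(2))
  thus ?thesis using holo_on_contr[OF assms(1) g(1)] unfolding entire_forms_def by auto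
qed

lemma add_entire_forms: "g \<in> entire_forms i \<Longrightarrow> h \<in> entire_forms i \<Longrightarrow> (\<lambda>I z. g I z + h I z) \<in> entire_forms i"
  unfolding entire_forms_def by (auto intro: holo_on_add)

lemma diff_entire_forms: "g \<in> entire_forms i \<Longrightarrow> h \<in> entire_forms i \<Longrightarrow> (\<lambda>I z. g I z - h I z) \<in> entire_forms i"
  unfolding entire_forms_def by (auto intro: holo_on_diff)

lemma zero_entire_forms: "(\<lambda>I z. 0) \<in> entire_forms i"
  unfolding entire_forms_def by (auto intro: holo_on_const)

lemma has_derivative_clinear_shift:
  assumes "clinear_form lam"
  shows "((\<lambda>z. z - lam z *s b) has_derivative (\<lambda>z. z - lam z *s b)) (at z)"
proof -
  have "bounded_linear (\<lambda>z. lam z *s b)"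
    by (rule bounded_linear_compose[OF bounded_linear_vector_smult_left clinear_form_props(4)[OF assms]])
  thus ?thesis by (intro has_derivative_diff has_derivative_ident bounded_linear_imp_has_derivative)
qed

text \<open>The homotopy is division by \<open>lam m\<close> in the direction \<open>b m\<close>, followed by \<open>wedge m\<close>.\<close>

lemma koszul_homotopy:
  fixes lam :: "'n::{finite,linorder} \<Rightarrow> complex ^ 'd \<Rightarrow> complex"
  assumes lam: "\<And>k. clinear_form (lam k)" and b: "\<And>k l. lam k (b l) = (if k = l then 1 else 0)"
    and g: "g \<in> entire_forms i" and cycle: "\<And>I z. koszul lam g I z = 0"
  shows "\<exists>h\<in>entire_forms (i + 1). \<forall>I z. koszul lam h I z =
    g I z - (if m \<in> I then 0 else g I (z - lam m z *s b m))"
proof -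
  let ?\<pi> = "\<lambda>z. z - lam m z *s b m"
  note lin = clinear_form_props[OF lam]
  have gh: "holo_on (g I) UNIV" and gz: "int (card I) \<noteq> i \<Longrightarrow> g I = (\<lambda>_. 0)" for I
    using g unfolding entire_forms_def by auto
  have gp: "holo_on (\<lambda>z. g I (?\<pi> z)) UNIV" for I
    by (rule holo_on_compose[OF gh _ has_derivative_clinear_shift[OF lam]])
       (auto simp: lin vec_eq_iff algebra_simps)
  define q where "q = (\<lambda>J. divq (lam m) (b m) (g J))"
  have qh: "holo_on (q J) UNIV" for J
    unfolding q_def by (rule holo_on_divq[OF gh]) (auto simp: lam)
  have qm: "lam m z * q J z = g J z - g J (?\<pi> z)" for J z
    unfolding q_def by (rule divq_mult[OF gh]) (auto simp: lam b)
  define h where "h = (\<lambda>I z. wedge m (\<lambda>J. q J z) I)"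
  have hh: "h \<in> entire_forms (i + 1)"
    unfolding entire_forms_def
  proof (intro CollectI conjI allI impI)
    show "holo_on (h I) UNIV" for I
    proof -
      have "h I = (if m \<in> I then (\<lambda>z. sg m I * q (I - {m}) z) else (\<lambda>_. 0))"
        by (simp add: h_def wedge_def)
      thus ?thesis using holo_on_mult[OF holo_on_const qh] by (simp add: holo_on_const)
    qed
    fix I :: "'n set" assume I: "int (card I) \<noteq> i + 1"
    show "h I = (\<lambda>_. 0)"
    proof (cases "m \<in> I")
      case True
      have "card I = Suc (card (I - {m}))" by (rule card.remove[OF finite True])
      hence "int (card (I - {m})) \<noteq> i" using I by simp
      hence "g (I - {m}) = (\<lambda>_. 0)" by (rule gz)
      hence "q (I - {m}) = (\<lambda>_. 0)" by (simp add: q_def divq_def[abs_def] dd_const)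
      thus ?thesis by (auto simp: h_def wedge_def)
    qed (auto simp: h_def wedge_def)
  qed
  define f where "f = (\<lambda>I z. koszul lam h I z - (g I z - (if m \<in> I then 0 else g I (?\<pi> z))))"
  have "f I z = 0" for I z
  \<comment> \<open>Along \<open>b m\<close> the form \<open>lam m\<close> has slope 1, so it
    vanishes for one parameter only; elsewhere the identity may be multiplied by
    \<open>lam m\<close>.\<close>
  proof (rule zero_by_lines[OF _ open_UNIV UNIV_I])
    show "continuous_on UNIV (f I)"
    proof (rule holo_on_continuous_on)
      have "holo_on (\<lambda>z. koszul lam h I z) UNIV"
        using hh by (intro holo_on_contr clinear_form_holo[OF lam]) (simp add: entire_forms_def)
      moreover have "holo_on (\<lambda>z. if m \<in> I then 0 else g I (?\<pi> z)) UNIV"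
        using gp by (cases "m \<in> I") (simp_all add: holo_on_const)
      ultimately show "holo_on (f I) UNIV"
        unfolding f_def by (intro holo_on_diff gh)
    qed
    fix t assume "t \<notin> {- lam m z}"
    hence nz: "lam m (z + t *s b m) \<noteq> 0" by (simp add: lin b add_eq_0_iff)
    define x where "x = z + t *s b m"
    let ?l = "\<lambda>k. lam k x"
    define G where "G = (\<lambda>J. g J x)" define G' where "G' = (\<lambda>J. g J (?\<pi> x))"
    \<comment> \<open>At the projected point the form \<open>lam m\<close> is zero and the others
      are unchanged, so the cycle condition there removes all contractions of \<open>G'\<close> but
      the one with \<open>m\<close>.\<close>
    have "lam k (?\<pi> x) = (if k = m then 0 else lam k x)" for k by (simp add: lin b)
    hence "contr (\<lambda>k. if k = m then 0 else ?l k) G' J = 0" for J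
      using cycle[of "?\<pi> x" J] by (simp add: G'_def)
    hence c': "contr ?l G' J = ?l m * ctr m G' J" for J
    proof -
      have "(\<Sum>k\<in>UNIV - {m}. ?l k * ctr k G' J) = 0"
        using \<open>\<And>J. contr (\<lambda>k. if k = m then 0 else ?l k) G' J = 0\<close>[of J]
        by (simp add: contr_def sum.remove[of _ m])
      thus ?thesis by (simp add: contr_def sum.remove[of _ m])
    qed
    have cG: "contr ?l G J = 0" for J unfolding G_def by (rule cycle)
    \<comment> \<open>Multiplying by \<open>lam m\<close> replaces the quotient \<open>q\<close> by
      the difference of \<open>G\<close> and \<open>G'\<close>.\<close>
    have "?l m * contr ?l (\<lambda>J. h J x) I = contr ?l (wedge m (\<lambda>J. G J - G' J)) I"
    proof -
      have "(\<lambda>J. ?l m * h J x) = wedge m (\<lambda>J. G J - G' J)"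
        by (rule ext) (simp add: h_def G_def G'_def flip: qm wedge_scale)
      thus ?thesis by (simp flip: contr_scale)
    qed
    also have "\<dots> = ?l m * (G I - G' I) - wedge m (\<lambda>J. ?l m * (- ctr m G' J)) I"
      by (simp add: contr_wedge) (simp add: contr_diff[abs_def] cG c')
    also have "\<dots> = ?l m * (G I - G' I + wedge m (ctr m G') I)"
      by (simp only: wedge_scale) (simp add: wedge_def algebra_simps)
    \<comment> \<open>On sets containing \<open>m\<close> this term cancels \<open>- G' I\<close>;
      on the others it vanishes.\<close>
    also have "wedge m (ctr m G') I = (if m \<in> I then G' I else 0)"
      using sg_square[of m I] by (auto simp: wedge_def ctr_def sg_self insert_absorb simp flip: mult.assoc)
    finally have "contr ?l (\<lambda>J. h J x) I = G I - G' I + (if m \<in> I then G' I else 0)"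
      using nz by (simp add: x_def)
    thus "f I (z + t *s b m) = 0" by (simp add: f_def G_def G'_def flip: x_def)
  qed simp
  thus ?thesis using hh by (intro bexI[of _ h]) (auto simp: f_def)
qed

text \<open>The homotopy is applied for one index \<open>m\<close> at a time and settles the
  components with \<open>m \<in> I\<close>. Components settled before stay correct: the error term
  at \<open>I\<close> is a value of the same component of the remaining cycle, which is
  zero.\<close>

lemma koszul_acyclic:
  fixes lam :: "'n::{finite,linorder} \<Rightarrow> complex ^ 'd \<Rightarrow> complex"
  assumes lam: "\<And>k. clinear_form (lam k)" and b: "\<And>k l. lam k (b l) = (if k = l then 1 else 0)"
    and g: "g \<in> entire_forms i" and i: "i \<ge> 1" and cycle: "\<And>I z. koszul lam g I z = 0"
  shows "\<exists>h\<in>entire_forms (i + 1). \<forall>I z. koszul lam h I z = g I z"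
proof -
  have "\<exists>h\<in>entire_forms (i + 1). \<forall>I z. I \<inter> W \<noteq> {} \<longrightarrow> koszul lam h I z = g I z" if "finite W" for W
    using that
  proof (induction W)
    case empty
    show ?case using zero_entire_forms by auto
  next
    case (insert m W)
    then obtain h where h: "h \<in> entire_forms (i + 1)"
      "\<And>I z. I \<inter> W \<noteq> {} \<Longrightarrow> koszul lam h I z = g I z" by blast
    define g' where "g' = (\<lambda>I z. g I z - koszul lam h I z)"
    have g': "g' \<in> entire_forms i"
      unfolding g'_def using contr_entire_forms[OF clinear_form_holo[OF lam] h(1)] g by (intro diff_entire_forms) auto
    have "koszul lam g' I z = 0" for I z
      by (simp add: g'_def contr_diff cycle contr_contr)
    from koszul_homotopy[OF lam b g' this, of m] obtain h' where h': "h' \<in> entire_forms (i + 1)"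
      "\<And>I z. koszul lam h' I z = g' I z - (if m \<in> I then 0 else g' I (z - lam m z *s b m))" by blast
    have "contr (\<lambda>k. lam k z) (\<lambda>J. h J z + h' J z) I = g I z" if "I \<inter> insert m W \<noteq> {}" for I z
    proof (cases "m \<in> I")
      case True
      thus ?thesis unfolding contr_add h'(2) by (simp add: g'_def)
    next
      case False
      hence ne: "I \<inter> W \<noteq> {}" using that by auto
      hence "g' I x = 0" for x unfolding g'_def h(2)[OF ne] by simp
      thus ?thesis unfolding contr_add h'(2) h(2)[OF ne] by simp
    qed
    thus ?case
      by (intro bexI[OF _ add_entire_forms[OF h(1) h'(1)]]) simp
  qed
  from this[of UNIV] obtain h where h: "h \<in> entire_forms (i + 1)"
    "\<And>I z. I \<noteq> {} \<Longrightarrow> koszul lam h I z = g I z" by auto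
  \<comment> \<open>The induction does not reach the empty set; that component has degree 0, below
    \<open>i\<close>.\<close>
  have "contr (\<lambda>k. lam k z) (\<lambda>J. h J z) {} = g {} z" for z
  proof -
    have "g {} = (\<lambda>_. 0)" using g i unfolding entire_forms_def by auto
    moreover have "contr (\<lambda>k. lam k z) (\<lambda>J. h J z) {} = 0"
      using h(1) i by (intro contr_graded[of "i + 1"]) (auto simp: entire_forms_def)
    ultimately show ?thesis by simp
  qed
  hence "koszul lam h I z = g I z" for I z
    using h(2)[of I z] by (cases "I = {}") simp_all
  thus ?thesis using h(1) by blast
qed

section \<open>Monomials and unions of coordinate subspaces\<close>

definition pr :: "'d set \<Rightarrow> complex ^ 'd \<Rightarrow> complex ^ 'd" where
  "pr A z = (\<chi> i. if i \<in> A then z $ i else 0)"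

lemma pr_nth [simp]: "pr A z $ i = (if i \<in> A then z $ i else 0)"
  by (simp add: pr_def)

lemma has_derivative_pr: "((pr A :: complex ^ 'd \<Rightarrow> complex ^ 'd) has_derivative pr A) (at z)"
proof -
  have "linear (pr A :: complex ^ 'd \<Rightarrow> complex ^ 'd)" by (rule linearI) (auto simp: vec_eq_iff)
  thus ?thesis by (simp add: linear_conv_bounded_linear bounded_linear_imp_has_derivative)
qed

lemma pr_smult: "pr A (c *s z) = c *s pr A z"
  by (simp add: vec_eq_iff)

lemma holo_on_pr:
  assumes "holo_on g V" "\<And>z. z \<in> U \<Longrightarrow> pr A z \<in> V"
  shows "holo_on (\<lambda>z. g (pr A z)) U"
  by (rule holo_on_compose[OF assms has_derivative_pr pr_smult])

lemma clinear_form_nth: "clinear_form (\<lambda>z. z $ i)"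
  unfolding clinear_form_def
  by (rule exI[of _ "\<lambda>j. if j = i then 1 else 0"]) (simp add: if_distrib[of "\<lambda>c. c * _"] cong: if_cong)

text \<open>Hadamard division by one coordinate at a time. The quotient by \<open>z $ i\<close>
  still vanishes on the other hyperplanes: this is clear where \<open>z $ i\<close> is nonzero and
  follows by continuity elsewhere.\<close>

lemma entire_divide_monomial:
  fixes h :: "complex ^ 'd::finite \<Rightarrow> complex"
  assumes "finite R" "holo_on h UNIV" "\<And>(z :: complex ^ 'd) i. i \<in> R \<Longrightarrow> z $ i = 0 \<Longrightarrow> h z = 0"
  shows "\<exists>h'. holo_on h' UNIV \<and> (\<forall>z. h z = (\<Prod>i\<in>R. z $ i) * h' z)"
  using assms
proof (induction R arbitrary: h)
  case empty
  thus ?case by (intro exI[of _ h]) auto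
next
  case (insert i R)
  let ?q = "divq (\<lambda>z. z $ i) (axis i 1) h"
  have q: "holo_on ?q UNIV" by (rule holo_on_divq[OF insert.prems(1)]) (auto simp: clinear_form_nth)
  have qm: "z $ i * ?q z = h z" for z
  proof -
    have "z $ i * ?q z = h z - h (z - z $ i *s axis i 1)"
      by (rule divq_mult[OF insert.prems(1)]) (auto simp: clinear_form_nth)
    moreover have "h (z - z $ i *s axis i 1) = 0" by (rule insert.prems(2)[of i]) auto
    ultimately show ?thesis by simp
  qed
  have qz: "?q z = 0" if "j \<in> R" "z $ j = 0" for z :: "complex ^ 'd" and j
  proof (rule zero_by_lines[OF holo_on_continuous_on[OF q] open_UNIV UNIV_I])
    fix t assume t: "t \<notin> {- z $ i}"
    have "j \<noteq> i" using that insert.hyps by auto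
    hence "h (z + t *s axis i 1) = 0" using that by (intro insert.prems(2)[of j]) (auto simp: axis_def)
    thus "?q (z + t *s axis i 1) = 0" using qm[of "z + t *s axis i 1"] t by (auto simp: add_eq_0_iff)
  qed simp
  have "\<exists>h'. holo_on h' UNIV \<and> (\<forall>z. ?q z = (\<Prod>i\<in>R. z $ i) * h' z)"
    by (rule insert.IH[OF q]) (rule qz)
  then obtain h' where "holo_on h' UNIV" "\<And>z. ?q z = (\<Prod>i\<in>R. z $ i) * h' z" by blast
  thus ?case using qm insert.hyps by (intro exI[of _ h']) (simp add: mult.assoc)
qed

definition coord_union :: "'d set set \<Rightarrow> (complex ^ 'd) set" where
  "coord_union F = {z. \<exists>A\<in>F. \<forall>i. i \<notin> A \<longrightarrow> z $ i = 0}"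

text \<open>
  Induction along a shelling: the functions on the union of the first coordinate subspaces that
  vanish on the earlier ones are the multiples of a monomial on the last one, where the forms
  \<open>lam k\<close> are coordinates.
\<close>

lemma koszul_shelling:
  fixes lam :: "'n::{finite,linorder} \<Rightarrow> complex ^ 'd::finite \<Rightarrow> complex"
    and w :: "'d set \<Rightarrow> real"
  assumes lam: "\<And>k. clinear_form (lam k)"
    and b: "\<And>A. A \<in> F \<Longrightarrow> \<exists>b. (\<forall>k l. lam k (b l) = (if k = l then 1 else 0)) \<and> (\<forall>l i. i \<notin> A \<longrightarrow> b l $ i = 0)"
    and w: "inj_on w F" and r: "\<And>A. A \<in> F \<Longrightarrow> r A \<subseteq> A"
    and sh1: "\<And>A A'. A \<in> F \<Longrightarrow> A' \<in> F \<Longrightarrow> w A' < w A \<Longrightarrow> \<not> r A \<subseteq> A'"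
    and sh2: "\<And>A i. A \<in> F \<Longrightarrow> i \<in> r A \<Longrightarrow> \<exists>A'\<in>F. w A' < w A \<and> A - {i} \<subseteq> A'"
    and g: "g \<in> entire_forms i" and i: "i \<ge> 1"
    and cycle: "\<And>I z. z \<in> coord_union F \<Longrightarrow> koszul lam g I z = 0"
  shows "\<exists>h\<in>entire_forms (i + 1). \<forall>I. \<forall>z\<in>coord_union F. koszul lam h I z = g I z"
proof -
  \<comment> \<open>\<open>E\<close> runs over the initial segments of \<open>F\<close> in the order
    given by \<open>w\<close>.\<close>
  have "\<exists>h\<in>entire_forms (i + 1). \<forall>I. \<forall>z\<in>coord_union E. koszul lam h I z = g I z"
    if "card E = n" "E \<subseteq> F" "\<And>A A'. A \<in> E \<Longrightarrow> A' \<in> F \<Longrightarrow> w A' < w A \<Longrightarrow> A' \<in> E" for n E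
    using that
  proof (induction n arbitrary: E)
    case 0
    hence "E = {}" by simp
    thus ?case using zero_entire_forms by (intro bexI[of _ "\<lambda>_ _. 0"]) (auto simp: coord_union_def)
  next
    case (Suc n)
    hence ne: "E \<noteq> {}" by auto
    obtain A where A: "A \<in> E" "\<And>A'. A' \<in> E \<Longrightarrow> w A' \<le> w A"
    proof -
      have fin: "finite (w ` E)" by simp
      hence "Max (w ` E) \<in> w ` E" using ne by (intro Max_in) auto
      then obtain A where "A \<in> E" "w A = Max (w ` E)" by auto
      thus ?thesis using that[of A] Max_ge[OF fin] by auto
    qed
    have AF: "A \<in> F" using A Suc.prems by auto
    define E' where "E' = E - {A}"
    have lt: "w A' < w A" if "A' \<in> E'" for A'
      using that A Suc.prems(2) inj_onD[OF w, of A A'] by (force simp: E'_def)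
    have E': "A' \<in> E'" if "A' \<in> F" "w A' < w A" for A'
      using that A(1) Suc.prems(3)[of A A'] by (auto simp: E'_def)
    obtain h1 where h1: "h1 \<in> entire_forms (i + 1)"
      "\<And>I z. z \<in> coord_union E' \<Longrightarrow> koszul lam h1 I z = g I z"
    proof -
      have "card E' = n" using Suc.prems(1) A(1) by (simp add: E'_def)
      moreover have "E' \<subseteq> F" using Suc.prems(2) by (auto simp: E'_def)
      moreover have "A'' \<in> E'" if "A' \<in> E'" "A'' \<in> F" "w A'' < w A'" for A' A''
        using E'[of A''] lt[OF that(1)] that by auto
      ultimately show ?thesis using Suc.IH that by blast
    qed
    \<comment> \<open>What \<open>h1\<close> leaves over is still a cycle on the whole union, and it
      vanishes on the earlier subspaces.\<close>
    define g1 where "g1 = (\<lambda>I z. g I z - koszul lam h1 I z)"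
    have g1: "g1 \<in> entire_forms i"
      unfolding g1_def using contr_entire_forms[OF clinear_form_holo[OF lam] h1(1)] g by (intro diff_entire_forms) auto
    have g1h: "holo_on (g1 I) UNIV" and g1z: "int (card I) \<noteq> i \<Longrightarrow> g1 I = (\<lambda>_. 0)" for I
      using g1 unfolding entire_forms_def by auto
    have prA: "pr A z \<in> coord_union F" for z using AF by (auto simp: coord_union_def)
    have g1c: "contr (\<lambda>k. lam k (pr A z)) (\<lambda>J. g1 J (pr A z)) I = 0" for I z
      by (simp add: g1_def contr_diff cycle[OF prA] contr_contr)
    have g1v: "g1 I z = 0" if "z \<in> coord_union E'" for I z using h1(2)[OF that] by (simp add: g1_def)
    \<comment> \<open>By the second shelling condition, points of the new subspace with a vanishing
      coordinate in \<open>r A\<close> lie on earlier subspaces; hence this monomial divides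
      \<open>g1\<close> there.\<close>
    let ?M = "\<lambda>z::complex ^ 'd. \<Prod>i\<in>r A. z $ i"
    have "\<exists>h'. holo_on h' UNIV \<and> (\<forall>z. g1 I (pr A z) = ?M z * h' z)" for I
    proof (rule entire_divide_monomial)
      show "holo_on (\<lambda>z. g1 I (pr A z)) UNIV" by (rule holo_on_pr[OF g1h]) simp
      fix z :: "complex ^ 'd" and j :: 'd assume j: "j \<in> r A" "z $ j = 0"
      obtain A' where "A' \<in> F" "w A' < w A" "A - {j} \<subseteq> A'" using sh2[OF AF j(1)] by blast
      hence "pr A z \<in> coord_union E'" using E' j by (auto simp: coord_union_def intro!: bexI[of _ A'])
      thus "g1 I (pr A z) = 0" by (rule g1v)
    qed simp
    then obtain h0 where h0: "\<And>I. holo_on (h0 I) UNIV" "\<And>I z. g1 I (pr A z) = ?M z * h0 I z" by metis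
    \<comment> \<open>The division treats each component separately, so the components of wrong
      degree have to be cut off.\<close>
    define h2 where "h2 = (\<lambda>I z. if int (card I) = i then h0 I (pr A z) else 0)"
    have pp: "pr A (pr A z) = pr A z" for z :: "complex ^ 'd" by (simp add: vec_eq_iff)
    have Mp: "?M (pr A z) = ?M z" for z using r[OF AF] by (intro prod.cong) auto
    have h2m: "g1 I (pr A z) = ?M z * h2 I z" for I z
    proof -
      have "g1 I (pr A z) = ?M z * h0 I (pr A z)" using h0(2)[of I "pr A z"] unfolding pp Mp .
      thus ?thesis using g1z[of I] by (cases "int (card I) = i") (simp_all add: h2_def)
    qed
    have h2: "h2 \<in> entire_forms i"
    proof -
      have "holo_on (h2 I) UNIV" for I
        using holo_on_pr[OF h0(1), of UNIV A I]
        by (cases "int (card I) = i") (simp_all add: h2_def holo_on_const)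
      thus ?thesis unfolding entire_forms_def by (auto simp: h2_def)
    qed
    have lamp: "clinear_form (\<lambda>z. lam k (pr A z))" for k
    proof -
      obtain a where "\<And>z. lam k z = (\<Sum>i\<in>UNIV. a i * z $ i)" using lam[of k] unfolding clinear_form_def by blast
      thus ?thesis unfolding clinear_form_def
        by (intro exI[of _ "\<lambda>i. if i \<in> A then a i else 0"]) (auto intro!: sum.cong)
    qed
    obtain bb where bb: "\<And>k l. lam k (bb l) = (if k = l then 1 else 0)" "\<And>l i. i \<notin> A \<Longrightarrow> bb l $ i = 0" using b[OF AF] by blast
    have "pr A (bb l) = bb l" for l using bb(2) by (auto simp: vec_eq_iff)
    hence bbp: "lam k (pr A (bb l)) = (if k = l then 1 else 0)" for k l by (simp add: bb(1))
    \<comment> \<open>The monomial is cancelled away from its zero set. The direction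
      \<open>vec 1\<close> moves all coordinates at once, so a line in this direction meets the zero
      set in finitely many points.\<close>
    have h2c: "contr (\<lambda>k. lam k (pr A z)) (\<lambda>J. h2 J z) I = 0" for I z
    proof (rule zero_by_lines[of UNIV "\<lambda>z. contr (\<lambda>k. lam k (pr A z)) (\<lambda>J. h2 J z) I", OF _ open_UNIV UNIV_I])
      show "continuous_on UNIV (\<lambda>z. contr (\<lambda>k. lam k (pr A z)) (\<lambda>J. h2 J z) I)"
        using h2 by (intro holo_on_continuous_on holo_on_contr clinear_form_holo[OF lamp]) (auto simp: entire_forms_def)
      show "finite ((\<lambda>i. - z $ i) ` r A)" by simp
      fix t assume t: "t \<notin> (\<lambda>i. - z $ i) ` r A"
      let ?x = "z + t *s vec 1"
      have "?M ?x \<noteq> 0" using t by (auto simp: add_eq_0_iff)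
      moreover have "?M ?x * contr (\<lambda>k. lam k (pr A ?x)) (\<lambda>J. h2 J ?x) I = 0"
        using g1c[of ?x I] unfolding h2m contr_scale .
      ultimately show "contr (\<lambda>k. lam k (pr A ?x)) (\<lambda>J. h2 J ?x) I = 0" by simp
    qed
    obtain h3 where h3: "h3 \<in> entire_forms (i + 1)" "\<And>I z. contr (\<lambda>k. lam k (pr A z)) (\<lambda>J. h3 J z) I = h2 I z"
      using koszul_acyclic[OF lamp bbp h2 i h2c] by blast
    \<comment> \<open>The factor \<open>?M\<close> makes the correction vanish on the earlier
      subspaces, by the first shelling condition; on the new subspace \<open>pr A\<close> is the
      identity.\<close>
    define h4 where "h4 = (\<lambda>I z. ?M z * h3 I (pr A z))"
    have h4: "h4 \<in> entire_forms (i + 1)"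
      using h3(1) unfolding entire_forms_def h4_def
      by (auto intro!: holo_on_mult holo_on_prod holo_on_nth holo_on_pr)
    have "contr (\<lambda>k. lam k z) (\<lambda>J. h1 J z + h4 J z) I = g I z" if z: "z \<in> coord_union E" for I z
    proof -
      obtain A' where A': "A' \<in> E" "\<And>i. i \<notin> A' \<Longrightarrow> z $ i = 0" using z unfolding coord_union_def by auto
      have "koszul lam h4 I z = g1 I z"
      proof (cases "A' = A")
        case True
        hence pz: "pr A z = z" using A'(2) by (auto simp: vec_eq_iff)
        show ?thesis
          using h3(2)[of z I] h2m[of I z] by (simp add: h4_def contr_scale pz)
      next
        case False
        hence A'E: "A' \<in> E'" using A'(1) by (simp add: E'_def)
        hence zE: "z \<in> coord_union E'" using A'(2) by (auto simp: coord_union_def)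
        obtain j where "j \<in> r A" "j \<notin> A'" using sh1[OF AF _ lt[OF A'E]] A'(1) Suc.prems(2) by blast
        hence "?M z = 0" using A'(2) by auto
        moreover have "koszul lam h4 I z = ?M z * contr (\<lambda>k. lam k z) (\<lambda>J. h3 J (pr A z)) I"
          unfolding h4_def by (rule contr_scale)
        ultimately show ?thesis using g1v[OF zE] by simp
      qed
      thus ?thesis by (simp add: contr_add g1_def)
    qed
    thus ?case
      by (intro bexI[OF _ add_entire_forms[OF h1(1) h4]]) simp
  qed
  from this[of F "card F"] show ?thesis by blast
qed


section \<open>Sections of the structure sheaf\<close>

lemma holo_on_vf_amb:
  assumes "holo_on g U" "open U"
  shows "holo_on (vf_amb \<rho> m g) U"
  unfolding vf_amb_def
  by (intro holo_on_sum holo_on_mult holo_on_const holo_on_nth holo_on_dd assms)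

lemma vf_amb_cong:
  assumes "open U" "z \<in> U" "\<And>z. z \<in> U \<Longrightarrow> g z = h z" "holo_on g U"
  shows "vf_amb \<rho> m g z = vf_amb \<rho> m h z"
  using dd_cong[OF assms] by (simp add: vf_amb_def)

lemma vf_amb_const: "vf_amb \<rho> m (\<lambda>_. c) z = 0"
  by (simp add: vf_amb_def dd_const)

lemma vf_amb_nth: "vf_amb \<rho> m (\<lambda>z. z $ i) z = of_int (m (\<rho> i)) * z $ i"
  unfolding vf_amb_def dd_nth by (subst sum_eq_single[of _ i]) (auto simp: axis_def)

lemma vf_amb_add:
  assumes "holo_on g U" "holo_on h U" "z \<in> U"
  shows "vf_amb \<rho> m (\<lambda>z. g z + h z) z = vf_amb \<rho> m g z + vf_amb \<rho> m h z"
  by (simp add: vf_amb_def dd_add[OF assms] distrib_left sum.distrib)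

lemma vf_amb_mult:
  assumes "holo_on g U" "holo_on h U" "z \<in> U"
  shows "vf_amb \<rho> m (\<lambda>z. g z * h z) z = g z * vf_amb \<rho> m h z + vf_amb \<rho> m g z * h z"
  unfolding vf_amb_def dd_mult[OF assms]
  by (simp add: algebra_simps sum.distrib sum_distrib_left)

lemma vf_amb_sum:
  assumes "\<And>i. i \<in> I \<Longrightarrow> holo_on (g i) U" "z \<in> U"
  shows "vf_amb \<rho> m (\<lambda>z. \<Sum>i\<in>I. g i z) z = (\<Sum>i\<in>I. vf_amb \<rho> m (g i) z)"
proof -
  have "dd (\<lambda>z. \<Sum>i\<in>I. g i z) v z = (\<Sum>i\<in>I. dd (g i) v z)" for v
    by (rule dd_sum[OF assms])
  thus ?thesis by (simp add: vf_amb_def sum_distrib_left) (rule sum.swap)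
qed

lemma vf_amb_scale:
  assumes "holo_on g U" "z \<in> U"
  shows "vf_amb \<rho> m (\<lambda>z. c * g z) z = c * vf_amb \<rho> m g z"
  using vf_amb_mult[OF holo_on_const assms] by (simp add: vf_amb_const)

text \<open>Monomials are eigenfunctions of these vector fields, which is why the fields preserve
  the Stanley-Reisner ideal.\<close>

lemma vf_amb_monomial:
  "finite S \<Longrightarrow> vf_amb \<rho> m (\<lambda>z. \<Prod>i\<in>S. z $ i) z = (\<Sum>i\<in>S. of_int (m (\<rho> i))) * (\<Prod>i\<in>S. z $ i)"
proof (induction S rule: finite_induct)
  case (insert i S)
  have "vf_amb \<rho> m (\<lambda>z. z $ i * (\<Prod>i\<in>S. z $ i)) z =
      z $ i * vf_amb \<rho> m (\<lambda>z. \<Prod>i\<in>S. z $ i) z + vf_amb \<rho> m (\<lambda>z. z $ i) z * (\<Prod>i\<in>S. z $ i)"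
    by (rule vf_amb_mult[of _ UNIV]) (auto intro: holo_on_nth holo_on_prod)
  thus ?case using insert by (simp add: vf_amb_nth algebra_simps)
qed (simp add: vf_amb_const)

text \<open>The second-order part is symmetric because partial derivatives commute; the first-order
  part has the coefficients \<open>m (\<rho> i) * m' (\<rho> i)\<close>, symmetric as well.\<close>

lemma vf_amb_commute:
  assumes g: "holo_on g U" "open U" and z: "z \<in> U"
  shows "vf_amb \<rho> m (vf_amb \<rho> m' g) z = vf_amb \<rho> m' (vf_amb \<rho> m g) z"
proof -
  have *: "vf_amb \<rho> m (vf_amb \<rho> m' g) z =
    (\<Sum>i\<in>UNIV. \<Sum>j\<in>UNIV. of_int (m (\<rho> i)) * of_int (m' (\<rho> j)) * z $ i * z $ j * dd (dd g (axis j 1)) (axis i 1) z) +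
    (\<Sum>i\<in>UNIV. of_int (m (\<rho> i)) * of_int (m' (\<rho> i)) * z $ i * dd g (axis i 1) z)" for m m'
  proof -
    have "vf_amb \<rho> m (vf_amb \<rho> m' g) z =
       (\<Sum>j\<in>UNIV. vf_amb \<rho> m (\<lambda>z. of_int (m' (\<rho> j)) * (z $ j * dd g (axis j 1) z)) z)"
      unfolding vf_amb_def[of \<rho> m' g] mult.assoc
      by (rule vf_amb_sum[of _ _ U]) (intro holo_on_mult holo_on_const holo_on_nth holo_on_dd g z)+
    also have "\<dots> = (\<Sum>j\<in>UNIV. of_int (m' (\<rho> j)) *
       (z $ j * vf_amb \<rho> m (dd g (axis j 1)) z + of_int (m (\<rho> j)) * z $ j * dd g (axis j 1) z))"
    proof (rule sum.cong[OF refl])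
      fix j
      have "vf_amb \<rho> m (\<lambda>z. z $ j * dd g (axis j 1) z) z =
          z $ j * vf_amb \<rho> m (dd g (axis j 1)) z + vf_amb \<rho> m (\<lambda>z. z $ j) z * dd g (axis j 1) z"
        by (rule vf_amb_mult[OF holo_on_nth holo_on_dd[OF g] z])
      moreover have "vf_amb \<rho> m (\<lambda>z. of_int (m' (\<rho> j)) * (z $ j * dd g (axis j 1) z)) z =
          of_int (m' (\<rho> j)) * vf_amb \<rho> m (\<lambda>z. z $ j * dd g (axis j 1) z) z"
        by (rule vf_amb_scale[OF holo_on_mult[OF holo_on_nth holo_on_dd[OF g]] z])
      ultimately show "vf_amb \<rho> m (\<lambda>z. of_int (m' (\<rho> j)) * (z $ j * dd g (axis j 1) z)) z =
         of_int (m' (\<rho> j)) * (z $ j * vf_amb \<rho> m (dd g (axis j 1)) z + of_int (m (\<rho> j)) * z $ j * dd g (axis j 1) z)"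
        by (simp add: vf_amb_nth)
    qed
    also have "\<dots> = (\<Sum>j\<in>UNIV. \<Sum>i\<in>UNIV. of_int (m (\<rho> i)) * of_int (m' (\<rho> j)) * z $ i * z $ j * dd (dd g (axis j 1)) (axis i 1) z) +
      (\<Sum>i\<in>UNIV. of_int (m (\<rho> i)) * of_int (m' (\<rho> i)) * z $ i * dd g (axis i 1) z)"
      by (simp add: vf_amb_def sum.distrib sum_distrib_left algebra_simps)
    finally show ?thesis by (subst sum.swap)
  qed
  have "(\<Sum>i\<in>UNIV. \<Sum>j\<in>UNIV. of_int (m (\<rho> i)) * of_int (m' (\<rho> j)) * z $ i * z $ j * dd (dd g (axis j 1)) (axis i 1) z) =
      (\<Sum>j\<in>UNIV. \<Sum>i\<in>UNIV. of_int (m' (\<rho> j)) * of_int (m (\<rho> i)) * z $ j * z $ i * dd (dd g (axis i 1)) (axis j 1) z)"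
  proof (subst sum.swap, intro sum.cong refl)
    fix i j
    show "of_int (m (\<rho> i)) * of_int (m' (\<rho> j)) * z $ i * z $ j * dd (dd g (axis j 1)) (axis i 1) z =
        of_int (m' (\<rho> j)) * of_int (m (\<rho> i)) * z $ j * z $ i * dd (dd g (axis i 1)) (axis j 1) z"
      by (simp add: dd_commute[OF g z, of "axis j 1" "axis i 1"])
  qed
  thus ?thesis unfolding * by (simp add: mult_ac)
qed

context projective_fan
begin

section \<open>The Stanley-Reisner ideal and its zero set\<close>

abbreviation N :: "'d set set" where "N \<equiv> nonfaces \<Sigma> \<rho>"
abbreviation X :: "(complex ^ 'd) set" where "X \<equiv> coord_union facets"
abbreviation cg :: "complex ^ 'd \<Rightarrow> (complex ^ 'd \<Rightarrow> complex) \<Rightarrow> (complex ^ 'd \<Rightarrow> complex) \<Rightarrow> bool" where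
  "cg \<equiv> SR_cong \<Sigma> \<rho>"
abbreviation rs :: "(complex ^ 'd \<Rightarrow> complex) \<Rightarrow> 'd sec" where "rs \<equiv> restr \<Sigma> \<rho>"

lemma nonface_mono: "S \<in> N \<Longrightarrow> S \<subseteq> T \<Longrightarrow> T \<in> N"
  unfolding nonfaces_def by blast

lemma nonface_monomial_zero: "z \<in> X \<Longrightarrow> S \<in> N \<Longrightarrow> (\<Prod>i\<in>S. z $ i) = 0"
  using faces_iff[of S] unfolding coord_union_def by fastforce

text \<open>Membership over all of \<open>U\<close> with one choice of coefficients; congruence of
  germs is this on some neighbourhood, see \<open>SR_cong_iff\<close>.\<close>

definition ideal_on :: "(complex ^ 'd) set \<Rightarrow> (complex ^ 'd \<Rightarrow> complex) \<Rightarrow> bool" where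
  "ideal_on U f \<longleftrightarrow> (\<exists>a. (\<forall>S\<in>N. holo_on (a S) U) \<and> (\<forall>z\<in>U. f z = (\<Sum>S\<in>N. a S z * (\<Prod>i\<in>S. z $ i))))"

lemma SR_cong_iff: "cg x g h \<longleftrightarrow>
   (\<exists>U. open U \<and> x \<in> U \<and> holo_on g U \<and> holo_on h U \<and> ideal_on U (\<lambda>z. g z - h z))"
  unfolding SR_cong_def ideal_on_def by auto

lemma ideal_on_subset: "ideal_on U f \<Longrightarrow> V \<subseteq> U \<Longrightarrow> ideal_on V f"
  unfolding ideal_on_def by (meson holo_on_subset subsetD)

lemma ideal_on_cong: "ideal_on U f \<Longrightarrow> (\<And>z. z \<in> U \<Longrightarrow> f z = g z) \<Longrightarrow> ideal_on U g"
  unfolding ideal_on_def by simp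

lemma ideal_on_zero: "ideal_on U (\<lambda>_. 0)"
  unfolding ideal_on_def by (intro exI[of _ "\<lambda>_ _. 0"]) (auto intro: holo_on_const)

lemma ideal_on_add:
  assumes "ideal_on U f" "ideal_on U g"
  shows "ideal_on U (\<lambda>z. f z + g z)"
proof -
  obtain a a' where a: "\<forall>S\<in>N. holo_on (a S) U" "\<forall>z\<in>U. f z = (\<Sum>S\<in>N. a S z * (\<Prod>i\<in>S. z $ i))"
     "\<forall>S\<in>N. holo_on (a' S) U" "\<forall>z\<in>U. g z = (\<Sum>S\<in>N. a' S z * (\<Prod>i\<in>S. z $ i))"
    using assms unfolding ideal_on_def by blast
  show ?thesis unfolding ideal_on_def
    by (rule exI[of _ "\<lambda>S z. a S z + a' S z"]) (use a in \<open>auto intro!: holo_on_add simp: distrib_right sum.distrib\<close>)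
qed

lemma ideal_on_mult:
  assumes "holo_on f U" "ideal_on U g"
  shows "ideal_on U (\<lambda>z. f z * g z)"
proof -
  obtain a where a: "\<forall>S\<in>N. holo_on (a S) U" "\<forall>z\<in>U. g z = (\<Sum>S\<in>N. a S z * (\<Prod>i\<in>S. z $ i))"
    using assms unfolding ideal_on_def by blast
  show ?thesis unfolding ideal_on_def
    by (rule exI[of _ "\<lambda>S z. f z * a S z"]) (use a assms(1) in \<open>auto intro!: holo_on_mult simp: sum_distrib_left mult.assoc\<close>)
qed

lemma ideal_on_monomial:
  assumes "S \<in> N" "holo_on f U"
  shows "ideal_on U (\<lambda>z. (\<Prod>i\<in>S. z $ i) * f z)"
  unfolding ideal_on_def
proof (rule exI[of _ "\<lambda>T. if T = S then f else (\<lambda>_. 0)"], intro conjI ballI)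
  fix z
  show "(\<Prod>i\<in>S. z $ i) * f z = (\<Sum>T\<in>N. (if T = S then f else (\<lambda>_. 0)) z * (\<Prod>i\<in>T. z $ i))"
    by (subst sum_eq_single[of _ S]) (use assms in auto)
qed (use assms in \<open>auto intro: holo_on_const\<close>)

text \<open>Leibniz rule on each summand: the derivative of a monomial is a constant multiple of the
  same monomial.\<close>

lemma ideal_on_vf:
  assumes "ideal_on U f" "open U" "holo_on f U"
  shows "ideal_on U (vf_amb \<rho> m f)"
proof -
  obtain a where a: "\<And>S. S \<in> N \<Longrightarrow> holo_on (a S) U" "\<And>z. z \<in> U \<Longrightarrow> f z = (\<Sum>S\<in>N. a S z * (\<Prod>i\<in>S. z $ i))"
    using assms unfolding ideal_on_def by blast
  have "vf_amb \<rho> m f z = (\<Sum>S\<in>N. (a S z * (\<Sum>i\<in>S. of_int (m (\<rho> i))) + vf_amb \<rho> m (a S) z) * (\<Prod>i\<in>S. z $ i))"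
    if z: "z \<in> U" for z
  proof -
    have "vf_amb \<rho> m f z = vf_amb \<rho> m (\<lambda>z. \<Sum>S\<in>N. a S z * (\<Prod>i\<in>S. z $ i)) z"
      by (rule vf_amb_cong[OF assms(2) z a(2) assms(3)])
    also have "\<dots> = (\<Sum>S\<in>N. vf_amb \<rho> m (\<lambda>z. a S z * (\<Prod>i\<in>S. z $ i)) z)"
      by (rule vf_amb_sum[OF _ z]) (intro holo_on_mult holo_on_prod holo_on_nth a(1))
    also have "\<dots> = (\<Sum>S\<in>N. (a S z * (\<Sum>i\<in>S. of_int (m (\<rho> i))) + vf_amb \<rho> m (a S) z) * (\<Prod>i\<in>S. z $ i))"
    proof (rule sum.cong[OF refl])
      fix S assume S: "S \<in> N"
      have "vf_amb \<rho> m (\<lambda>z. a S z * (\<Prod>i\<in>S. z $ i)) z =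
          a S z * vf_amb \<rho> m (\<lambda>z. \<Prod>i\<in>S. z $ i) z + vf_amb \<rho> m (a S) z * (\<Prod>i\<in>S. z $ i)"
        by (rule vf_amb_mult[OF a(1)[OF S] _ z]) (intro holo_on_prod holo_on_nth)
      thus "vf_amb \<rho> m (\<lambda>z. a S z * (\<Prod>i\<in>S. z $ i)) z =
        (a S z * (\<Sum>i\<in>S. of_int (m (\<rho> i))) + vf_amb \<rho> m (a S) z) * (\<Prod>i\<in>S. z $ i)"
        by (simp add: vf_amb_monomial algebra_simps)
    qed
    finally show ?thesis .
  qed
  moreover have "holo_on (\<lambda>z. a S z * (\<Sum>i\<in>S. of_int (m (\<rho> i))) + vf_amb \<rho> m (a S) z) U" if "S \<in> N" for S
    by (intro holo_on_add holo_on_mult holo_on_const holo_on_vf_amb a(1) that assms(2))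
  ultimately show ?thesis unfolding ideal_on_def
    by (intro exI[of _ "\<lambda>S z. a S z * (\<Sum>i\<in>S. of_int (m (\<rho> i))) + vf_amb \<rho> m (a S) z"]) auto
qed

lemma SR_cong_refl: "open U \<Longrightarrow> x \<in> U \<Longrightarrow> holo_on g U \<Longrightarrow> cg x g g"
  unfolding SR_cong_iff using ideal_on_zero by auto

lemma SR_cong_sym: "cg x g h \<Longrightarrow> cg x h g"
proof -
  assume "cg x g h"
  then obtain U where U: "open U" "x \<in> U" "holo_on g U" "holo_on h U" "ideal_on U (\<lambda>z. g z - h z)"
    unfolding SR_cong_iff by blast
  have "ideal_on U (\<lambda>z. h z - g z)"
    using ideal_on_mult[OF holo_on_const[of "-1"] U(5)] by simp
  thus ?thesis using U unfolding SR_cong_iff by blast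
qed

lemma SR_cong_two:
  assumes "cg x g h" "cg x g' h'"
  obtains U where "open U" "x \<in> U" "holo_on g U" "holo_on h U" "ideal_on U (\<lambda>z. g z - h z)"
    "holo_on g' U" "holo_on h' U" "ideal_on U (\<lambda>z. g' z - h' z)"
proof -
  obtain U where U: "open U" "x \<in> U" "holo_on g U" "holo_on h U" "ideal_on U (\<lambda>z. g z - h z)"
    using assms(1) unfolding SR_cong_iff by blast
  obtain V where V: "open V" "x \<in> V" "holo_on g' V" "holo_on h' V" "ideal_on V (\<lambda>z. g' z - h' z)"
    using assms(2) unfolding SR_cong_iff by blast
  show ?thesis
    by (rule that[of "U \<inter> V"])
       (use U V in \<open>auto intro: holo_on_subset[OF _ Int_lower1] holo_on_subset[OF _ Int_lower2]
          ideal_on_subset[OF _ Int_lower1] ideal_on_subset[OF _ Int_lower2]\<close>)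
qed

lemma SR_cong_trans:
  assumes "cg x g h" "cg x h k"
  shows "cg x g k"
proof -
  obtain U where U: "open U" "x \<in> U" "holo_on g U" "holo_on h U" "ideal_on U (\<lambda>z. g z - h z)"
    "holo_on h U" "holo_on k U" "ideal_on U (\<lambda>z. h z - k z)"
    using SR_cong_two[OF assms] by blast
  have "ideal_on U (\<lambda>z. g z - k z)" using ideal_on_add[OF U(5,8)] by simp
  thus ?thesis using U unfolding SR_cong_iff by blast
qed

lemma SR_cong_add:
  assumes "cg x g h" "cg x g' h'"
  shows "cg x (\<lambda>z. g z + g' z) (\<lambda>z. h z + h' z)"
proof -
  obtain U where U: "open U" "x \<in> U" "holo_on g U" "holo_on h U" "ideal_on U (\<lambda>z. g z - h z)"
    "holo_on g' U" "holo_on h' U" "ideal_on U (\<lambda>z. g' z - h' z)"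
    using SR_cong_two[OF assms] by blast
  have "ideal_on U (\<lambda>z. (g z + g' z) - (h z + h' z))"
    using ideal_on_add[OF U(5,8)] by (rule ideal_on_cong) simp
  thus ?thesis using U unfolding SR_cong_iff by (intro exI[of _ U]) (simp add: holo_on_add)
qed

lemma SR_cong_mult:
  assumes "cg x g h" "cg x g' h'"
  shows "cg x (\<lambda>z. g z * g' z) (\<lambda>z. h z * h' z)"
proof -
  obtain U where U: "open U" "x \<in> U" "holo_on g U" "holo_on h U" "ideal_on U (\<lambda>z. g z - h z)"
    "holo_on g' U" "holo_on h' U" "ideal_on U (\<lambda>z. g' z - h' z)"
    using SR_cong_two[OF assms] by blast
  have "ideal_on U (\<lambda>z. g z * g' z - h z * h' z)"
    using ideal_on_add[OF ideal_on_mult[OF U(3,8)] ideal_on_mult[OF U(7,5)]]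
    by (rule ideal_on_cong) (simp add: algebra_simps)
  thus ?thesis using U unfolding SR_cong_iff by (intro exI[of _ U]) (simp add: holo_on_mult)
qed

lemma SR_cong_vf:
  assumes "cg x g h"
  shows "cg x (vf_amb \<rho> m g) (vf_amb \<rho> m h)"
proof -
  obtain U where U: "open U" "x \<in> U" "holo_on g U" "holo_on h U" "ideal_on U (\<lambda>z. g z - h z)"
    using assms unfolding SR_cong_iff by blast
  have "ideal_on U (vf_amb \<rho> m (\<lambda>z. g z - h z))"
    by (rule ideal_on_vf[OF U(5,1)]) (intro holo_on_diff U)
  hence "ideal_on U (\<lambda>z. vf_amb \<rho> m g z - vf_amb \<rho> m h z)"
  proof (rule ideal_on_cong)
    fix z assume z: "z \<in> U"
    have "vf_amb \<rho> m (\<lambda>z. g z + (-1) * h z) z = vf_amb \<rho> m g z + vf_amb \<rho> m (\<lambda>z. (-1) * h z) z"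
      by (rule vf_amb_add[OF U(3) holo_on_mult[OF holo_on_const U(4)] z])
    thus "vf_amb \<rho> m (\<lambda>z. g z - h z) z = vf_amb \<rho> m g z - vf_amb \<rho> m h z"
      using vf_amb_scale[OF U(4) z, of \<rho> m "-1"] by simp
  qed
  thus ?thesis using U holo_on_vf_amb[OF U(3,1)] holo_on_vf_amb[OF U(4,1)] unfolding SR_cong_iff by blast
qed

text \<open>The generators of the ideal vanish on \<open>X\<close>, so evaluation at a point of
  \<open>X\<close> is defined on classes of germs.\<close>

lemma SR_cong_eval: "cg x g h \<Longrightarrow> x \<in> X \<Longrightarrow> g x = h x"
proof -
  assume "cg x g h" and x: "x \<in> X"
  then obtain U a where "x \<in> U" "\<forall>z\<in>U. g z - h z = (\<Sum>S\<in>N. a S z * (\<Prod>i\<in>S. z $ i))"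
    unfolding SR_cong_iff ideal_on_def by blast
  hence "g x - h x = (\<Sum>S\<in>N. a S x * (\<Prod>i\<in>S. x $ i))" by blast
  also have "\<dots> = 0" by (rule sum.neutral) (simp add: nonface_monomial_zero[OF x])
  finally show ?thesis by simp
qed

lemma restr_eqI: "cg x g h \<Longrightarrow> rs g x = rs h x"
  unfolding restr_def using SR_cong_trans SR_cong_sym by blast

lemma in_restr: "open U \<Longrightarrow> x \<in> U \<Longrightarrow> holo_on g U \<Longrightarrow> g \<in> rs g x"
  unfolding restr_def using SR_cong_refl by blast

text \<open>
  A local decomposition by the support of the monomials: peeling off the coordinates one at a time
  writes \<open>g\<close> as a sum of monomials times functions of the coordinates in their support.
\<close>

lemma vanishing_in_ideal:
  assumes g: "holo_on g U" "open U" and x: "x \<in> U" and van: "\<And>z. z \<in> U \<Longrightarrow> z \<in> X \<Longrightarrow> g z = 0"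
  shows "\<exists>V. open V \<and> x \<in> V \<and> V \<subseteq> U \<and> ideal_on V g"
proof -
  \<comment> \<open>The coordinates in \<open>A\<close> are invertible near \<open>x\<close>; only
    the others have to be peeled off.\<close>
  define A where "A = {i. x $ i \<noteq> 0}"
  obtain B where B: "\<And>i. open (B i) \<and> x $ i \<in> B i" "\<And>y. (\<forall>i. y $ i \<in> B i) \<Longrightarrow> y \<in> U"
    using g(2) x unfolding open_vec_def by blast
  have "\<exists>e>0. ball (x $ i) e \<subseteq> B i \<and> (i \<in> A \<longrightarrow> 0 \<notin> ball (x $ i) e)" for i
  proof -
    obtain e where e: "e > 0" "ball (x $ i) e \<subseteq> B i" using B(1)[of i] by (meson openE)
    show ?thesis
    proof (cases "i \<in> A")
      case True
      thus ?thesis using e by (intro exI[of _ "min e (norm (x $ i))"]) (auto simp: A_def)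
    qed (use e in auto)
  qed
  then obtain d where d: "\<And>i. d i > 0" "\<And>i. ball (x $ i) (d i) \<subseteq> B i" "\<And>i. i \<in> A \<Longrightarrow> 0 \<notin> ball (x $ i) (d i)" by metis
  \<comment> \<open>A polydisc on which the coordinates in \<open>A\<close> have no zeros. It is
    convex and stable under setting coordinates outside \<open>A\<close> to zero, as
    \<open>divq\<close> requires.\<close>
  define V where "V = {z. \<forall>i. z $ i \<in> ball (x $ i) (d i)}"
  have "open V" unfolding V_def by (rule open_vector_box) auto
  moreover have "V \<subseteq> U" using B(2) d(2) unfolding V_def by blast
  moreover have "x \<in> V" using d(1) by (simp add: V_def)
  ultimately have V: "open V" "x \<in> V" "V \<subseteq> U" by auto
  have cV: "convex V"
  proof (rule convexI)
    fix y z and u v :: real assume "y \<in> V" "z \<in> V" "u \<ge> 0" "v \<ge> 0" "u + v = 1"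
    hence "u *\<^sub>R (y $ i) + v *\<^sub>R (z $ i) \<in> ball (x $ i) (d i)" for i
      by (intro convexD[OF convex_ball]) (auto simp: V_def)
    thus "u *\<^sub>R y + v *\<^sub>R z \<in> V" unfolding V_def by simp
  qed
  have prV: "pr T z \<in> V" if "A \<subseteq> T" "z \<in> V" for T z
    unfolding V_def
  proof (intro CollectI allI)
    fix i
    show "pr T z $ i \<in> ball (x $ i) (d i)"
    proof (cases "i \<in> T")
      case True
      thus ?thesis using that by (auto simp: V_def)
    next
      case False
      hence "x $ i = 0" using that by (auto simp: A_def)
      thus ?thesis using d(1)[of i] False by simp
    qed
  qed
  have shrink: "z - (of_real t * z $ i) *s axis i 1 \<in> V" if "z \<in> V" "t \<in> {0..1}" "i \<notin> A" for z i and t :: real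
  proof -
    have "z - (of_real t * z $ i) *s axis i 1 = (1 - t) *\<^sub>R z + t *\<^sub>R pr (- {i}) z"
      by (auto simp: vec_eq_iff axis_def scaleR_conv_of_real[where 'a=complex] algebra_simps)
    moreover have "pr (- {i}) z \<in> V" using that by (intro prV) auto
    ultimately show ?thesis using convexD_alt[OF cV that(1), of "pr (- {i}) z" t] that(2) by simp
  qed
  \<comment> \<open>\<open>S\<close> holds the coordinates already split off as a monomial,
    \<open>W\<close> those still to be treated. For empty \<open>W\<close>, either the monomial of
    \<open>S\<close> is a generator of the ideal or the hypothesis makes the term zero.\<close>
  have key: "ideal_on V (\<lambda>z. (\<Prod>i\<in>S. z $ i) * g (pr (S \<union> W) z))"
    if "finite W" "A \<subseteq> S" "S \<inter> W = {}" "holo_on g V"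
      "\<And>T z. T \<subseteq> W \<Longrightarrow> S \<union> T \<notin> N \<Longrightarrow> z \<in> V \<Longrightarrow> g (pr (S \<union> T) z) = 0" for W S g
    using that
  proof (induction W arbitrary: S g)
    case (empty S g)
    show ?case
    proof (cases "S \<in> N")
      case True
      thus ?thesis using empty prV by (auto intro!: ideal_on_monomial holo_on_pr)
    next
      case False
      thus ?thesis using empty by (intro ideal_on_cong[OF ideal_on_zero]) auto
    qed
  next
    case (insert i W S g)
    have i: "i \<notin> A" "i \<notin> S" "i \<notin> W" using insert.prems insert.hyps by auto
    let ?q = "divq (\<lambda>z. z $ i) (axis i 1) g"
    have q: "holo_on ?q V"
      by (rule holo_on_divq[OF insert.prems(3) V(1) V(1) cV clinear_form_nth]) (use shrink i in auto)
    have qm: "z $ i * ?q z = g z - g (z - z $ i *s axis i 1)" if "z \<in> V" for z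
      by (rule divq_mult[OF insert.prems(3) clinear_form_nth]) (use shrink i that in auto)
    have "ideal_on V (\<lambda>z. (\<Prod>i\<in>S. z $ i) * g (pr (S \<union> W) z))"
    proof (rule insert.IH[OF insert.prems(1) _ insert.prems(3)])
      show "S \<inter> W = {}" using insert.prems(2) by auto
      show "g (pr (S \<union> T) z) = 0" if "T \<subseteq> W" "S \<union> T \<notin> N" "z \<in> V" for T z
        using that by (intro insert.prems(4)) auto
    qed
    moreover have "ideal_on V (\<lambda>z. (\<Prod>i\<in>insert i S. z $ i) * ?q (pr (insert i S \<union> W) z))"
    proof (rule insert.IH)
      show "A \<subseteq> insert i S" "insert i S \<inter> W = {}" using insert.prems insert.hyps by auto
      show "holo_on ?q V" by (rule q)
      fix T z assume T: "T \<subseteq> W" "insert i S \<union> T \<notin> N" and z: "z \<in> V"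
      let ?y = "pr (insert i S \<union> T) z"
      \<comment> \<open>Where \<open>y $ i\<close> is nonzero, the quotient comes from a difference
        of two values that vanish by the hypothesis, for \<open>insert i T\<close> and for
        \<open>T\<close>. The points with \<open>y $ i = 0\<close> follow by
        \<open>zero_by_lines\<close>.\<close>
      have q0: "?q y = 0" if y: "y \<in> V" "pr (insert i S \<union> T) y = y" "y $ i \<noteq> 0" for y
      proof -
        have "g (pr (S \<union> insert i T) y) = 0" by (rule insert.prems(4)) (use T y in auto)
        moreover have "g (pr (S \<union> T) y) = 0"
        proof (rule insert.prems(4)[OF _ _ y(1)])
          show "T \<subseteq> insert i W" using T(1) by auto
          show "S \<union> T \<notin> N" using T(2) nonface_mono[of "S \<union> T" "insert i S \<union> T"] by blast
        qed
        moreover have "y - y $ i *s axis i 1 = pr (S \<union> T) y"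
        proof -
          have yj: "y $ j = 0" if "j \<notin> insert i S \<union> T" for j
            using arg_cong[OF y(2), of "\<lambda>v. v $ j"] that by simp
          have "i \<notin> S \<union> T" using T i by auto
          thus ?thesis using yj by (auto simp: axis_def vec_eq_iff)
        qed
        ultimately show ?thesis using qm[OF y(1)] y by simp
      qed
      have yV: "?y \<in> V" using insert.prems(1) z by (intro prV) auto
      show "?q ?y = 0"
      proof (rule zero_by_lines[OF holo_on_continuous_on[OF q] V(1) yV, of "{- ?y $ i}" "axis i 1"])
        fix t assume "t \<notin> {- ?y $ i}" "?y + t *s axis i 1 \<in> V"
        thus "?q (?y + t *s axis i 1) = 0"
          by (intro q0) (auto simp: vec_eq_iff axis_def add_eq_0_iff)
      qed simp
    qed
    ultimately have "ideal_on V (\<lambda>z. (\<Prod>i\<in>S. z $ i) * g (pr (S \<union> W) z) + (\<Prod>i\<in>insert i S. z $ i) * ?q (pr (insert i S \<union> W) z))"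
      by (rule ideal_on_add)
    thus ?case
    proof (rule ideal_on_cong)
      fix z assume z: "z \<in> V"
      let ?y = "pr (S \<union> insert i W) z"
      have "?y \<in> V" using insert.prems(1) z by (intro prV) auto
      from qm[OF this] have "z $ i * ?q ?y = g ?y - g (?y - z $ i *s axis i 1)" by simp
      also have "?y - z $ i *s axis i 1 = pr (S \<union> W) z" using i by (auto simp: vec_eq_iff axis_def)
      finally have q: "g (pr (S \<union> W) z) + z $ i * ?q ?y = g ?y" by simp
      have W: "insert i S \<union> W = S \<union> insert i W" by auto
      have P: "(\<Prod>i\<in>insert i S. z $ i) = (\<Prod>i\<in>S. z $ i) * z $ i" using i by simp
      show "(\<Prod>i\<in>S. z $ i) * g (pr (S \<union> W) z) + (\<Prod>i\<in>insert i S. z $ i) * ?q (pr (insert i S \<union> W) z)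
         = (\<Prod>i\<in>S. z $ i) * g ?y"
        unfolding W P mult.assoc distrib_left[symmetric] q ..
    qed
  qed
  have gV: "holo_on g V" by (rule holo_on_subset[OF g(1) V(3)])
  \<comment> \<open>The start of the peeling, with \<open>S = A\<close> and \<open>W = - A\<close>:
    the projection is the identity, and the monomial of \<open>A\<close> is invertible on
    \<open>V\<close>.\<close>
  have "ideal_on V (\<lambda>z. (\<Prod>i\<in>A. z $ i) * g (pr (A \<union> - A) z))"
  proof (rule key[OF _ order_refl _ gV])
    fix T z assume "A \<union> T \<notin> N" "z \<in> V"
    moreover from this obtain F where "F \<in> facets" "A \<union> T \<subseteq> F" using faces_iff by blast
    ultimately show "g (pr (A \<union> T) z) = 0"
      using prV[of "A \<union> T" z] V(3) by (intro van) (auto simp: coord_union_def)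
  qed auto
  moreover have nz: "(\<Prod>i\<in>A. z $ i) \<noteq> 0" if "z \<in> V" for z
  proof -
    have "z $ i \<in> ball (x $ i) (d i)" for i using that unfolding V_def by blast
    hence "z $ i \<noteq> 0" if "i \<in> A" for i using d(3)[OF that] by metis
    thus ?thesis by simp
  qed
  moreover have "holo_on (\<lambda>z. inverse (\<Prod>i\<in>A. z $ i)) V"
    by (intro holo_on_inverse holo_on_prod holo_on_nth nz)
  ultimately have "ideal_on V (\<lambda>z. inverse (\<Prod>i\<in>A. z $ i) * ((\<Prod>i\<in>A. z $ i) * g (pr (A \<union> - A) z)))"
    by (intro ideal_on_mult[where f = "\<lambda>z. inverse (\<Prod>i\<in>A. z $ i)"])
  hence "ideal_on V g"
  proof (rule ideal_on_cong)
    fix z assume "z \<in> V"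
    hence "(\<Prod>i\<in>A. z $ i) \<noteq> 0" by (rule nz)
    moreover have "pr (A \<union> - A) z = z" by (simp add: vec_eq_iff)
    ultimately show "inverse (\<Prod>i\<in>A. z $ i) * ((\<Prod>i\<in>A. z $ i) * g (pr (A \<union> - A) z)) = g z" by simp
  qed
  thus ?thesis using V by blast
qed

text \<open>The ideal contains every holomorphic germ that vanishes on \<open>X\<close>, so
  congruence can be tested on points of \<open>X\<close>. This is the reducedness of the analytic
  space.\<close>

lemma SR_congI:
  assumes "holo_on g U" "holo_on h U" "open U" "x \<in> U" "\<And>z. z \<in> U \<Longrightarrow> z \<in> X \<Longrightarrow> g z = h z"
  shows "cg x g h"
proof -
  have "holo_on (\<lambda>z. g z - h z) U" by (intro holo_on_diff assms)
  from vanishing_in_ideal[OF this assms(3,4)] obtain V where "open V" "x \<in> V" "V \<subseteq> U" "ideal_on V (\<lambda>z. g z - h z)"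
    using assms(5) by auto
  thus ?thesis using assms(1,2) unfolding SR_cong_iff by (meson holo_on_subset)
qed

lemma restr_eq_iff:
  assumes "holo_on g UNIV" "holo_on h UNIV"
  shows "rs g = rs h \<longleftrightarrow> (\<forall>z\<in>X. g z = h z)"
proof
  assume "rs g = rs h"
  hence "g \<in> rs h x" for x using in_restr[OF open_UNIV UNIV_I assms(1), of x] by simp
  thus "\<forall>z\<in>X. g z = h z" unfolding restr_def using SR_cong_eval by blast
next
  assume "\<forall>z\<in>X. g z = h z"
  hence "cg x g h" for x by (intro SR_congI[OF assms open_UNIV UNIV_I]) auto
  thus "rs g = rs h" by (intro ext restr_eqI)
qed

text \<open>
  Every section over \<open>X\<close> extends to an entire function: extend the values over the union of the
  coordinate subspaces, adding one subspace at a time.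
\<close>

lemma section_entire:
  assumes s: "s \<in> carrier (OX \<Sigma> \<rho>)"
  shows "\<exists>g. holo_on g UNIV \<and> s = rs g"
proof -
  have loc: "\<exists>U g. open U \<and> x \<in> U \<and> holo_on g U \<and> (\<forall>y\<in>U. s y = rs g y)" for x
    using s unfolding OX_def by simp
  \<comment> \<open>The value of the section at a point; on \<open>X\<close> it does not depend on
    the chosen representative.\<close>
  define v where "v = (\<lambda>x. (SOME h. h \<in> s x) x)"
  have v: "v y = g y" if "open U" "holo_on g U" "y \<in> U" "s y = rs g y" "y \<in> X" for U g y
  proof -
    have "g \<in> s y" using in_restr[OF that(1,3,2)] that(4) by simp
    hence "(SOME h. h \<in> s y) \<in> s y" by (rule someI[of "\<lambda>h. h \<in> s y"])
    thus ?thesis using that(4,5) SR_cong_eval unfolding v_def restr_def by simp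
  qed
  have vA: "holo_on (\<lambda>z. v (pr A z)) UNIV" if A: "A \<in> facets" for A
  proof (rule holo_on_local)
    fix z :: "complex ^ 'd"
    obtain U g where U: "open U" "pr A z \<in> U" "holo_on g U" "\<And>y. y \<in> U \<Longrightarrow> s y = rs g y" using loc[of "pr A z"] by blast
    have "continuous_on UNIV (pr A :: complex ^ 'd \<Rightarrow> complex ^ 'd)"
      by (simp add: continuous_at_imp_continuous_on has_derivative_continuous[OF has_derivative_pr])
    hence V: "open (pr A -` U)" using U(1) by (rule open_vimage[rotated])
    have "holo_on (\<lambda>z. g (pr A z)) (pr A -` U)" by (rule holo_on_pr[OF U(3)]) auto
    hence "holo_on (\<lambda>z. v (pr A z)) (pr A -` U)"
    proof (rule holo_on_cong[OF _ V])
      fix z :: "complex ^ 'd" assume z: "z \<in> pr A -` U"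
      have "pr A z \<in> X" using A by (auto simp: coord_union_def intro!: bexI[of _ A])
      thus "g (pr A z) = v (pr A z)"
        using v[OF U(1,3) _ U(4), of "pr A z"] z by simp
    qed
    thus "\<exists>V. z \<in> V \<and> holo_on (\<lambda>z. v (pr A z)) V" using U(2) by auto
  qed
  have "\<exists>g. holo_on g UNIV \<and> (\<forall>z\<in>coord_union E. g z = v z)" if "finite E" "E \<subseteq> facets" for E
    using that
  proof (induction E)
    case empty
    show ?case by (intro exI[of _ "\<lambda>_. 0"]) (auto simp: coord_union_def holo_on_const)
  next
    case (insert A E)
    then obtain g where g: "holo_on g UNIV" "\<And>z. z \<in> coord_union E \<Longrightarrow> g z = v z" by auto
    have A: "A \<in> facets" using insert.prems by simp
    show ?case
    \<comment> \<open>The correction repairs the values on the subspace of \<open>A\<close>. It is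
      zero on the earlier subspaces, because \<open>pr A\<close> maps each of them into
      itself.\<close>
    proof (intro exI[of _ "\<lambda>z. g z + (v (pr A z) - g (pr A z))"] conjI ballI)
      show "holo_on (\<lambda>z. g z + (v (pr A z) - g (pr A z))) UNIV"
        by (intro holo_on_add holo_on_diff g(1) vA[OF A] holo_on_pr[OF g(1)] UNIV_I)
      fix z assume z: "z \<in> coord_union (insert A E)"
      show "g z + (v (pr A z) - g (pr A z)) = v z"
      proof (cases "\<forall>i. i \<notin> A \<longrightarrow> z $ i = 0")
        case True
        hence "pr A z = z" by (auto simp: vec_eq_iff)
        thus ?thesis by simp
      next
        case False
        hence zE: "z \<in> coord_union E" using z by (auto simp: coord_union_def)
        then obtain B where "B \<in> E" "\<And>i. i \<notin> B \<Longrightarrow> z $ i = 0" by (auto simp: coord_union_def)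
        hence "pr A z \<in> coord_union E" by (auto simp: coord_union_def intro!: bexI[of _ B])
        thus ?thesis using g(2) zE by simp
      qed
    qed
  qed
  from this[OF finite_facets order_refl] obtain G where G: "holo_on G UNIV" "\<And>z. z \<in> X \<Longrightarrow> G z = v z" by blast
  have "s x = rs G x" for x
  proof -
    obtain U g where U: "open U" "x \<in> U" "holo_on g U" "\<And>y. y \<in> U \<Longrightarrow> s y = rs g y" using loc[of x] by blast
    have "cg x g G"
      by (rule SR_congI[OF U(3) holo_on_subset[OF G(1)] U(1,2)]) (use v[OF U(1,3) _ U(4)] G(2) in auto)
    thus ?thesis unfolding U(4)[OF U(2)] by (rule restr_eqI)
  qed
  thus ?thesis using G(1) by blast
qed

end


lemma holo_on_ctr:
  assumes "\<And>I. holo_on (g I) U"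
  shows "holo_on (\<lambda>z. ctr k (\<lambda>J. g J z) I) U"
  using holo_on_mult[OF holo_on_const assms] by (cases "k \<in> I") (simp_all add: ctr_def holo_on_const)

context projective_fan
begin

section \<open>The ring of global sections\<close>

abbreviation RX :: "'d sec ring" where "RX \<equiv> OX \<Sigma> \<rho>"

lemma rs_carrier: "holo_on g UNIV \<Longrightarrow> rs g \<in> carrier RX"
  unfolding OX_def by (auto intro!: exI[of _ UNIV] exI[of _ g])

lemma carrier_RX_E:
  assumes "s \<in> carrier RX"
  obtains g where "holo_on g UNIV" "s = rs g"
  using section_entire[OF assms] by blast

text \<open>Sum and product in \<open>OX\<close> collect the germs obtained from all pairs of
  representatives; compatibility with congruence reduces this to the pair \<open>g\<close>,
  \<open>h\<close>.\<close>

lemma rs_binop: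
  assumes "holo_on g UNIV" "holo_on h UNIV"
    and "\<And>x a b. cg x a g \<Longrightarrow> cg x b h \<Longrightarrow> cg x (\<lambda>z. f (a z) (b z)) (\<lambda>z. f (g z) (h z))"
  shows "(\<lambda>x. {k. \<exists>a\<in>rs g x. \<exists>b\<in>rs h x. cg x k (\<lambda>z. f (a z) (b z))}) = rs (\<lambda>z. f (g z) (h z))"
proof (rule ext, intro equalityI subsetI)
  fix x k assume "k \<in> {k. \<exists>a\<in>rs g x. \<exists>b\<in>rs h x. cg x k (\<lambda>z. f (a z) (b z))}"
  then obtain a b where "cg x a g" "cg x b h" "cg x k (\<lambda>z. f (a z) (b z))" unfolding restr_def by blast
  thus "k \<in> rs (\<lambda>z. f (g z) (h z)) x" unfolding restr_def using SR_cong_trans assms(3) by blast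
next
  fix x k assume "k \<in> rs (\<lambda>z. f (g z) (h z)) x"
  moreover have "g \<in> rs g x" "h \<in> rs h x" using in_restr[OF open_UNIV UNIV_I] assms by auto
  ultimately show "k \<in> {k. \<exists>a\<in>rs g x. \<exists>b\<in>rs h x. cg x k (\<lambda>z. f (a z) (b z))}"
    unfolding restr_def[of _ _ "\<lambda>z. f (g z) (h z)"] by blast
qed

lemma rs_add:
  assumes "holo_on g UNIV" "holo_on h UNIV"
  shows "rs g \<oplus>\<^bsub>RX\<^esub> rs h = rs (\<lambda>z. g z + h z)"
  unfolding OX_def using rs_binop[OF assms, of "(+)"] SR_cong_add by simp

lemma rs_mult:
  assumes "holo_on g UNIV" "holo_on h UNIV"
  shows "rs g \<otimes>\<^bsub>RX\<^esub> rs h = rs (\<lambda>z. g z * h z)"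
  unfolding OX_def using rs_binop[OF assms, of "(*)"] SR_cong_mult by simp

lemma rs_zero: "\<zero>\<^bsub>RX\<^esub> = rs (\<lambda>_. 0)"
  unfolding OX_def by simp

lemma RX_abelian_group: "abelian_group RX"
proof (rule abelian_groupI)
  show "\<zero>\<^bsub>RX\<^esub> \<in> carrier RX" unfolding rs_zero by (intro rs_carrier holo_on_const)
  fix s assume "s \<in> carrier RX"
  then obtain g where g: "holo_on g UNIV" "s = rs g" by (rule carrier_RX_E)
  show "\<zero>\<^bsub>RX\<^esub> \<oplus>\<^bsub>RX\<^esub> s = s" unfolding rs_zero g(2) by (simp add: rs_add[OF holo_on_const g(1)])
  show "\<exists>t\<in>carrier RX. t \<oplus>\<^bsub>RX\<^esub> s = \<zero>\<^bsub>RX\<^esub>"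
    unfolding rs_zero g(2)
    by (rule bexI[OF _ rs_carrier[OF holo_on_uminus[OF g(1)]]]) (simp add: rs_add[OF holo_on_uminus[OF g(1)] g(1)])
  fix t assume "t \<in> carrier RX"
  then obtain h where h: "holo_on h UNIV" "t = rs h" by (rule carrier_RX_E)
  show "s \<oplus>\<^bsub>RX\<^esub> t \<in> carrier RX"
    unfolding g(2) h(2) rs_add[OF g(1) h(1)] by (intro rs_carrier holo_on_add g(1) h(1))
  show "s \<oplus>\<^bsub>RX\<^esub> t = t \<oplus>\<^bsub>RX\<^esub> s"
    unfolding g(2) h(2) rs_add[OF g(1) h(1)] rs_add[OF h(1) g(1)] by (simp add: add.commute)
  fix u assume "u \<in> carrier RX"
  then obtain k where k: "holo_on k UNIV" "u = rs k" by (rule carrier_RX_E)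
  show "s \<oplus>\<^bsub>RX\<^esub> t \<oplus>\<^bsub>RX\<^esub> u = s \<oplus>\<^bsub>RX\<^esub> (t \<oplus>\<^bsub>RX\<^esub> u)"
    unfolding g(2) h(2) k(2)
    by (simp add: rs_add g(1) h(1) k(1) holo_on_add add.assoc)
qed

lemma rs_neg:
  assumes "holo_on g UNIV"
  shows "\<ominus>\<^bsub>RX\<^esub> rs g = rs (\<lambda>z. - g z)"
proof -
  interpret RX: abelian_group RX by (rule RX_abelian_group)
  show ?thesis
    by (rule RX.minus_equality)
       (simp_all add: rs_add[OF holo_on_uminus[OF assms] assms] rs_zero rs_carrier assms holo_on_uminus)
qed

lemma rs_finsum:
  assumes "finite K" "\<And>k. holo_on (g k) UNIV"
  shows "(\<Oplus>\<^bsub>RX\<^esub>k\<in>K. rs (g k)) = rs (\<lambda>z. \<Sum>k\<in>K. g k z)"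
proof -
  interpret RX: abelian_group RX by (rule RX_abelian_group)
  show ?thesis
    using assms(1)
  proof (induction K rule: finite_induct)
    case (insert k K)
    have "(\<Oplus>\<^bsub>RX\<^esub>k\<in>insert k K. rs (g k)) = rs (g k) \<oplus>\<^bsub>RX\<^esub> (\<Oplus>\<^bsub>RX\<^esub>k\<in>K. rs (g k))"
      by (rule RX.finsum_insert) (use insert assms(2) in \<open>auto intro: rs_carrier\<close>)
    also have "\<dots> = rs (\<lambda>z. g k z + (\<Sum>k\<in>K. g k z))"
      unfolding insert.IH by (intro rs_add holo_on_sum assms(2))
    finally show ?case using insert.hyps by simp
  qed (simp add: rs_zero)
qed

lemma vf_rs:
  assumes g: "holo_on g UNIV"
  shows "vf \<Sigma> \<rho> m (rs g) = rs (vf_amb \<rho> m g)"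
  unfolding vf_def
proof (rule ext, intro equalityI subsetI)
  fix x k assume "k \<in> {h. \<exists>g'\<in>rs g x. cg x h (vf_amb \<rho> m g')}"
  then obtain g' where "cg x g' g" "cg x k (vf_amb \<rho> m g')" unfolding restr_def by blast
  thus "k \<in> rs (vf_amb \<rho> m g) x" unfolding restr_def using SR_cong_trans SR_cong_vf by blast
next
  fix x k assume "k \<in> rs (vf_amb \<rho> m g) x"
  moreover have "g \<in> rs g x" using in_restr[OF open_UNIV UNIV_I] g by auto
  ultimately show "k \<in> {h. \<exists>g'\<in>rs g x. cg x h (vf_amb \<rho> m g')}"
    unfolding restr_def[of _ _ "vf_amb \<rho> m g"] by blast
qed

definition rsf :: "('n set \<Rightarrow> complex ^ 'd \<Rightarrow> complex) \<Rightarrow> ('n, 'd) pvec" where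
  "rsf g = (\<lambda>I. rs (g I))"

end

section \<open>Log polyvector fields\<close>

locale lg_model = projective_fan \<Sigma> \<psi> \<rho>
  for \<Sigma> :: "(real, 'n::{finite,linorder}) vec set set" and \<psi> and \<rho> :: "'d::finite \<Rightarrow> (int, 'n) vec" +
  fixes b :: "'n \<Rightarrow> 'd" and e :: "'n \<Rightarrow> (int, 'n) vec \<Rightarrow> int"
  assumes basis: "lattice_basis (\<lambda>k. \<rho> (b k))" and dual: "dual_basis (\<lambda>k. \<rho> (b k)) e"
begin

abbreviation Th :: "int \<Rightarrow> (complex, ('n, 'd) pvec) module" where "Th \<equiv> Theta \<Sigma> \<rho>"

lemma entire_formsD: "g \<in> entire_forms i \<Longrightarrow> holo_on (g I) UNIV"
  "g \<in> entire_forms i \<Longrightarrow> int (card I) \<noteq> i \<Longrightarrow> g I = (\<lambda>_. 0)"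
  unfolding entire_forms_def by auto

lemma rsf_carrier: "g \<in> entire_forms i \<Longrightarrow> rsf g \<in> carrier (Th i)"
  unfolding Theta_def by (auto simp: rsf_def rs_zero intro!: rs_carrier entire_formsD(1) dest: entire_formsD(2))

lemma carrier_Theta_E:
  assumes "x \<in> carrier (Th i)"
  obtains g where "g \<in> entire_forms i" "x = rsf g"
proof -
  have x: "x I \<in> carrier RX" "int (card I) \<noteq> i \<Longrightarrow> x I = rs (\<lambda>_. 0)" for I
    using assms by (auto simp: Theta_def rs_zero)
  have "\<forall>I. \<exists>g. holo_on g UNIV \<and> x I = rs g" using section_entire[OF x(1)] by blast
  then obtain g where g: "\<And>I. holo_on (g I) UNIV" "\<And>I. x I = rs (g I)" by metis
  \<comment> \<open>A representative of the zero section may be nonzero off \<open>X\<close>, so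
    components of the wrong degree are reset.\<close>
  define h where "h = (\<lambda>I. if int (card I) = i then g I else (\<lambda>_. 0))"
  have "h \<in> entire_forms i" unfolding entire_forms_def h_def using g(1) by (auto intro: holo_on_const)
  moreover have "x = rsf h" using x(2) g(2) by (auto simp: rsf_def h_def)
  ultimately show ?thesis by (rule that)
qed

lemma Theta_zero: "\<zero>\<^bsub>Th i\<^esub> = rsf (\<lambda>_ _. 0)"
  by (simp add: Theta_def rsf_def rs_zero)

lemma Theta_add:
  assumes "g \<in> entire_forms i" "h \<in> entire_forms j"
  shows "rsf g \<oplus>\<^bsub>Th k\<^esub> rsf h = rsf (\<lambda>I z. g I z + h I z)"
  using assms by (simp add: Theta_def rsf_def rs_add entire_formsD(1))

lemma Theta_smult:
  assumes "g \<in> entire_forms i"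
  shows "c \<odot>\<^bsub>Th k\<^esub> rsf g = rsf (\<lambda>I z. c * g I z)"
  using assms by (simp add: Theta_def rsf_def rs_mult holo_on_const entire_formsD(1))

lemma scale_entire_forms: "g \<in> entire_forms i \<Longrightarrow> (\<lambda>I z. c * g I z) \<in> entire_forms i"
  unfolding entire_forms_def by (auto intro!: holo_on_mult holo_on_const)

lemma rsf_eq_iff:
  assumes "g \<in> entire_forms i" "h \<in> entire_forms j"
  shows "rsf g = rsf h \<longleftrightarrow> (\<forall>I. \<forall>z\<in>X. g I z = h I z)"
  using restr_eq_iff[OF entire_formsD(1)[OF assms(1)] entire_formsD(1)[OF assms(2)]]
  by (auto simp: rsf_def fun_eq_iff)

lemma vspace_Theta: "vspace (Th i)"
proof (intro vspace.intro smodule.intro vspace_axioms.intro smodule_axioms.intro abelian_groupI)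
  show "\<zero>\<^bsub>Th i\<^esub> \<in> carrier (Th i)" unfolding Theta_zero by (intro rsf_carrier zero_entire_forms)
  fix x a assume "x \<in> carrier (Th i)"
  then obtain g where g: "g \<in> entire_forms i" and x: "x = rsf g" by (rule carrier_Theta_E)
  note gs = scale_entire_forms[OF g]
  show "a \<odot>\<^bsub>Th i\<^esub> x \<in> carrier (Th i)" unfolding x Theta_smult[OF g] by (intro rsf_carrier gs)
  show "\<zero>\<^bsub>Th i\<^esub> \<oplus>\<^bsub>Th i\<^esub> x = x"
    unfolding x Theta_zero by (simp add: Theta_add[OF zero_entire_forms g])
  have "rsf (\<lambda>I z. (-1) * g I z) \<oplus>\<^bsub>Th i\<^esub> x = \<zero>\<^bsub>Th i\<^esub>"
    unfolding x Theta_zero Theta_add[OF gs g] by simp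
  thus "\<exists>y\<in>carrier (Th i). y \<oplus>\<^bsub>Th i\<^esub> x = \<zero>\<^bsub>Th i\<^esub>" using rsf_carrier[OF gs] by blast
  show "1 \<odot>\<^bsub>Th i\<^esub> x = x" unfolding x Theta_smult[OF g] by simp
  show "(a + b) \<odot>\<^bsub>Th i\<^esub> x = a \<odot>\<^bsub>Th i\<^esub> x \<oplus>\<^bsub>Th i\<^esub> b \<odot>\<^bsub>Th i\<^esub> x" for b
    unfolding x Theta_smult[OF g] Theta_add[OF gs gs] by (simp add: distrib_right)
  show "(a * b) \<odot>\<^bsub>Th i\<^esub> x = a \<odot>\<^bsub>Th i\<^esub> (b \<odot>\<^bsub>Th i\<^esub> x)" for b
    unfolding x Theta_smult[OF g] Theta_smult[OF gs] by (simp add: mult.assoc)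
  fix y assume "y \<in> carrier (Th i)"
  then obtain h where h: "h \<in> entire_forms i" and y: "y = rsf h" by (rule carrier_Theta_E)
  note hs = scale_entire_forms[OF h] and gh = add_entire_forms[OF g h]
  show "x \<oplus>\<^bsub>Th i\<^esub> y \<in> carrier (Th i)" unfolding x y Theta_add[OF g h] by (intro rsf_carrier gh)
  show "x \<oplus>\<^bsub>Th i\<^esub> y = y \<oplus>\<^bsub>Th i\<^esub> x"
    unfolding x y Theta_add[OF g h] Theta_add[OF h g] by (simp add: add.commute)
  show "a \<odot>\<^bsub>Th i\<^esub> (x \<oplus>\<^bsub>Th i\<^esub> y) = a \<odot>\<^bsub>Th i\<^esub> x \<oplus>\<^bsub>Th i\<^esub> a \<odot>\<^bsub>Th i\<^esub> y"
    unfolding x y Theta_add[OF g h] Theta_smult[OF gh] Theta_smult[OF g] Theta_smult[OF h] Theta_add[OF gs hs]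
    by (simp add: distrib_left)
  fix w assume "w \<in> carrier (Th i)"
  then obtain k where k: "k \<in> entire_forms i" and w: "w = rsf k" by (rule carrier_Theta_E)
  show "x \<oplus>\<^bsub>Th i\<^esub> y \<oplus>\<^bsub>Th i\<^esub> w = x \<oplus>\<^bsub>Th i\<^esub> (y \<oplus>\<^bsub>Th i\<^esub> w)"
    unfolding x y w Theta_add[OF g h] Theta_add[OF h k] Theta_add[OF gh k] Theta_add[OF g add_entire_forms[OF h k]]
    by (simp add: add.assoc)
qed

text \<open>\<open>lam k\<close> is \<open>\<theta>\<^sub>k(f)\<close>.\<close>

definition lam :: "'n \<Rightarrow> complex ^ 'd \<Rightarrow> complex" where
  "lam k z = (\<Sum>i\<in>UNIV. of_int (e k (\<rho> i)) * z $ i)"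

lemma clinear_form_lam: "clinear_form (lam k)"
  unfolding clinear_form_def lam_def by (rule exI[of _ "\<lambda>i. of_int (e k (\<rho> i))"]) simp

lemma holo_on_lam: "holo_on (lam k) U"
  by (rule clinear_form_holo[OF clinear_form_lam])

lemma vf_superpotential: "vf \<Sigma> \<rho> (e k) (superpotential \<Sigma> \<rho>) = rs (lam k)"
proof -
  have h: "holo_on (\<lambda>z::complex ^ 'd. \<Sum>i\<in>UNIV. z $ i) UNIV" by (intro holo_on_sum holo_on_nth)
  have "vf_amb \<rho> (e k) (\<lambda>z. \<Sum>i\<in>UNIV. z $ i) z = lam k z" for z
    using vf_amb_sum[of UNIV "\<lambda>(i::'d) (z::complex ^ 'd). z $ i" UNIV z \<rho> "e k"] by (simp add: holo_on_nth vf_amb_nth lam_def)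
  hence "vf_amb \<rho> (e k) (\<lambda>z. \<Sum>i\<in>UNIV. z $ i) = lam k" by auto
  thus ?thesis unfolding superpotential_def vf_rs[OF h] by simp
qed

lemma ddtheta_rsf:
  assumes "\<And>I. holo_on (g I) UNIV"
  shows "ddtheta \<Sigma> \<rho> k (rsf g) I = rs (\<lambda>z. ctr k (\<lambda>J. g J z) I)"
  using assms by (simp add: ddtheta_def rsf_def ctr_def sg_def rs_zero rs_neg minus_one_power_iff)

section \<open>The two operators on entire coefficients\<close>

text \<open>\<open>br\<close> and \<open>bva\<close> lift \<open>bracket_f\<close> and
  \<open>bv\<close> to entire coefficients on the ambient space; the identities of a mixed complex
  hold already there, before restriction to \<open>X\<close>.\<close>

definition br :: "('n set \<Rightarrow> complex ^ 'd \<Rightarrow> complex) \<Rightarrow> 'n set \<Rightarrow> complex ^ 'd \<Rightarrow> complex" where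
  "br g = (\<lambda>I z. koszul lam g I z)"

definition bva :: "('n set \<Rightarrow> complex ^ 'd \<Rightarrow> complex) \<Rightarrow> 'n set \<Rightarrow> complex ^ 'd \<Rightarrow> complex" where
  "bva g = (\<lambda>I z. \<Sum>k\<in>UNIV. vf_amb \<rho> (e k) (\<lambda>z. ctr k (\<lambda>J. g J z) I) z)"

lemma bracket_rsf:
  assumes "\<And>I. holo_on (g I) UNIV"
  shows "bracket_f \<Sigma> \<rho> e (rsf g) = rsf (br g)"
proof
  fix I
  have c: "holo_on (\<lambda>z. ctr k (\<lambda>J. g J z) I) UNIV" for k by (rule holo_on_ctr[OF assms])
  have "bracket_f \<Sigma> \<rho> e (rsf g) I = (\<Oplus>\<^bsub>RX\<^esub>k\<in>UNIV. rs (\<lambda>z. lam k z * ctr k (\<lambda>J. g J z) I))"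
    unfolding bracket_f_def vf_superpotential ddtheta_rsf[OF assms] rs_mult[OF holo_on_lam c] ..
  also have "\<dots> = rs (br g I)"
    unfolding br_def contr_def by (rule rs_finsum) (auto intro!: holo_on_mult holo_on_lam c)
  finally show "bracket_f \<Sigma> \<rho> e (rsf g) I = rsf (br g) I" by (simp add: rsf_def)
qed

lemma bv_rsf:
  assumes "\<And>I. holo_on (g I) UNIV"
  shows "bv \<Sigma> \<rho> e (rsf g) = rsf (bva g)"
proof
  fix I
  have c: "holo_on (\<lambda>z. ctr k (\<lambda>J. g J z) I) UNIV" for k by (rule holo_on_ctr[OF assms])
  have "bv \<Sigma> \<rho> e (rsf g) I = (\<Oplus>\<^bsub>RX\<^esub>k\<in>UNIV. rs (vf_amb \<rho> (e k) (\<lambda>z. ctr k (\<lambda>J. g J z) I)))"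
    unfolding bv_def ddtheta_rsf[OF assms] vf_rs[OF c] ..
  also have "\<dots> = rs (bva g I)"
    unfolding bva_def by (rule rs_finsum) (auto intro!: holo_on_vf_amb c)
  finally show "bv \<Sigma> \<rho> e (rsf g) I = rsf (bva g) I" by (simp add: rsf_def)
qed

lemma br_entire: "g \<in> entire_forms i \<Longrightarrow> br g \<in> entire_forms (i - 1)"
  unfolding br_def by (rule contr_entire_forms[OF holo_on_lam])

lemma bva_entire:
  assumes g: "g \<in> entire_forms i"
  shows "bva g \<in> entire_forms (i - 1)"
  unfolding entire_forms_def
proof (intro CollectI conjI allI impI)
  show "holo_on (bva g I) UNIV" for I
    unfolding bva_def by (intro holo_on_sum holo_on_vf_amb holo_on_ctr entire_formsD(1)[OF g] open_UNIV)
  fix I :: "'n set" assume I: "int (card I) \<noteq> i - 1"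
  have "ctr k (\<lambda>J. g J z) I = 0" for k z
  proof (cases "k \<in> I")
    case False
    hence "int (card (insert k I)) \<noteq> i" using I by simp
    hence "g (insert k I) = (\<lambda>_. 0)" by (rule entire_formsD(2)[OF g])
    thus ?thesis by (simp add: ctr_def)
  qed (simp add: ctr_def)
  thus "bva g I = (\<lambda>_. 0)" by (simp add: bva_def vf_amb_const)
qed

lemma bva_add:
  assumes "g \<in> entire_forms i" "h \<in> entire_forms j"
  shows "bva (\<lambda>I z. g I z + h I z) I z = bva g I z + bva h I z"
  unfolding bva_def ctr_add
  by (simp add: vf_amb_add[of _ UNIV] holo_on_ctr entire_formsD(1)[OF assms(1)] entire_formsD(1)[OF assms(2)] sum.distrib)

lemma bva_scale:
  assumes "g \<in> entire_forms i"
  shows "bva (\<lambda>I z. c * g I z) I z = c * bva g I z"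
  unfolding bva_def ctr_scale
  by (simp add: vf_amb_scale[of _ UNIV] holo_on_ctr entire_formsD(1)[OF assms] sum_distrib_left)

lemma ctr_vf_amb:
  assumes "\<And>I. holo_on (g I) UNIV"
  shows "ctr k (\<lambda>J. vf_amb \<rho> m (g J) z) I = vf_amb \<rho> m (\<lambda>z. ctr k (\<lambda>J. g J z) I) z"
  using vf_amb_scale[OF assms UNIV_I, where \<rho> = \<rho> and m = m]
  by (cases "k \<in> I") (simp_all add: ctr_def vf_amb_const)

lemma ctr_bva:
  assumes g: "\<And>I. holo_on (g I) UNIV"
  shows "ctr k (\<lambda>J. bva g J z) I = (\<Sum>l\<in>UNIV. vf_amb \<rho> (e l) (\<lambda>z. ctr k (ctr l (\<lambda>J. g J z)) I) z)"
  unfolding bva_def ctr_sum by (subst ctr_vf_amb) (rule holo_on_ctr[OF g], rule refl)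

lemma holo_on_ctr_ctr:
  assumes "\<And>I. holo_on (g I) U"
  shows "holo_on (\<lambda>z. ctr k (ctr l (\<lambda>J. g J z)) I) U"
  using holo_on_ctr[of "\<lambda>I z. ctr l (\<lambda>J. g J z) I", OF holo_on_ctr[OF assms]] .

lemma vf_amb_neg: "holo_on g UNIV \<Longrightarrow> vf_amb \<rho> m (\<lambda>z. - g z) z = - vf_amb \<rho> m g z"
  using vf_amb_scale[of g UNIV z \<rho> m "-1"] by simp

lemma vf_ctr_antisym:
  assumes "\<And>I. holo_on (g I) UNIV"
  shows "vf_amb \<rho> m (\<lambda>z. ctr k (ctr l (\<lambda>J. g J z)) I) z = - vf_amb \<rho> m (\<lambda>z. ctr l (ctr k (\<lambda>J. g J z)) I) z"
proof -
  have "(\<lambda>z. ctr k (ctr l (\<lambda>J. g J z)) I) = (\<lambda>z. - ctr l (ctr k (\<lambda>J. g J z)) I)"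
    using ctr_anticommute by blast
  thus ?thesis by (simp add: vf_amb_neg[OF holo_on_ctr_ctr[OF assms]])
qed

text \<open>Commuting vector fields are paired with anticommuting contractions, so the double sum is
  antisymmetric.\<close>

lemma bva_bva:
  assumes "g \<in> entire_forms i"
  shows "bva (bva g) I z = 0"
proof -
  note g = entire_formsD(1)[OF assms]
  have "bva (bva g) I z = (\<Sum>k\<in>UNIV. \<Sum>l\<in>UNIV. vf_amb \<rho> (e k) (vf_amb \<rho> (e l) (\<lambda>z. ctr k (ctr l (\<lambda>J. g J z)) I)) z)"
    unfolding bva_def[of "bva g"] ctr_bva[OF g]
    by (intro sum.cong refl vf_amb_sum[of _ _ UNIV] holo_on_vf_amb holo_on_ctr_ctr g open_UNIV UNIV_I)
  also have "\<dots> = 0"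
  proof (rule antisymmetric_double_sum)
    fix k l
    have "vf_amb \<rho> (e k) (vf_amb \<rho> (e l) (\<lambda>z. ctr k (ctr l (\<lambda>J. g J z)) I)) z =
       vf_amb \<rho> (e k) (\<lambda>z. - vf_amb \<rho> (e l) (\<lambda>z. ctr l (ctr k (\<lambda>J. g J z)) I) z) z"
      by (rule arg_cong[where f = "\<lambda>F. vf_amb \<rho> (e k) F z"]) (rule ext, rule vf_ctr_antisym[OF g])
    also have "\<dots> = - vf_amb \<rho> (e k) (vf_amb \<rho> (e l) (\<lambda>z. ctr l (ctr k (\<lambda>J. g J z)) I)) z"
      by (rule vf_amb_neg) (intro holo_on_vf_amb holo_on_ctr_ctr g open_UNIV)
    also have "\<dots> = - vf_amb \<rho> (e l) (vf_amb \<rho> (e k) (\<lambda>z. ctr l (ctr k (\<lambda>J. g J z)) I)) z"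
      by (subst vf_amb_commute[of _ UNIV]) (auto intro: holo_on_ctr_ctr g)
    finally show "vf_amb \<rho> (e k) (vf_amb \<rho> (e l) (\<lambda>z. ctr k (ctr l (\<lambda>J. g J z)) I)) z =
        - vf_amb \<rho> (e l) (vf_amb \<rho> (e k) (\<lambda>z. ctr l (ctr k (\<lambda>J. g J z)) I)) z" .
  qed
  finally show ?thesis .
qed

text \<open>The result is symmetric in \<open>k\<close> and \<open>l\<close>, which is what
  \<open>br_bva\<close> rests on.\<close>

lemma vf_amb_lam: "vf_amb \<rho> (e l) (lam k) z = (\<Sum>i\<in>UNIV. of_int (e k (\<rho> i)) * of_int (e l (\<rho> i)) * z $ i)"
proof -
  have "lam k = (\<lambda>z. \<Sum>i\<in>UNIV. of_int (e k (\<rho> i)) * z $ i)" by (simp add: lam_def fun_eq_iff)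
  hence "vf_amb \<rho> (e l) (lam k) z = (\<Sum>i\<in>UNIV. vf_amb \<rho> (e l) (\<lambda>z. of_int (e k (\<rho> i)) * z $ i) z)"
    using vf_amb_sum[of UNIV "\<lambda>(i::'d) (z::complex ^ 'd). of_int (e k (\<rho> i)) * z $ i" UNIV z \<rho> "e l"]
    by (simp add: holo_on_mult holo_on_const holo_on_nth)
  also have "\<dots> = (\<Sum>i\<in>UNIV. of_int (e k (\<rho> i)) * of_int (e l (\<rho> i)) * z $ i)"
    using vf_amb_scale[OF holo_on_nth UNIV_I, of \<rho> "e l"] by (simp add: vf_amb_nth mult.assoc)
  finally show ?thesis .
qed

text \<open>By the product rule, the terms that differentiate the coefficients of \<open>g\<close>
  cancel through antisymmetry of the contractions. What remains pairs the symmetric functions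
  \<open>vf_amb \<rho> (e l) (lam k)\<close> with antisymmetric double contractions.\<close>

lemma br_bva:
  assumes "g \<in> entire_forms i"
  shows "br (bva g) I z + bva (br g) I z = 0"
proof -
  note g = entire_formsD(1)[OF assms]
  let ?c = "\<lambda>k l z. ctr k (ctr l (\<lambda>J. g J z)) I"
  have 1: "br (bva g) I z = (\<Sum>k\<in>UNIV. \<Sum>l\<in>UNIV. lam k z * vf_amb \<rho> (e l) (?c k l) z)"
    unfolding br_def contr_def ctr_bva[OF g] by (simp add: sum_distrib_left)
  have "bva (br g) I z = (\<Sum>l\<in>UNIV. vf_amb \<rho> (e l) (\<lambda>z. \<Sum>k\<in>UNIV. lam k z * ?c l k z) z)"
    unfolding bva_def br_def contr_def[abs_def] ctr_sum ctr_scale ..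
  also have "\<dots> = (\<Sum>l\<in>UNIV. \<Sum>k\<in>UNIV. vf_amb \<rho> (e l) (\<lambda>z. lam k z * ?c l k z) z)"
    by (intro sum.cong refl vf_amb_sum[of _ _ UNIV] holo_on_mult holo_on_lam holo_on_ctr_ctr g UNIV_I)
  also have "\<dots> = (\<Sum>l\<in>UNIV. \<Sum>k\<in>UNIV. lam k z * vf_amb \<rho> (e l) (?c l k) z + vf_amb \<rho> (e l) (lam k) z * ?c l k z)"
    by (intro sum.cong refl vf_amb_mult[of _ UNIV] holo_on_lam holo_on_ctr_ctr g UNIV_I)
  also have "\<dots> = (\<Sum>l\<in>UNIV. \<Sum>k\<in>UNIV. lam k z * vf_amb \<rho> (e l) (?c l k) z) +
      (\<Sum>l\<in>UNIV. \<Sum>k\<in>UNIV. vf_amb \<rho> (e l) (lam k) z * ?c l k z)"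
    by (simp add: sum.distrib)
  also have "(\<Sum>l\<in>UNIV. \<Sum>k\<in>UNIV. vf_amb \<rho> (e l) (lam k) z * ?c l k z) = 0"
  proof (rule antisymmetric_double_sum)
    fix l k
    have "vf_amb \<rho> (e l) (lam k) z = vf_amb \<rho> (e k) (lam l) z" by (simp add: vf_amb_lam mult_ac)
    thus "vf_amb \<rho> (e l) (lam k) z * ?c l k z = - (vf_amb \<rho> (e k) (lam l) z * ?c k l z)"
      using ctr_anticommute[of l k] by simp
  qed
  also have "(\<Sum>l\<in>UNIV. \<Sum>k\<in>UNIV. lam k z * vf_amb \<rho> (e l) (?c l k) z) = - br (bva g) I z"
  proof -
    have "lam k z * vf_amb \<rho> (e l) (?c l k) z = - (lam k z * vf_amb \<rho> (e l) (?c k l) z)" for k l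
      by (subst vf_ctr_antisym[OF g]) simp
    thus ?thesis unfolding 1 by (subst sum.swap) (simp add: sum_negf)
  qed
  finally show ?thesis by simp
qed

text \<open>\<open>dual_basis\<close> asks for additivity, which over the integers is
  linearity.\<close>

lemma e_sum_smult: "e k (\<Sum>j\<in>J. c j *s v j) = (\<Sum>j\<in>J. c j * e k (v j))"
proof -
  have add: "e k (x + y) = e k x + e k y" for x y using dual unfolding dual_basis_def by blast
  have zero: "e k 0 = 0" using add[of 0 0] by simp
  have smult: "e k (a *s x) = a * e k x" for a x
  proof (induction a rule: int_induct[where k = 0])
    case base
    show ?case by (simp add: zero)
  next
    case (step1 a)
    thus ?case by (simp add: vector_sadd_rdistrib add distrib_right)
  next
    case (step2 a)
    have "a *s x = (a - 1) *s x + x" by (simp add: vec_eq_iff algebra_simps)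
    thus ?case using step2 add[of "(a - 1) *s x" x] by (simp add: left_diff_distrib)
  qed
  show ?thesis
    by (induction J rule: infinite_finite_induct) (auto simp: zero add smult)
qed

text \<open>\<open>lam k\<close> at a vector with integer entries \<open>v\<^sub>i\<close> is
  \<open>e k\<close> at the lattice vector \<open>\<Sum> v\<^sub>i \<rho>\<^sub>i\<close>. The
  \<open>\<rho> i\<close> with \<open>i \<in> A\<close> form a lattice basis, so the integer
  coordinates of \<open>\<rho> (b l)\<close> in it give the dual vectors.\<close>

lemma lam_dual_on_facet:
  assumes A: "A \<in> facets"
  shows "\<exists>v :: 'n \<Rightarrow> complex ^ 'd. (\<forall>k l. lam k (v l) = (if k = l then 1 else 0)) \<and> (\<forall>l i. i \<notin> A \<longrightarrow> v l $ i = 0)"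
proof -
  obtain a where a: "A = range a" "lattice_basis (\<lambda>k. \<rho> (a k))" "inj a" using facetsE[OF A] by metis
  have "\<exists>c. \<rho> (b l) = (\<Sum>j\<in>UNIV. c j *s \<rho> (a j))" for l using a(2) unfolding lattice_basis_def by blast
  then obtain c where c: "\<And>l. \<rho> (b l) = (\<Sum>j\<in>UNIV. c l j *s \<rho> (a j))" by metis
  define v :: "'n \<Rightarrow> complex ^ 'd" where "v l = (\<chi> i. if i \<in> A then of_int (c l (inv_into UNIV a i)) else 0)" for l
  have "lam k (v l) = (if k = l then 1 else 0)" for k l
  proof -
    have "lam k (v l) = (\<Sum>i\<in>A. of_int (e k (\<rho> i)) * v l $ i)"
      unfolding lam_def by (rule sum.mono_neutral_right) (auto simp: v_def)
    also have "\<dots> = (\<Sum>j\<in>UNIV. of_int (e k (\<rho> (a j))) * of_int (c l j))"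
      unfolding a(1) sum.reindex[OF a(3)] by (rule sum.cong) (auto simp: v_def a(1) inv_into_f_f[OF a(3)])
    also have "\<dots> = of_int (\<Sum>j\<in>UNIV. c l j * e k (\<rho> (a j)))" by (simp add: mult.commute)
    also have "(\<Sum>j\<in>UNIV. c l j * e k (\<rho> (a j))) = e k (\<rho> (b l))" unfolding c e_sum_smult ..
    also have "\<dots> = (if k = l then 1 else 0)" using dual unfolding dual_basis_def by blast
    finally show ?thesis by simp
  qed
  thus ?thesis by (intro exI[of _ v]) (auto simp: v_def)
qed

text \<open>Fan geometry and analysis meet here: \<open>shelling\<close> and
  \<open>lam_dual_on_facet\<close> supply the hypotheses of \<open>koszul_shelling\<close>, and
  equality of sections is equality of entire lifts on \<open>X\<close>.\<close>

lemma koszul_exact: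
  assumes i: "i \<ge> 1" and x: "x \<in> carrier (Th i)" and zero: "bracket_f \<Sigma> \<rho> e x = \<zero>\<^bsub>Th (i - 1)\<^esub>"
  shows "\<exists>y\<in>carrier (Th (i + 1)). bracket_f \<Sigma> \<rho> e y = x"
proof -
  obtain g where g: "g \<in> entire_forms i" "x = rsf g" using x by (rule carrier_Theta_E)
  have "rsf (br g) = rsf (\<lambda>_ _. 0)" using zero unfolding g(2) Theta_zero bracket_rsf[OF entire_formsD(1)[OF g(1)]] .
  hence "\<forall>I. \<forall>z\<in>X. br g I z = 0"
    unfolding rsf_eq_iff[OF br_entire[OF g(1)] zero_entire_forms] .
  hence cyc: "koszul lam g I z = 0" if "z \<in> X" for z I
    using that by (simp add: br_def)
  obtain w :: "'d set \<Rightarrow> real" and r where sh: "inj_on w facets" "\<And>A. A \<in> facets \<Longrightarrow> r A \<subseteq> A"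
    "\<And>A A'. A \<in> facets \<Longrightarrow> A' \<in> facets \<Longrightarrow> w A' < w A \<Longrightarrow> \<not> r A \<subseteq> A'"
    "\<And>A i. A \<in> facets \<Longrightarrow> i \<in> r A \<Longrightarrow> \<exists>A'\<in>facets. w A' < w A \<and> A - {i} \<subseteq> A'"
    using shelling by metis
  obtain h where h: "h \<in> entire_forms (i + 1)" "\<And>I z. z \<in> X \<Longrightarrow> koszul lam h I z = g I z"
    using koszul_shelling[OF clinear_form_lam lam_dual_on_facet sh g(1) i cyc] by blast
  have "br h \<in> entire_forms i" using br_entire[OF h(1)] by simp
  hence "rsf (br h) = rsf g" using h(2) by (simp add: rsf_eq_iff[OF _ g(1)] br_def)
  hence "bracket_f \<Sigma> \<rho> e (rsf h) = x" unfolding bracket_rsf[OF entire_formsD(1)[OF h(1)]] g(2) .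
  thus ?thesis using rsf_carrier[OF h(1)] by blast
qed

lemma mixed: "mixed_complex Th (bracket_f \<Sigma> \<rho> e) (bv \<Sigma> \<rho> e) (twisted_d \<Sigma> \<rho> e)"
proof (rule mixed_complex.intro)
  show "vspace (Th i)" for i by (rule vspace_Theta)
next
  fix i
  show "lin_map (Th i) (Th (i - 1)) (bracket_f \<Sigma> \<rho> e)"
    unfolding lin_map_def
  proof (intro conjI ballI allI)
    fix x c assume "x \<in> carrier (Th i)"
    then obtain g where g: "g \<in> entire_forms i" and x: "x = rsf g" by (rule carrier_Theta_E)
    note B = bracket_rsf[OF entire_formsD(1)]
    show "bracket_f \<Sigma> \<rho> e x \<in> carrier (Th (i - 1))" unfolding x B[OF g] by (intro rsf_carrier br_entire g)
    show "bracket_f \<Sigma> \<rho> e (c \<odot>\<^bsub>Th i\<^esub> x) = c \<odot>\<^bsub>Th (i - 1)\<^esub> bracket_f \<Sigma> \<rho> e x"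
      unfolding x Theta_smult[OF g] B[OF g] B[OF scale_entire_forms[OF g]] Theta_smult[OF br_entire[OF g]]
      by (simp add: br_def contr_scale)
    fix y assume "y \<in> carrier (Th i)"
    then obtain h where h: "h \<in> entire_forms i" and y: "y = rsf h" by (rule carrier_Theta_E)
    show "bracket_f \<Sigma> \<rho> e (x \<oplus>\<^bsub>Th i\<^esub> y) = bracket_f \<Sigma> \<rho> e x \<oplus>\<^bsub>Th (i - 1)\<^esub> bracket_f \<Sigma> \<rho> e y"
      unfolding x y Theta_add[OF g h] B[OF g] B[OF h] B[OF add_entire_forms[OF g h]] Theta_add[OF br_entire[OF g] br_entire[OF h]]
      by (simp add: br_def contr_add)
  qed
  show "lin_map (Th i) (Th (i - 1)) (bv \<Sigma> \<rho> e)"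
    unfolding lin_map_def
  proof (intro conjI ballI allI)
    fix x c assume "x \<in> carrier (Th i)"
    then obtain g where g: "g \<in> entire_forms i" and x: "x = rsf g" by (rule carrier_Theta_E)
    note B = bv_rsf[OF entire_formsD(1)]
    show "bv \<Sigma> \<rho> e x \<in> carrier (Th (i - 1))" unfolding x B[OF g] by (intro rsf_carrier bva_entire g)
    show "bv \<Sigma> \<rho> e (c \<odot>\<^bsub>Th i\<^esub> x) = c \<odot>\<^bsub>Th (i - 1)\<^esub> bv \<Sigma> \<rho> e x"
      unfolding x Theta_smult[OF g] B[OF g] B[OF scale_entire_forms[OF g]] Theta_smult[OF bva_entire[OF g]] bva_scale[OF g, abs_def] ..
    fix y assume "y \<in> carrier (Th i)"
    then obtain h where h: "h \<in> entire_forms i" and y: "y = rsf h" by (rule carrier_Theta_E)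
    show "bv \<Sigma> \<rho> e (x \<oplus>\<^bsub>Th i\<^esub> y) = bv \<Sigma> \<rho> e x \<oplus>\<^bsub>Th (i - 1)\<^esub> bv \<Sigma> \<rho> e y"
      unfolding x y Theta_add[OF g h] B[OF g] B[OF h] B[OF add_entire_forms[OF g h]] Theta_add[OF bva_entire[OF g] bva_entire[OF h]]
        bva_add[OF g h, abs_def] ..
  qed
next
  fix x i assume "x \<in> carrier (Th i)"
  then obtain g where g: "g \<in> entire_forms i" and x: "x = rsf g" by (rule carrier_Theta_E)
  note B = bracket_rsf[OF entire_formsD(1)] and V = bv_rsf[OF entire_formsD(1)]
  note bg = br_entire[OF g] and vg = bva_entire[OF g]
  show "bracket_f \<Sigma> \<rho> e (bracket_f \<Sigma> \<rho> e x) = \<zero>\<^bsub>Th (i - 2)\<^esub>"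
    unfolding x B[OF g] B[OF bg] Theta_zero by (simp add: br_def contr_contr)
  show "bv \<Sigma> \<rho> e (bv \<Sigma> \<rho> e x) = \<zero>\<^bsub>Th (i - 2)\<^esub>"
    unfolding x V[OF g] V[OF vg] Theta_zero bva_bva[OF g, abs_def] ..
  show "bracket_f \<Sigma> \<rho> e (bv \<Sigma> \<rho> e x) \<oplus>\<^bsub>Th (i - 2)\<^esub> bv \<Sigma> \<rho> e (bracket_f \<Sigma> \<rho> e x) = \<zero>\<^bsub>Th (i - 2)\<^esub>"
    unfolding x B[OF g] V[OF g] B[OF vg] V[OF bg] Theta_add[OF br_entire[OF vg] bva_entire[OF bg]] Theta_zero
      br_bva[OF g, abs_def] ..
next
  fix i :: int assume i: "i < 0"
  have "g = (\<lambda>_ _. 0)" if "g \<in> entire_forms i" for g :: "'n set \<Rightarrow> complex ^ 'd \<Rightarrow> complex"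
    by (rule ext, rule entire_formsD(2)[OF that]) (use i in linarith)
  thus "carrier (Th i) = {\<zero>\<^bsub>Th i\<^esub>}"
    unfolding Theta_zero using rsf_carrier[OF zero_entire_forms] by (auto elim!: carrier_Theta_E)
next
  show "i \<ge> 1 \<Longrightarrow> x \<in> carrier (Th i) \<Longrightarrow> bracket_f \<Sigma> \<rho> e x = \<zero>\<^bsub>Th (i - 1)\<^esub> \<Longrightarrow>
     \<exists>y\<in>carrier (Th (i + 1)). bracket_f \<Sigma> \<rho> e y = x" for i x
    by (rule koszul_exact)
next
  \<comment> \<open>The addition of \<open>Th\<close> is given by the same formula in all degrees,
    so the equation holds for every sequence \<open>Y\<close>.\<close>
  show "twisted_d \<Sigma> \<rho> e Y = (\<lambda>j. case j of 0 \<Rightarrow> bracket_f \<Sigma> \<rho> e (Y 0)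
     | Suc k \<Rightarrow> bracket_f \<Sigma> \<rho> e (Y (Suc k)) \<oplus>\<^bsub>Th (i - 1)\<^esub> bv \<Sigma> \<rho> e (Y k))" for Y i
    by (auto simp: twisted_d_def Theta_def fun_eq_iff split: nat.split)
qed

end

theorem theorem2p5:
  fixes \<Sigma> :: "(real, 'n::{finite,linorder}) vec set set"
    and \<psi> :: "(real, 'n) vec \<Rightarrow> real"
    and \<rho> :: "'d::finite \<Rightarrow> (int, 'n) vec"
    and b :: "'n \<Rightarrow> 'd"
    and e :: "'n \<Rightarrow> (int, 'n) vec \<Rightarrow> int"
  assumes "smooth_fan \<Sigma>"
    and "complete_fan \<Sigma>"
    and "strictly_convex_PL \<Sigma> \<psi>"
    and "ray_generators \<Sigma> \<rho>"
    and "lattice_basis (\<lambda>k. \<rho> (b k))"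
    and "maximal_cone \<Sigma> (cone_gen (range (\<lambda>k. \<rho> (b k))))"
    and "dual_basis (\<lambda>k. \<rho> (b k)) e"
  shows "degenerates_at_E1 (Theta_u \<Sigma> \<rho>) (twisted_d \<Sigma> \<rho> e) (u_adic (Theta_u \<Sigma> \<rho>)) \<and>
    (\<forall>i. module_iso (homology (Theta_u \<Sigma> \<rho>) (twisted_d \<Sigma> \<rho> e) i)
           (pser_module (homology (Theta \<Sigma> \<rho>) (bracket_f \<Sigma> \<rho> e) i)))"
proof -
  interpret lg_model \<Sigma> \<psi> \<rho> b e
    by unfold_locales (use assms in auto)
  interpret M: mixed_complex "Theta \<Sigma> \<rho>" "bracket_f \<Sigma> \<rho> e" "bv \<Sigma> \<rho> e" "twisted_d \<Sigma> \<rho> e"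
    by (rule mixed)
  have "Theta_u \<Sigma> \<rho> = M.P" by (rule ext) (simp add: Theta_u_def)
  thus ?thesis using M.degenerates M.homology_iso by simp
qed

end
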